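(* Let $m,n\in\mathbf N$, $A_0,\dots,A_{m-1}\in\mathbb G^\infty_{n\times n}$, $t_0\in I$. The solution of the Cauchy problem $$X^{(m)}-A_{m-1}X^{(m-1)}-\dots-A_0X=F,\qquad X^{(k)}=X_k\ \text{ for } t<t_0,\quad 0\le k\le m-1,$$ depends continuously on $F\in\mathcal R^{n\times n\prime}$ (with $F=0$ for $t<t_0$) and on $X_k\in\mathbf C^{n\times n}$, $0\le k\le m-1$; that is, the map $(F,X_0,\dots,X_{m-1})\mapsto X$ from $\{F\in\mathcal R^{n\times n\prime}:F=0\text{ for }t<t_0\}\times(\mathbf C^{n\times n})^m$ to $\mathcal R^{n\times n\prime}$ is continuous.
   Context: $I=(a,b)\subset\mathbf R$ is an open interval (e.g. $I=\mathbf R$), $\mathbf N_0=\mathbf N\cup\{0\}$; functions are identified when equal almost everywhere. $\mathbb G$ is the algebra of essentially bounded $g:I\to\mathbf C$ possessing both limits $g(t\pm)=\operatorname{ess\,lim}_{s\to t\pm}g(s)$ at every $t\in I$; $\sigma_t(g):=g(t+)-g(t-)$. $\mathbb G^\infty$ is the algebra of $g\in\mathbb G$ such that for every $k\in\mathbf N$ there is $g^{(k)}\in\mathbb G$ with $g^{(k)}(t\pm)=\operatorname{ess\,lim}_{s\to t\pm}\frac{g^{(k-1)}(s)-g^{(k-1)}(t\pm)}{s-t}$ for all $t\in I$ ($g^{(0)}=g$), with the norms $\|g\|_k=\max_{0\le i\le k}\|g^{(i)}\|_{L_\infty}$, $k\in\mathbf N_0$. For $g\in\mathbb G$, $\operatorname{supp}(g)$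 is the closure in $I$ of $\{t: g(t-)\ne0\text{ or }g(t+)\ne0\}$. $\mathcal R$ is the space of $\varphi\in\mathbb G^\infty$ with compact support in $I$, with the locally convex inductive limit topology of the countably normed spaces $\{\varphi\in\mathbb G^\infty:\varphi=0\text{ outside }J\}$ (norms $\|\cdot\|_k$), $J$ running over bounded subintervals with $\bar J\subset I$. $\mathcal R'$ is the space of continuous linear functionals $f:\mathcal R\to\mathbf C$, $\varphi\mapsto(f,\varphi)$, with the weak* topology. For $g\in\mathbb G^\infty$, $f\in\mathcal R'$: $(gf,\varphi):=(f,g\varphi)$. For $\alpha\in\mathbf C$, $k\in\mathbf N_0$: $(\delta_{t_0}^{(k)\alpha},\varphi):=(-1)^k\bigl(\alpha\varphi^{(k)}(t_0+)+(1-\alpha)\varphi^{(k)}(t_0-)\bigr)$. Derivative: let $\mathbb C$ be the bounded continuous functions on $I$; $\mathbb F_k\subset\mathbb G^\infty$ is the set of $g$ with $g^{(i)}\in\mathbb C$ for all $i\ne k$ and $g^{(k)}$ piecewise continuous (locally finitely many discontinuities); $\mathbb F$ is the linear span of all $\mathbb F_k$, $k\in\mathbf N_0$; $\mathcal R_F=\mathcal R\cap\mathbb F$. $\Delta\subset\mathcal R'$ is the set of $g\in\mathcal R'$ for which there is $c:I\to\mathbf C$ with $(g,\varphi)=\sum_{t\in I}c(t)\sigma_t(\varphi)$ for all $\varphi\in\mathcal R_F$ (a finite sum). For $f\in\mathcal R'$ let $(\frac{df}{dt},\varphi):=-(f,\varphi')$; a derivative of $f$ is any element $f'$ of $D(f):=\frac{df}{dt}+\Delta$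 (differentiation is multivalued). Higher derivatives are defined inductively: $f^{(0)}=f$, $f^{(k+1)}\in D(f^{(k)})$; $f$ and a given $m$-th derivative $f^{(m)}$ determine the intermediate derivatives uniquely. $\mathcal R^{n\times n\prime}$ is the space of $n\times n$ matrices of elements of $\mathcal R'$ (entrywise weak* topology), $\mathbb G^\infty_{n\times n}$ the $n\times n$ matrices with entries in $\mathbb G^\infty$; operations are entrywise, with matrix products as usual. "$F=0$ for $t<t_0$" means $(F,\varphi)=0$ for all $\varphi\in\mathcal R$ with $\operatorname{supp}(\varphi)\subset(a,t_0)$. A solution of an $m$-th order equation $Z^{(m)}-\sum_{k<m}A_kZ^{(k)}=H$ is $Z\in\mathcal R^{n\times n\prime}$ possessing an $m$-th derivative $Z^{(m)}$ (with intermediate derivatives $Z',\dots,Z^{(m-1)}$) such that the equation holds as an identity on all $\varphi\in\mathcal R$; initial conditions refer to these derivatives. The solution of the Cauchy problem in the claim is by definition the unique solution $Z\in\mathcal R^{n\times n\prime}$ of $$Z^{(m)}-\sum_{j=0}^{m-1}X_j\delta_{t_0}^{(m-j-1)\alpha}-\sum_{k=0}^{m-1}A_k\Bigl(Z^{(k)}-\sum_{j=0}^{k-1}X_j\delta_{t_0}^{(k-j-1)\alpha}\Bigr)=F,\qquad Z^{(k)}=0\ (t<t_0),\ 0\le k\le m-1,$$ where $\alpha\in\mathbf C$ is arbitrary ($Z$ exists, is unique and does not depend on $\alpha$). *)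

theory Defs
  imports "HOL-Analysis.Analysis" "HOL-Probability.Essential_Supremum"
    "HOL-Library.Function_Algebras"
begin

text \<open>
  Throughout, \<open>I\<close> is an open interval of the real line. A class of functions on \<open>I\<close> modulo equality
  almost everywhere is represented by any of its members, taken as a total function
  \<open>real \<Rightarrow> complex\<close> whose values outside \<open>I\<close> are irrelevant. All predicates and function spaces
  below are invariant under \<open>ae_eq I\<close>, and functionals are required to respect it.
\<close>

definition ae_eq :: "real set \<Rightarrow> (real \<Rightarrow> complex) \<Rightarrow> (real \<Rightarrow> complex) \<Rightarrow> bool" where
  "ae_eq I g h \<longleftrightarrow> (AE t in lebesgue_on I. g t = h t)"

text \<open>\<open>(g \<longlongrightarrow> l) (ess_at_right t)\<close> unfolds to: for every \<open>e > 0\<close> there is \<open>d > 0\<close> such that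
  \<open>dist (g s) l < e\<close> for almost every \<open>s\<close> in \<open>{t<..<t+d}\<close>.\<close>

definition ess_at_right :: "real \<Rightarrow> real filter" where
  "ess_at_right t = inf (at_right t) (ae_filter lebesgue)"

definition ess_at_left :: "real \<Rightarrow> real filter" where
  "ess_at_left t = inf (at_left t) (ae_filter lebesgue)"

definition rlim :: "(real \<Rightarrow> complex) \<Rightarrow> real \<Rightarrow> complex" where
  "rlim g t = Lim (ess_at_right t) g"

definition llim :: "(real \<Rightarrow> complex) \<Rightarrow> real \<Rightarrow> complex" where
  "llim g t = Lim (ess_at_left t) g"

definition jump :: "real \<Rightarrow> (real \<Rightarrow> complex) \<Rightarrow> complex" where
  "jump t g = rlim g t - llim g t"


section \<open>Test functions\<close>

definition GG :: "real set \<Rightarrow> (real \<Rightarrow> complex) set" where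
  "GG I = {g. g \<in> borel_measurable (lebesgue_on I) \<and>
              (\<exists>C. AE t in lebesgue_on I. norm (g t) \<le> C) \<and>
              (\<forall>t\<in>I. (\<exists>l. (g \<longlongrightarrow> l) (ess_at_right t)) \<and> (\<exists>l. (g \<longlongrightarrow> l) (ess_at_left t)))}"

text \<open>\<open>h\<close> is the derivative of \<open>g\<close> in the sense of one-sided essential limits of difference quotients;
  \<open>h\<close> is unique up to \<open>ae_eq I\<close>.\<close>

definition has_uderiv :: "real set \<Rightarrow> (real \<Rightarrow> complex) \<Rightarrow> (real \<Rightarrow> complex) \<Rightarrow> bool" where
  "has_uderiv I g h \<longleftrightarrow> h \<in> GG I \<and>
     (\<forall>t\<in>I. ((\<lambda>s. (g s - rlim g t) / of_real (s - t)) \<longlongrightarrow> rlim h t) (ess_at_right t) \<and>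
            ((\<lambda>s. (g s - llim g t) / of_real (s - t)) \<longlongrightarrow> llim h t) (ess_at_left t))"

definition GGinf :: "real set \<Rightarrow> (real \<Rightarrow> complex) set" where
  "GGinf I = {g \<in> GG I. \<exists>D :: nat \<Rightarrow> real \<Rightarrow> complex. D 0 = g \<and> (\<forall>k. has_uderiv I (D k) (D (Suc k)))}"

definition uderiv :: "real set \<Rightarrow> (real \<Rightarrow> complex) \<Rightarrow> (real \<Rightarrow> complex)" where
  "uderiv I g = (SOME h. has_uderiv I g h)"

definition uderivs :: "real set \<Rightarrow> nat \<Rightarrow> (real \<Rightarrow> complex) \<Rightarrow> (real \<Rightarrow> complex)" where
  "uderivs I k = uderiv I ^^ k"

definition Linf_norm :: "real set \<Rightarrow> (real \<Rightarrow> complex) \<Rightarrow> real" where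
  "Linf_norm I g = real_of_ereal (esssup (lebesgue_on I) (\<lambda>t. ereal (norm (g t))))"

definition GG_norm :: "real set \<Rightarrow> nat \<Rightarrow> (real \<Rightarrow> complex) \<Rightarrow> real" where
  "GG_norm I k g = Max ((\<lambda>i. Linf_norm I (uderivs I i g)) ` {..k})"

definition gsupp :: "real set \<Rightarrow> (real \<Rightarrow> complex) \<Rightarrow> real set" where
  "gsupp I g = I \<inter> closure {t \<in> I. llim g t \<noteq> 0 \<or> rlim g t \<noteq> 0}"

definition RR :: "real set \<Rightarrow> (real \<Rightarrow> complex) set" where
  "RR I = {\<phi> \<in> GGinf I. compact (gsupp I \<phi>)}"

definition RR_on :: "real set \<Rightarrow> real set \<Rightarrow> (real \<Rightarrow> complex) set" where
  "RR_on I J = {\<phi> \<in> GGinf I. AE t in lebesgue_on I. t \<notin> J \<longrightarrow> \<phi> t = 0}"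

text \<open>The locally convex inductive limit topology: the absolutely convex sets that meet every step
  \<open>RR_on I J\<close> in a neighbourhood of zero for the norms \<open>GG_norm I k\<close> (which increase with \<open>k\<close>)
  form a base of neighbourhoods of zero.\<close>

definition zero_nbhd :: "real set \<Rightarrow> (real \<Rightarrow> complex) set \<Rightarrow> bool" where
  "zero_nbhd I V \<longleftrightarrow> V \<subseteq> RR I \<and>
     (\<forall>u\<in>V. \<forall>v\<in>V. \<forall>c d :: complex. norm c + norm d \<le> 1 \<longrightarrow> (\<lambda>t. c * u t + d * v t) \<in> V) \<and>
     (\<forall>J. is_interval J \<and> bounded J \<and> closure J \<subseteq> I \<longrightarrow>
        (\<exists>k. \<exists>e>0. {\<phi> \<in> RR_on I J. GG_norm I k \<phi> < e} \<subseteq> V))"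

definition RR_open :: "real set \<Rightarrow> (real \<Rightarrow> complex) set \<Rightarrow> bool" where
  "RR_open I U \<longleftrightarrow> U \<subseteq> RR I \<and> (\<forall>\<phi>\<in>U. \<exists>V. zero_nbhd I V \<and> (\<lambda>v. \<phi> + v) ` V \<subseteq> U)"

definition RR_topology :: "real set \<Rightarrow> (real \<Rightarrow> complex) topology" where
  "RR_topology I = topology (RR_open I)"

lemma zero_nbhd_Int:
  assumes "zero_nbhd I V" "zero_nbhd I W"
  shows "zero_nbhd I (V \<inter> W)"
  unfolding zero_nbhd_def
proof (intro conjI allI impI)
  fix J assume J: "is_interval J \<and> bounded J \<and> closure J \<subseteq> I"
  obtain k e where 1: "e > 0" "{\<phi> \<in> RR_on I J. GG_norm I k \<phi> < e} \<subseteq> V"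
    using assms(1) J unfolding zero_nbhd_def by meson
  obtain l d where 2: "d > 0" "{\<phi> \<in> RR_on I J. GG_norm I l \<phi> < d} \<subseteq> W"
    using assms(2) J unfolding zero_nbhd_def by meson
  have mono: "GG_norm I i \<phi> \<le> GG_norm I (max k l) \<phi>" if "i \<le> max k l" for i \<phi>
    unfolding GG_norm_def using that by (intro Max_mono image_mono) auto
  have "{\<phi> \<in> RR_on I J. GG_norm I (max k l) \<phi> < min e d} \<subseteq> V \<inter> W"
  proof
    fix \<phi> assume "\<phi> \<in> {\<phi> \<in> RR_on I J. GG_norm I (max k l) \<phi> < min e d}"
    then show "\<phi> \<in> V \<inter> W"
      using mono[of k \<phi>] mono[of l \<phi>] 1(2) 2(2) by force
  qed
  then show "\<exists>k. \<exists>e>0. {\<phi> \<in> RR_on I J. GG_norm I k \<phi> < e} \<subseteq> V \<inter> W"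
    using 1(1) 2(1) by (intro exI[of _ "max k l"] exI[of _ "min e d"]) auto
next
  show "V \<inter> W \<subseteq> RR I"
    using assms(1) unfolding zero_nbhd_def by blast
next
  show "\<forall>u\<in>V \<inter> W. \<forall>v\<in>V \<inter> W. \<forall>c d :: complex.
          norm c + norm d \<le> 1 \<longrightarrow> (\<lambda>t. c * u t + d * v t) \<in> V \<inter> W"
    using assms unfolding zero_nbhd_def by simp
qed

lemma istopology_RR_open: "istopology (RR_open I)"
  unfolding istopology_def
proof (intro conjI allI impI)
  fix S T assume S: "RR_open I S" and T: "RR_open I T"
  show "RR_open I (S \<inter> T)"
    unfolding RR_open_def
  proof (intro conjI ballI)
    show "S \<inter> T \<subseteq> RR I"
      using S unfolding RR_open_def by blast
    fix \<phi> assume p: "\<phi> \<in> S \<inter> T"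
    obtain V where "zero_nbhd I V" "(\<lambda>v. \<phi> + v) ` V \<subseteq> S"
      using S p unfolding RR_open_def by blast
    moreover obtain W where "zero_nbhd I W" "(\<lambda>v. \<phi> + v) ` W \<subseteq> T"
      using T p unfolding RR_open_def by blast
    ultimately show "\<exists>V. zero_nbhd I V \<and> (\<lambda>v. \<phi> + v) ` V \<subseteq> S \<inter> T"
      using zero_nbhd_Int by (intro exI[of _ "V \<inter> W"]) blast
  qed
next
  fix K assume "\<forall>S\<in>K. RR_open I S"
  then show "RR_open I (\<Union>K)"
    unfolding RR_open_def by (meson Sup_le_iff UnionE Union_upper subset_trans)
qed

lemma openin_RR_topology: "openin (RR_topology I) U \<longleftrightarrow> RR_open I U"
  by (simp add: RR_topology_def topology_inverse' istopology_RR_open)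


section \<open>Distributions\<close>

text \<open>Functionals are extended by zero outside \<open>RR I\<close>, so that equality of elements of the dual
  is equality in HOL.\<close>

definition RR_dual :: "real set \<Rightarrow> ((real \<Rightarrow> complex) \<Rightarrow> complex) set" where
  "RR_dual I = {f.
     (\<forall>\<phi>\<in>RR I. \<forall>\<psi>\<in>RR I. ae_eq I \<phi> \<psi> \<longrightarrow> f \<phi> = f \<psi>) \<and>
     (\<forall>\<phi>\<in>RR I. \<forall>\<psi>\<in>RR I. \<forall>c d. f (\<lambda>t. c * \<phi> t + d * \<psi> t) = c * f \<phi> + d * f \<psi>) \<and>
     continuous_map (RR_topology I) euclidean f \<and>
     (\<forall>\<phi>. \<phi> \<notin> RR I \<longrightarrow> f \<phi> = 0)}"

definition weak_star :: "real set \<Rightarrow> ((real \<Rightarrow> complex) \<Rightarrow> complex) topology" where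
  "weak_star I = pullback_topology (RR_dual I) (\<lambda>f. restrict f (RR I))
                   (product_topology (\<lambda>_. euclidean) (RR I))"

definition mult_dist :: "real set \<Rightarrow> (real \<Rightarrow> complex) \<Rightarrow> ((real \<Rightarrow> complex) \<Rightarrow> complex) \<Rightarrow>
    ((real \<Rightarrow> complex) \<Rightarrow> complex)" where
  "mult_dist I g f = (\<lambda>\<phi>. if \<phi> \<in> RR I then f (\<lambda>t. g t * \<phi> t) else 0)"

definition delta :: "real set \<Rightarrow> real \<Rightarrow> nat \<Rightarrow> complex \<Rightarrow> ((real \<Rightarrow> complex) \<Rightarrow> complex)" where
  "delta I t0 k \<alpha> = (\<lambda>\<phi>. if \<phi> \<in> RR I
     then (-1) ^ k * (\<alpha> * rlim (uderivs I k \<phi>) t0 + (1 - \<alpha>) * llim (uderivs I k \<phi>) t0) else 0)"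

definition bdd_continuous :: "real set \<Rightarrow> (real \<Rightarrow> complex) set" where
  "bdd_continuous I = {g. \<exists>h. ae_eq I g h \<and> continuous_on I h \<and> bounded (h ` I)}"

definition piecewise_continuous :: "real set \<Rightarrow> (real \<Rightarrow> complex) set" where
  "piecewise_continuous I = {g \<in> GG I. \<exists>h S. ae_eq I g h \<and> S \<subseteq> I \<and>
     (\<forall>K. compact K \<and> K \<subseteq> I \<longrightarrow> finite (K \<inter> S)) \<and> continuous_on (I - S) h}"

definition FF_k :: "real set \<Rightarrow> nat \<Rightarrow> (real \<Rightarrow> complex) set" where
  "FF_k I k = {g \<in> GGinf I. (\<forall>i. i \<noteq> k \<longrightarrow> uderivs I i g \<in> bdd_continuous I) \<and>
                            uderivs I k g \<in> piecewise_continuous I}"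

definition FF :: "real set \<Rightarrow> (real \<Rightarrow> complex) set" where
  "FF I = module.span (\<lambda>(c :: complex) g t. c * g t) (\<Union>k. FF_k I k)"

definition RR_F :: "real set \<Rightarrow> (real \<Rightarrow> complex) set" where
  "RR_F I = RR I \<inter> FF I"

text \<open>Test functions in \<open>RR_F I\<close> have finitely many jumps, so the sum below is finite.\<close>

definition Delta :: "real set \<Rightarrow> ((real \<Rightarrow> complex) \<Rightarrow> complex) set" where
  "Delta I = {g \<in> RR_dual I. \<exists>c :: real \<Rightarrow> complex.
     \<forall>\<phi>\<in>RR_F I. g \<phi> = (\<Sum>t\<in>{t \<in> I. jump t \<phi> \<noteq> 0}. c t * jump t \<phi>)}"

definition ddt :: "real set \<Rightarrow> ((real \<Rightarrow> complex) \<Rightarrow> complex) \<Rightarrow> ((real \<Rightarrow> complex) \<Rightarrow> complex)" where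
  "ddt I f = (\<lambda>\<phi>. if \<phi> \<in> RR I then - f (uderiv I \<phi>) else 0)"

definition derivs :: "real set \<Rightarrow> ((real \<Rightarrow> complex) \<Rightarrow> complex) \<Rightarrow>
    ((real \<Rightarrow> complex) \<Rightarrow> complex) set" where
  "derivs I f = {ddt I f + g | g. g \<in> Delta I}"


section \<open>Matrix distributions and the Cauchy problem\<close>

type_synonym 'n mat_dist = "((real \<Rightarrow> complex) \<Rightarrow> complex) ^ 'n ^ 'n"

definition mat_dual :: "real set \<Rightarrow> ('n::finite) mat_dist set" where
  "mat_dual I = {Z. \<forall>i j. Z $ i $ j \<in> RR_dual I}"

definition mat_weak_star :: "real set \<Rightarrow> ('n::finite) mat_dist topology" where
  "mat_weak_star I = pullback_topology (mat_dual I) (\<lambda>Z. \<lambda>(i, j). Z $ i $ j)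
                       (product_topology (\<lambda>_. weak_star I) (UNIV :: ('n \<times> 'n) set))"

definition fun_mult :: "real set \<Rightarrow> (real \<Rightarrow> complex) ^ 'n ^ 'n \<Rightarrow> ('n::finite) mat_dist \<Rightarrow>
    'n mat_dist" where
  "fun_mult I A Z = (\<chi> i j. \<Sum>p\<in>UNIV. mult_dist I (A $ i $ p) (Z $ p $ j))"

definition const_mult :: "complex ^ 'n ^ 'n \<Rightarrow> ((real \<Rightarrow> complex) \<Rightarrow> complex) \<Rightarrow>
    ('n::finite) mat_dist" where
  "const_mult X f = (\<chi> i j. (\<lambda>\<phi>. X $ i $ j * f \<phi>))"

definition zero_before :: "real set \<Rightarrow> real \<Rightarrow> ('n::finite) mat_dist \<Rightarrow> bool" where
  "zero_before I t0 Z \<longleftrightarrow> (\<forall>\<phi>\<in>RR I. gsupp I \<phi> \<subseteq> I \<inter> {..<t0} \<longrightarrow> (\<forall>i j. (Z $ i $ j) \<phi> = 0))"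

text \<open>\<open>Y 0, \<dots>, Y m\<close> are a distribution together with successive (multivalued) derivatives.\<close>

definition deriv_chain :: "real set \<Rightarrow> nat \<Rightarrow> (nat \<Rightarrow> ('n::finite) mat_dist) \<Rightarrow> bool" where
  "deriv_chain I m Y \<longleftrightarrow> Y 0 \<in> mat_dual I \<and>
     (\<forall>k<m. \<forall>i j. Y (Suc k) $ i $ j \<in> derivs I (Y k $ i $ j))"

definition cauchy_solution :: "real set \<Rightarrow> nat \<Rightarrow> (nat \<Rightarrow> (real \<Rightarrow> complex) ^ 'n ^ 'n) \<Rightarrow> real \<Rightarrow>
    complex \<Rightarrow> ('n::finite) mat_dist \<Rightarrow> (nat \<Rightarrow> complex ^ 'n ^ 'n) \<Rightarrow> 'n mat_dist \<Rightarrow> bool" where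
  "cauchy_solution I m A t0 \<alpha> F X Z \<longleftrightarrow>
     (\<exists>Y. Y 0 = Z \<and> deriv_chain I m Y \<and>
        Y m - (\<Sum>j<m. const_mult (X j) (delta I t0 (m - j - 1) \<alpha>))
            - (\<Sum>k<m. fun_mult I (A k)
                 (Y k - (\<Sum>j<k. const_mult (X j) (delta I t0 (k - j - 1) \<alpha>)))) = F \<and>
        (\<forall>k<m. zero_before I t0 (Y k)))"

end

theory Submission
  imports Defs
begin

text \<open>
  Fix \<open>c < t0\<close> in \<open>I\<close> and let \<open>PP \<psi> t = \<integral>\<^sub>t\<^sup>\<infinity> \<psi>\<close> for \<open>t \<ge> c\<close> and \<open>0\<close> for \<open>t < c\<close>. Among distributions
  that vanish before \<open>t0\<close>, \<open>f'\<close> is a derivative of \<open>f\<close> if and only if \<open>f = f' \<circ> PP\<close>. Indeed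
  \<open>f' - df/dt\<close> evaluated at \<open>\<phi>\<close> is \<open>f' (\<phi> + PP \<phi>')\<close>, and for \<open>\<phi>\<close> in \<open>RR_F I\<close> the function
  \<open>\<phi> + PP \<phi>'\<close> is, beyond \<open>c\<close>, a step function made of the jumps of \<open>\<phi>\<close>; conversely an element of \<open>\<Delta>\<close> that vanishes before \<open>t0\<close> kills the range of \<open>PP\<close>, because
  functions \<open>PP \<chi>\<close> with \<open>\<chi>\<close> piecewise polynomial are dense there and jump at \<open>c\<close> only.

  The Cauchy problem thereby becomes \<open>V \<circ> (1 - K) = H\<close>, where \<open>V\<close> is the highest derivative with its
  delta part removed and \<open>K \<Phi> = \<Sum>\<^sub>k PP\<^sup>m\<^sup>-\<^sup>k (A\<^sub>k \<Phi>)\<close> is a Volterra operator on test functions. As \<open>1 - K\<close> is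
  bijective (modulo null sets) with a continuous inverse, \<open>X = V \<circ> PP\<^sup>m + \<dots>\<close> evaluated at a fixed test function is
  a finite sum of values of \<open>F\<close> at fixed test functions and of entries of the \<open>X\<^sub>k\<close> times constants.
\<close>

section \<open>One-sided essential limits\<close>

text \<open>A primitive of a test function need not have compact support; cutting it off at
  \<open>c\<close> repairs this at the price of a jump at \<open>c\<close>. With \<open>c\<close>
  strictly before \<open>t0\<close> that jump does no harm: a functional in \<open>\<Delta>\<close>
  that vanishes before \<open>t0\<close> has coefficient 0 at \<open>c\<close>. Membership in
  \<open>\<Delta>\<close> constrains a functional only through its values on \<open>RR_F I\<close>,
  where each summand may be discontinuous in a single derivative; a general \<open>PP \<psi>\<close>
  is a limit of such functions, not one of them, and so an approximation in each of the norms is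
  needed. For the approximants to lie in \<open>FF I\<close>, their building blocks must be bounded
  with all derivatives on the whole of \<open>I\<close>, which polynomials are not when
  \<open>I\<close> is unbounded; hence the logistic function. The Volterra operator becomes a
  contraction under the weight \<open>exp (L * (w - t))\<close>, and since it gains a derivative,
  the bound of order 0 propagates to every order.\<close>

definition ess :: "bool \<Rightarrow> real \<Rightarrow> real filter" where
  "ess b t = (if b then ess_at_right t else ess_at_left t)"

text \<open>Coding the side as a Boolean lets every statement about one-sided limits be proved once
  for both sides.\<close>

definition slim :: "bool \<Rightarrow> (real \<Rightarrow> complex) \<Rightarrow> real \<Rightarrow> complex" where
  "slim b g t = Lim (ess b t) g"

lemma slim_True: "slim True g t = rlim g t"
  and slim_False: "slim False g t = llim g t"
  by (simp_all add: slim_def rlim_def llim_def ess_def)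

definition side :: "bool \<Rightarrow> real \<Rightarrow> real \<Rightarrow> real set" where
  "side b t d = (if b then {t<..<t+d} else {t-d<..<t})"

lemma side_mono: "d \<le> e \<Longrightarrow> side b t d \<subseteq> side b t e"
  by (auto simp: side_def)

text \<open>A set in the infimum of two filters contains an intersection of members, here of a
  one-sided neighbourhood and a conull set. All later arguments use this measure-theoretic
  form.\<close>

lemma eventually_ess:
  "eventually P (ess b t) \<longleftrightarrow> (\<exists>d>0. AE s in lebesgue. s \<in> side b t d \<longrightarrow> P s)"
proof
  assume "eventually P (ess b t)"
  then obtain Q R where Q: "eventually Q (if b then at_right t else at_left t)"
    and R: "AE s in lebesgue. R s" and QR: "\<And>s. Q s \<Longrightarrow> R s \<Longrightarrow> P s"
    by (cases b) (auto simp: ess_def ess_at_right_def ess_at_left_def eventually_inf)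
  have "\<exists>d>0. \<forall>s\<in>side b t d. Q s"
  proof (cases b)
    case True
    then obtain e where "e > t" "\<forall>y>t. y < e \<longrightarrow> Q y"
      using Q by (auto simp: eventually_at_right_field)
    then show ?thesis using True by (intro exI[of _ "e - t"]) (auto simp: side_def)
  next
    case False
    then obtain e where "e < t" "\<forall>y>e. y < t \<longrightarrow> Q y"
      using Q by (auto simp: eventually_at_left_field)
    then show ?thesis using False by (intro exI[of _ "t - e"]) (auto simp: side_def)
  qed
  then obtain d where "d > 0" "\<forall>s\<in>side b t d. Q s" by blast
  then show "\<exists>d>0. AE s in lebesgue. s \<in> side b t d \<longrightarrow> P s"
    using R QR by (intro exI[of _ d]) (auto elim!: eventually_mono)
next
  assume "\<exists>d>0. AE s in lebesgue. s \<in> side b t d \<longrightarrow> P s"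
  then obtain d where d: "d > 0" "AE s in lebesgue. s \<in> side b t d \<longrightarrow> P s" by blast
  have "eventually (\<lambda>s. s \<in> side b t d) (if b then at_right t else at_left t)"
  proof (cases b)
    case True
    then show ?thesis using d(1)
      by (auto simp: eventually_at_right_field side_def intro!: exI[of _ "t + d"])
  next
    case False
    then show ?thesis using d(1)
      by (auto simp: eventually_at_left_field side_def intro!: exI[of _ "t - d"])
  qed
  then show "eventually P (ess b t)"
    using d(2) by (cases b) (auto simp: ess_def ess_at_right_def ess_at_left_def eventually_inf)
qed

lemma eventually_side: "d > 0 \<Longrightarrow> eventually (\<lambda>s. s \<in> side b t d) (ess b t)"
  unfolding eventually_ess by auto

lemma not_AE_False_side:
  assumes "d > 0"
  shows "\<not> (AE s in lebesgue. s \<notin> side b t d)"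
proof
  assume *: "AE s in lebesgue. s \<notin> side b t d"
  have "emeasure lebesgue {s \<in> space lebesgue. s \<in> side b t d} = 0"
    using * by (intro emeasure_eq_0_AE) simp
  then show False using assms by (auto simp: side_def split: if_splits)
qed

text \<open>One-sided intervals have positive measure, so they meet every conull set. This is what
  makes essential limits unique.\<close>

lemma ess_nontrivial [simp]: "ess b t \<noteq> bot"
proof
  assume "ess b t = bot"
  then have "eventually (\<lambda>_. False) (ess b t)" by simp
  then show False unfolding eventually_ess using not_AE_False_side by auto
qed

lemma ess_le_at: "ess b t \<le> at t"
proof -
  have "ess_at_right t \<le> at_right t" "ess_at_left t \<le> at_left t"
    by (auto simp: ess_at_right_def ess_at_left_def)
  then show ?thesis
    using at_le[of "{t<..}" UNIV t] at_le[of "{..<t}" UNIV t] order_trans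
    unfolding ess_def by (auto split: if_splits)
qed

lemma slim_eqI: "(g \<longlongrightarrow> l) (ess b t) \<Longrightarrow> slim b g t = l"
  unfolding slim_def by (rule tendsto_Lim) simp_all

lemma eventually_ess_id: "eventually P (at t) \<Longrightarrow> eventually P (ess b t)"
  using ess_le_at filter_leD by blast

lemma AE_imp_eventually_ess:
  assumes "open I" "t \<in> I" "AE s in lebesgue_on I. P s"
  shows "eventually P (ess b t)"
proof -
  obtain d where d: "d > 0" "ball t d \<subseteq> I" using assms(1,2) open_contains_ball by blast
  have "I \<in> sets lebesgue" using assms(1) by simp
  then have "AE s in lebesgue. s \<in> I \<longrightarrow> P s" using assms(3) by (simp add: AE_restrict_space_iff)
  moreover have "side b t d \<subseteq> I" using d(2) by (auto simp: side_def dist_real_def split: if_splits)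
  ultimately show ?thesis unfolding eventually_ess using d(1) by (intro exI[of _ d]) auto
qed

text \<open>Lindelof: countably many of the two-sided neighbourhoods cover \<open>I\<close>, and the centres form
  a null set.\<close>

lemma AE_ess_I:
  assumes "open I" and ev: "\<And>t b. t \<in> I \<Longrightarrow> eventually P (ess b t)"
  shows "AE s in lebesgue_on I. P s"
proof -
  have "\<exists>d>0. AE s in lebesgue. s \<in> ball t d \<longrightarrow> P s" if t: "t \<in> I" for t
  proof -
    obtain d1 where d1: "d1 > 0" "AE s in lebesgue. s \<in> side True t d1 \<longrightarrow> P s"
      using ev[OF t, of True] unfolding eventually_ess by blast
    obtain d2 where d2: "d2 > 0" "AE s in lebesgue. s \<in> side False t d2 \<longrightarrow> P s"
      using ev[OF t, of False] unfolding eventually_ess by blast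
    have "{t} \<in> null_sets lebesgue" by simp
    then have "AE s in lebesgue. s \<noteq> t" using AE_not_in by fastforce
    then have "AE s in lebesgue. s \<in> ball t (min d1 d2) \<longrightarrow> P s"
      using d1(2) d2(2) by eventually_elim (auto simp: side_def dist_real_def)
    then show ?thesis using d1(1) d2(1) by (intro exI[of _ "min d1 d2"]) auto
  qed
  then obtain d where d: "\<And>t. t \<in> I \<Longrightarrow> d t > 0"
    "\<And>t. t \<in> I \<Longrightarrow> AE s in lebesgue. s \<in> ball t (d t) \<longrightarrow> P s" by metis
  obtain F where F: "F \<subseteq> (\<lambda>t. ball t (d t)) ` I" "countable F" "\<Union>F = (\<Union>t\<in>I. ball t (d t))"
    by (rule Lindelof[of "(\<lambda>t. ball t (d t)) ` I"]) auto
  have "AE s in lebesgue. \<forall>B\<in>F. s \<in> B \<longrightarrow> P s"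
    using F(1) d(2) by (subst AE_ball_countable[OF F(2)]) auto
  moreover have "I \<subseteq> \<Union>F" using F(3) d(1) by force
  ultimately have "AE s in lebesgue. s \<in> I \<longrightarrow> P s" by (auto elim!: eventually_mono)
  then show ?thesis using assms(1) by (simp add: AE_restrict_space_iff)
qed

lemma slim_cong:
  assumes "open I" "t \<in> I" "ae_eq I g h"
  shows "slim b g t = slim b h t" and "(g \<longlongrightarrow> l) (ess b t) \<longleftrightarrow> (h \<longlongrightarrow> l) (ess b t)"
proof -
  have ev: "eventually (\<lambda>s. g s = h s) (ess b t)"
    using AE_imp_eventually_ess[OF assms(1,2)] assms(3) unfolding ae_eq_def by blast
  then show eq: "(g \<longlongrightarrow> l) (ess b t) \<longleftrightarrow> (h \<longlongrightarrow> l) (ess b t)" for l by (rule tendsto_cong)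
  show "slim b g t = slim b h t" unfolding slim_def t2_space_class.Lim_def eq ..
qed

lemma GG_iff: "g \<in> GG I \<longleftrightarrow> g \<in> borel_measurable (lebesgue_on I) \<and>
   (\<exists>C. AE t in lebesgue_on I. norm (g t) \<le> C) \<and> (\<forall>t\<in>I. \<forall>b. \<exists>l. (g \<longlongrightarrow> l) (ess b t))"
  unfolding GG_def ess_def by (auto split: if_splits)

lemma has_uderiv_iff: "has_uderiv I g h \<longleftrightarrow> h \<in> GG I \<and>
   (\<forall>t\<in>I. \<forall>b. ((\<lambda>s. (g s - slim b g t) / of_real (s - t)) \<longlongrightarrow> slim b h t) (ess b t))"
proof -
  have *: "(\<forall>b. ((\<lambda>s. (g s - slim b g t) / of_real (s - t)) \<longlongrightarrow> slim b h t) (ess b t)) \<longleftrightarrow>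
     ((\<lambda>s. (g s - rlim g t) / of_real (s - t)) \<longlongrightarrow> rlim h t) (ess_at_right t) \<and>
     ((\<lambda>s. (g s - llim g t) / of_real (s - t)) \<longlongrightarrow> llim h t) (ess_at_left t)" for t
  proof -
    have "(\<forall>b. Q b) \<longleftrightarrow> Q True \<and> Q False" for Q by (metis (full_types))
    then show ?thesis by (simp add: slim_True slim_False ess_def)
  qed
  show ?thesis unfolding has_uderiv_def * ..
qed

section \<open>Algebra and differentiation of functions with one-sided essential limits\<close>

locale open_interval =
  fixes I :: "real set"
  assumes open_I: "open I" and interval_I: "is_interval I" and nonempty_I: "I \<noteq> {}"
begin

lemma I_lebesgue [simp, intro]: "I \<in> sets lebesgue"
  using open_I by simp

lemma AE_I: "(AE s in lebesgue_on I. P s) \<longleftrightarrow> (AE s in lebesgue. s \<in> I \<longrightarrow> P s)"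
  by (simp add: AE_restrict_space_iff)

lemma atLeastAtMost_subset_I: "u \<in> I \<Longrightarrow> v \<in> I \<Longrightarrow> {u..v} \<subseteq> I"
  using interval_I unfolding is_interval_1 by (meson atLeastAtMost_iff subsetI)

lemma ae_eq_refl [simp]: "ae_eq I g g"
  by (simp add: ae_eq_def)

lemma ae_eq_sym: "ae_eq I g h \<Longrightarrow> ae_eq I h g"
  by (auto simp: ae_eq_def elim: eventually_mono)

lemma ae_eq_trans [trans]: "ae_eq I f g \<Longrightarrow> ae_eq I g h \<Longrightarrow> ae_eq I f h"
  unfolding ae_eq_def by (elim AE_mp) (auto intro: AE_I2)

lemma ae_eqI: "(\<And>t. t \<in> I \<Longrightarrow> g t = h t) \<Longrightarrow> ae_eq I g h"
  by (auto simp: ae_eq_def intro: AE_I2)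

lemma GG_tendsto: "g \<in> GG I \<Longrightarrow> t \<in> I \<Longrightarrow> (g \<longlongrightarrow> slim b g t) (ess b t)"
  unfolding GG_iff using slim_eqI by metis

lemma GG_measurable: "g \<in> GG I \<Longrightarrow> g \<in> borel_measurable (lebesgue_on I)"
  unfolding GG_iff by blast

lemma GG_bounded:
  assumes "g \<in> GG I" obtains B where "0 \<le> B" "AE t in lebesgue_on I. norm (g t) \<le> B"
proof -
  obtain C where C: "AE t in lebesgue_on I. norm (g t) \<le> C" using assms unfolding GG_iff by blast
  have "AE t in lebesgue_on I. norm (g t) \<le> max 0 C" by (rule eventually_mono[OF C]) simp
  then show ?thesis using that[of "max 0 C"] by simp
qed

lemma GG_I:
  assumes "g \<in> borel_measurable (lebesgue_on I)" "AE t in lebesgue_on I. norm (g t) \<le> C"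
    "\<And>t b. t \<in> I \<Longrightarrow> \<exists>l. (g \<longlongrightarrow> l) (ess b t)"
  shows "g \<in> GG I"
  using assms unfolding GG_iff by blast

lemma slim_norm_le:
  assumes "g \<in> GG I" "t \<in> I" "eventually (\<lambda>s. norm (g s) \<le> B) (ess b t)"
  shows "norm (slim b g t) \<le> B"
  by (rule tendsto_upperbound[OF tendsto_norm[OF GG_tendsto[OF assms(1,2)]] assms(3)]) simp

lemma GG_ae_cong:
  assumes "g \<in> GG I" "ae_eq I g h" shows "h \<in> GG I"
proof -
  \<comment> \<open>Extending by zero passes to \<open>lebesgue\<close> on the whole line, whose
    completeness gives measurability of any function that agrees almost everywhere with a measurable
    one.\<close>
  have "(\<lambda>x. if x \<in> I then g x else 0) \<in> borel_measurable lebesgue"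
    using GG_measurable[OF assms(1)] by (simp add: borel_measurable_if)
  moreover have "AE x in lebesgue. (if x \<in> I then g x else 0) = (if x \<in> I then h x else 0)"
    using assms(2) unfolding ae_eq_def AE_I by eventually_elim auto
  ultimately have "(\<lambda>x. if x \<in> I then h x else 0) \<in> borel_measurable lebesgue"
    by (rule borel_measurable_AE)
  then have m: "h \<in> borel_measurable (lebesgue_on I)" by (simp add: borel_measurable_if)
  obtain B where B: "AE t in lebesgue_on I. norm (g t) \<le> B" using GG_bounded[OF assms(1)] .
  have "AE t in lebesgue_on I. norm (h t) \<le> B"
    using B assms(2) unfolding ae_eq_def by eventually_elim simp
  moreover have "\<exists>l. (h \<longlongrightarrow> l) (ess b t)" if "t \<in> I" for t b
    using slim_cong(2)[OF open_I that assms(2)] GG_tendsto[OF assms(1) that] by blast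
  ultimately show ?thesis using m by (intro GG_I) auto
qed

text \<open>The difference has essential limit 0 on both sides of every point, so
  \<open>AE_ess_I\<close> makes it smaller than each \<open>1 / (n + 1)\<close> almost everywhere;
  intersecting over \<open>n\<close> leaves 0. Classes of functions are thus determined by their
  one-sided limits.\<close>

lemma ae_eq_slimI:
  assumes "g \<in> GG I" "h \<in> GG I" "\<And>t b. t \<in> I \<Longrightarrow> slim b g t = slim b h t"
  shows "ae_eq I g h"
proof -
  have "AE s in lebesgue_on I. \<forall>n. norm (g s - h s) < inverse (real (Suc n))"
    unfolding AE_all_countable
  proof
    fix n :: nat
    show "AE s in lebesgue_on I. norm (g s - h s) < inverse (real (Suc n))"
    proof (rule AE_ess_I[OF open_I])
      fix t b assume t: "t \<in> I"
      have "((\<lambda>s. g s - h s) \<longlongrightarrow> 0) (ess b t)"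
        using tendsto_diff[OF GG_tendsto[OF assms(1) t, of b] GG_tendsto[OF assms(2) t, of b]]
        by (simp add: assms(3) t)
      then show "eventually (\<lambda>s. norm (g s - h s) < inverse (real (Suc n))) (ess b t)"
        by (auto simp: tendsto_iff dist_norm)
    qed
  qed
  then show ?thesis unfolding ae_eq_def
  proof (rule eventually_mono)
    fix s assume *: "\<forall>n. norm (g s - h s) < inverse (real (Suc n))"
    show "g s = h s"
    proof (rule ccontr)
      assume "g s \<noteq> h s"
      then obtain n where "inverse (real (Suc n)) < norm (g s - h s)"
        using reals_Archimedean[of "norm (g s - h s)"] by auto
      then show False using * by (meson less_asym)
    qed
  qed
qed

lemma GG_const [simp]: "(\<lambda>_. l) \<in> GG I"
  by (rule GG_I[of _ "norm l"]) auto

lemma slim_const [simp]: "slim b (\<lambda>_. l) t = l"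
  by (rule slim_eqI) simp

lemma slim_add: "f \<in> GG I \<Longrightarrow> g \<in> GG I \<Longrightarrow> t \<in> I \<Longrightarrow>
    slim b (\<lambda>s. f s + g s) t = slim b f t + slim b g t"
  by (rule slim_eqI) (intro tendsto_add GG_tendsto)

lemma slim_mult: "f \<in> GG I \<Longrightarrow> g \<in> GG I \<Longrightarrow> t \<in> I \<Longrightarrow>
    slim b (\<lambda>s. f s * g s) t = slim b f t * slim b g t"
  by (rule slim_eqI) (intro tendsto_mult GG_tendsto)

lemma slim_cmult: "g \<in> GG I \<Longrightarrow> t \<in> I \<Longrightarrow> slim b (\<lambda>s. l * g s) t = l * slim b g t"
  using slim_mult[OF GG_const] by simp

lemma slim_diff: "f \<in> GG I \<Longrightarrow> g \<in> GG I \<Longrightarrow> t \<in> I \<Longrightarrow>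
    slim b (\<lambda>s. f s - g s) t = slim b f t - slim b g t"
  by (rule slim_eqI) (intro tendsto_diff GG_tendsto)

lemma GG_add: assumes "f \<in> GG I" "g \<in> GG I" shows "(\<lambda>s. f s + g s) \<in> GG I"
proof -
  obtain B C where "AE t in lebesgue_on I. norm (f t) \<le> B" "AE t in lebesgue_on I. norm (g t) \<le> C"
    using GG_bounded assms by metis
  then have "AE t in lebesgue_on I. norm (f t + g t) \<le> B + C"
    by eventually_elim (meson add_mono norm_triangle_le)
  then show ?thesis
    using GG_measurable assms by (intro GG_I) (blast intro: borel_measurable_add tendsto_add GG_tendsto)+
qed

lemma GG_mult: assumes "f \<in> GG I" "g \<in> GG I" shows "(\<lambda>s. f s * g s) \<in> GG I"
proof -
  obtain B C where "0 \<le> B" and bd: "AE t in lebesgue_on I. norm (f t) \<le> B" "AE t in lebesgue_on I. norm (g t) \<le> C"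
    using GG_bounded assms by metis
  from bd have "AE t in lebesgue_on I. norm (f t * g t) \<le> B * C"
    by eventually_elim (use \<open>0 \<le> B\<close> in \<open>simp add: norm_mult mult_mono\<close>)
  then show ?thesis
    using GG_measurable assms by (intro GG_I) (blast intro: borel_measurable_times tendsto_mult GG_tendsto)+
qed

lemma GG_cmult: "g \<in> GG I \<Longrightarrow> (\<lambda>s. l * g s) \<in> GG I"
  using GG_mult[OF GG_const] by simp

lemma GG_sum: "(\<And>i. i \<in> A \<Longrightarrow> f i \<in> GG I) \<Longrightarrow> (\<lambda>s. \<Sum>i\<in>A. f i s) \<in> GG I"
  by (induction A rule: infinite_finite_induct) (auto intro: GG_add)

lemma has_uderiv_GG: "has_uderiv I g h \<Longrightarrow> h \<in> GG I"
  by (simp add: has_uderiv_iff)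

lemma has_uderivD: "has_uderiv I g h \<Longrightarrow> t \<in> I \<Longrightarrow>
    ((\<lambda>s. (g s - slim b g t) / of_real (s - t)) \<longlongrightarrow> slim b h t) (ess b t)"
  by (simp add: has_uderiv_iff)

lemma has_uderiv_cong:
  assumes "has_uderiv I g h" "ae_eq I g g'" "ae_eq I h h'"
  shows "has_uderiv I g' h'"
  unfolding has_uderiv_iff
proof (intro conjI ballI allI)
  show "h' \<in> GG I" using assms GG_ae_cong has_uderiv_GG by blast
  fix t b assume t: "t \<in> I"
  have ev: "ae_eq I (\<lambda>s. (g s - slim b g t) / of_real (s - t)) (\<lambda>s. (g' s - slim b g' t) / of_real (s - t))"
    using assms(2) unfolding ae_eq_def slim_cong(1)[OF open_I t assms(2)]
    by eventually_elim simp
  show "((\<lambda>s. (g' s - slim b g' t) / complex_of_real (s - t)) \<longlongrightarrow> slim b h' t) (ess b t)"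
    unfolding slim_cong(2)[OF open_I t ev, symmetric] slim_cong(1)[OF open_I t assms(3), symmetric]
    by (rule has_uderivD[OF assms(1) t])
qed

lemma has_uderiv_unique:
  assumes "has_uderiv I g h" "has_uderiv I g h'" shows "ae_eq I h h'"
proof (rule ae_eq_slimI)
  show "slim b h t = slim b h' t" if "t \<in> I" for t b
    by (rule tendsto_unique[OF _ has_uderivD[OF assms(1) that] has_uderivD[OF assms(2) that]]) simp
qed (use assms has_uderiv_GG in auto)

lemma has_uderiv_add:
  assumes "has_uderiv I f f'" "has_uderiv I g g'" "f \<in> GG I" "g \<in> GG I"
  shows "has_uderiv I (\<lambda>s. f s + g s) (\<lambda>s. f' s + g' s)"
  unfolding has_uderiv_iff
proof (intro conjI ballI allI)
  show "(\<lambda>s. f' s + g' s) \<in> GG I" using assms has_uderiv_GG GG_add by blast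
  fix t b assume t: "t \<in> I"
  show "((\<lambda>s. (f s + g s - slim b (\<lambda>s. f s + g s) t) / of_real (s - t)) \<longlongrightarrow>
      slim b (\<lambda>s. f' s + g' s) t) (ess b t)"
    using tendsto_add[OF has_uderivD[OF assms(1) t, of b] has_uderivD[OF assms(2) t, of b]]
    unfolding slim_add[OF assms(3,4) t] slim_add[OF has_uderiv_GG[OF assms(1)] has_uderiv_GG[OF assms(2)] t]
      add_diff_add add_divide_distrib .
qed

lemma has_uderiv_mult:
  assumes "has_uderiv I f f'" "has_uderiv I g g'" "f \<in> GG I" "g \<in> GG I"
  shows "has_uderiv I (\<lambda>s. f s * g s) (\<lambda>s. f' s * g s + f s * g' s)"
  unfolding has_uderiv_iff
proof (intro conjI ballI allI)
  have f': "f' \<in> GG I" and g': "g' \<in> GG I" using assms has_uderiv_GG by auto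
  then show "(\<lambda>s. f' s * g s + f s * g' s) \<in> GG I" using assms by (intro GG_add GG_mult)
  fix t b assume t: "t \<in> I"
  have *: "slim b (\<lambda>s. f' s * g s + f s * g' s) t = slim b f' t * slim b g t + slim b f t * slim b g' t"
    using f' g' assms t by (simp add: slim_add slim_mult GG_mult)
  have eq: "(f s * g s - x * y) / d = (f s - x) / d * g s + x * ((g s - y) / d)" for s x y d
    by (simp add: add_divide_distrib[symmetric] left_diff_distrib right_diff_distrib)
  have "((\<lambda>s. (f s - slim b f t) / of_real (s - t) * g s + slim b f t * ((g s - slim b g t) / of_real (s - t)))
      \<longlongrightarrow> slim b f' t * slim b g t + slim b f t * slim b g' t) (ess b t)"
    by (intro tendsto_add tendsto_mult tendsto_const has_uderivD assms GG_tendsto t)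
  then show "((\<lambda>s. (f s * g s - slim b (\<lambda>s. f s * g s) t) / of_real (s - t)) \<longlongrightarrow>
      slim b (\<lambda>s. f' s * g s + f s * g' s) t) (ess b t)"
    unfolding * slim_mult[OF assms(3,4) t] eq .
qed

lemma has_uderiv_const [simp]: "has_uderiv I (\<lambda>_. l) (\<lambda>_. 0)"
  by (simp add: has_uderiv_iff)

lemma has_uderiv_cmult: "has_uderiv I f f' \<Longrightarrow> f \<in> GG I \<Longrightarrow>
    has_uderiv I (\<lambda>s. l * f s) (\<lambda>s. l * f' s)"
  using has_uderiv_mult[OF has_uderiv_const, of f f' l] by simp

end

section \<open>Iterated derivatives\<close>

context open_interval
begin

text \<open>\<open>ggb k B g\<close> says that the derivatives of \<open>g\<close> up to order \<open>k\<close> exist and are bounded by \<open>B\<close>;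
  unlike \<open>GG_norm\<close> it refers to no choice of derivatives.\<close>

primrec ggb :: "nat \<Rightarrow> real \<Rightarrow> (real \<Rightarrow> complex) \<Rightarrow> bool" where
  "ggb 0 B g \<longleftrightarrow> g \<in> GG I \<and> (AE t in lebesgue_on I. norm (g t) \<le> B)"
| "ggb (Suc k) B g \<longleftrightarrow> g \<in> GG I \<and> (AE t in lebesgue_on I. norm (g t) \<le> B) \<and>
     (\<exists>h. has_uderiv I g h \<and> ggb k B h)"

lemma ggb_GG: "ggb k B g \<Longrightarrow> g \<in> GG I"
  by (cases k) auto

lemma ggb_AE: "ggb k B g \<Longrightarrow> AE t in lebesgue_on I. norm (g t) \<le> B"
  by (cases k) auto

lemma ggb_cong:
  assumes "ggb k B g" "ae_eq I g g'" shows "ggb k B g'"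
proof -
  have "g' \<in> GG I" using assms ggb_GG GG_ae_cong by blast
  moreover have "AE t in lebesgue_on I. norm (g' t) \<le> B"
    using ggb_AE[OF assms(1)] assms(2) unfolding ae_eq_def by eventually_elim simp
  moreover have "has_uderiv I g h \<Longrightarrow> has_uderiv I g' h" for h
    using has_uderiv_cong assms(2) ae_eq_refl by blast
  ultimately show ?thesis using assms(1) by (cases k) auto
qed

lemma ggb_SucI: "g \<in> GG I \<Longrightarrow> AE t in lebesgue_on I. norm (g t) \<le> B \<Longrightarrow> has_uderiv I g h \<Longrightarrow>
    ggb k B h \<Longrightarrow> ggb (Suc k) B g"
  by auto

lemma ggb_derivD: "ggb (Suc k) B g \<Longrightarrow> has_uderiv I g h \<Longrightarrow> ggb k B h"
  using ggb_cong has_uderiv_unique by auto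

lemma ggb_mono: "ggb k B g \<Longrightarrow> B \<le> C \<Longrightarrow> ggb k C g"
proof (induction k arbitrary: g)
  case 0
  then have "AE t in lebesgue_on I. norm (g t) \<le> B" by simp
  then have "AE t in lebesgue_on I. norm (g t) \<le> C"
    by (rule eventually_mono) (use 0 in simp)
  then show ?case using 0 by simp
next
  case (Suc k)
  then have "AE t in lebesgue_on I. norm (g t) \<le> B" by simp
  then have "AE t in lebesgue_on I. norm (g t) \<le> C"
    by (rule eventually_mono) (use Suc in simp)
  then show ?case using Suc by auto
qed

lemma ggb_SucD: "ggb (Suc k) B g \<Longrightarrow> ggb k B g"
  by (induction k arbitrary: g) auto

lemma ggb_le: "ggb k B g \<Longrightarrow> j \<le> k \<Longrightarrow> ggb j B g"
  by (induction k) (auto simp: le_Suc_eq simp del: ggb.simps(2) dest: ggb_SucD)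

lemma ggb_add: "ggb k B f \<Longrightarrow> ggb k C g \<Longrightarrow> ggb k (B + C) (\<lambda>t. f t + g t)"
proof (induction k arbitrary: f g)
  case 0
  then have "AE t in lebesgue_on I. norm (f t) \<le> B" "AE t in lebesgue_on I. norm (g t) \<le> C" by auto
  then have "AE t in lebesgue_on I. norm (f t + g t) \<le> B + C"
    by eventually_elim (meson add_mono norm_triangle_le)
  then show ?case using 0 by (simp add: GG_add)
next
  case (Suc k)
  then have "AE t in lebesgue_on I. norm (f t) \<le> B" "AE t in lebesgue_on I. norm (g t) \<le> C" by auto
  then have ae: "AE t in lebesgue_on I. norm (f t + g t) \<le> B + C"
    by eventually_elim (meson add_mono norm_triangle_le)
  obtain f' g' where "has_uderiv I f f'" "has_uderiv I g g'" "ggb k B f'" "ggb k C g'"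
    using Suc.prems by auto
  then show ?case
    using Suc ae by (intro ggb_SucI[OF _ _ has_uderiv_add]) (auto intro: GG_add)
qed

text \<open>Each differentiation at most doubles the number of products in the Leibniz rule, whence
  \<open>2 ^ k\<close>.\<close>

lemma ggb_mult:
  assumes "0 \<le> B" "0 \<le> C"
  shows "ggb k B f \<Longrightarrow> ggb k C g \<Longrightarrow> ggb k (2 ^ k * (B * C)) (\<lambda>t. f t * g t)"
proof (induction k arbitrary: f g)
  case 0
  then have "AE t in lebesgue_on I. norm (f t) \<le> B" "AE t in lebesgue_on I. norm (g t) \<le> C" by auto
  then have "AE t in lebesgue_on I. norm (f t * g t) \<le> B * C"
    by eventually_elim (simp add: norm_mult mult_mono assms)
  then show ?case using 0 by (simp add: GG_mult)
next
  case (Suc k)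
  have "B * C \<le> 2 ^ Suc k * (B * C)"
    using assms mult_right_mono[of 1 "2 ^ Suc k" "B * C"] one_le_power[of "2::real" "Suc k"] by simp
  moreover have "AE t in lebesgue_on I. norm (f t) \<le> B" "AE t in lebesgue_on I. norm (g t) \<le> C"
    using Suc.prems by auto
  then have "AE t in lebesgue_on I. norm (f t * g t) \<le> B * C"
    by eventually_elim (simp add: norm_mult mult_mono assms)
  ultimately have ae: "AE t in lebesgue_on I. norm (f t * g t) \<le> 2 ^ Suc k * (B * C)"
    by (auto elim!: eventually_mono)
  obtain f' g' where fg: "has_uderiv I f f'" "has_uderiv I g g'" "ggb k B f'" "ggb k C g'"
    using Suc.prems by auto
  have "ggb k (2 ^ k * (B * C) + 2 ^ k * (B * C)) (\<lambda>t. f' t * g t + f t * g' t)"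
    using Suc fg ggb_SucD by (intro ggb_add) blast+
  then show ?case
    using Suc.prems ae fg ggb_GG
    by (intro ggb_SucI[OF _ _ has_uderiv_mult]) (auto intro!: GG_mult simp: algebra_simps)
qed

lemma ggb_const: "norm l \<le> B \<Longrightarrow> ggb k B (\<lambda>_. l)"
proof (induction k arbitrary: l)
  case (Suc k)
  then have "ggb k B (\<lambda>_. 0)" using norm_ge_zero[of l] by (intro Suc.IH) (simp del: norm_ge_zero)
  then show ?case using Suc by (intro ggb_SucI[OF _ _ has_uderiv_const]) auto
qed auto

lemma ggb_cmult: "ggb k B g \<Longrightarrow> ggb k (norm l * B) (\<lambda>t. l * g t)"
proof (induction k arbitrary: g)
  case 0
  then have "AE t in lebesgue_on I. norm (l * g t) \<le> norm l * B"
    by (auto elim!: eventually_mono simp: norm_mult intro: mult_left_mono)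
  then show ?case using 0 by (simp add: GG_cmult)
next
  case (Suc k)
  then have "AE t in lebesgue_on I. norm (l * g t) \<le> norm l * B"
    by (auto elim!: eventually_mono simp: norm_mult intro: mult_left_mono)
  moreover obtain g' where "has_uderiv I g g'" "ggb k B g'" using Suc.prems by auto
  ultimately show ?case
    using Suc by (intro ggb_SucI[OF _ _ has_uderiv_cmult]) (auto intro: GG_cmult)
qed

text \<open>As \<open>w\<close> has derivative 0, it passes through every derivative of
  \<open>g\<close>. The bound is therefore kept exactly, without the factor of
  \<open>ggb_mult\<close>.\<close>

lemma ggb_cut:
  assumes w: "w \<in> GG I" "has_uderiv I w (\<lambda>_. 0)" "\<And>t. norm (w t) \<le> 1"
  shows "ggb k B g \<Longrightarrow> ggb k B (\<lambda>t. w t * g t)"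
proof (induction k arbitrary: g)
  case 0
  have "norm (w t * g t) \<le> norm (g t)" for t
    using w(3)[of t] mult_right_mono[of "norm (w t)" 1 "norm (g t)"] by (simp add: norm_mult)
  then have "AE t in lebesgue_on I. norm (w t * g t) \<le> B"
    using ggb_AE[OF 0] by (auto elim!: eventually_mono intro: order_trans)
  then show ?case using 0 w by (simp add: GG_mult)
next
  case (Suc k)
  have "norm (w t * g t) \<le> norm (g t)" for t
    using w(3)[of t] mult_right_mono[of "norm (w t)" 1 "norm (g t)"] by (simp add: norm_mult)
  then have "AE t in lebesgue_on I. norm (w t * g t) \<le> B"
    using ggb_AE[OF Suc.prems] by (auto elim!: eventually_mono intro: order_trans)
  moreover obtain g' where "has_uderiv I g g'" "ggb k B g'" using Suc.prems by auto
  moreover from this have "has_uderiv I (\<lambda>t. w t * g t) (\<lambda>t. w t * g' t)"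
    using has_uderiv_mult[OF w(2) _ w(1)] ggb_GG[OF Suc.prems] by fastforce
  ultimately show ?case
    using Suc w by (intro ggb_SucI[of _ _ "\<lambda>t. w t * g' t"]) (auto intro: GG_mult)
qed

text \<open>In one direction, finitely many members of a chain of derivatives have a common bound,
  because each lies in \<open>GG I\<close>. In the other, the choice function \<open>uderiv\<close>
  never fails, so \<open>uderivs\<close> itself is a chain.\<close>

lemma GGinf_iff: "g \<in> GGinf I \<longleftrightarrow> (\<forall>k. \<exists>B. ggb k B g)"
proof
  assume "g \<in> GGinf I"
  then obtain D where g: "g \<in> GG I" "D 0 = g" and D: "\<And>k. has_uderiv I (D k) (D (Suc k))"
    unfolding GGinf_def by blast
  have DG: "D k \<in> GG I" for k using g D has_uderiv_GG by (cases k) auto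
  have "\<exists>B. ggb k B (D j)" for k j
  proof (induction k arbitrary: j)
    case 0
    show ?case using DG[of j] GG_bounded[OF DG[of j]] by auto
  next
    case (Suc k)
    obtain B where B: "ggb k B (D (Suc j))" using Suc by blast
    obtain C where C: "AE t in lebesgue_on I. norm (D j t) \<le> C" using GG_bounded[OF DG[of j]] by blast
    have "AE t in lebesgue_on I. norm (D j t) \<le> max B C"
      by (rule eventually_mono[OF C]) simp
    then show ?case using D DG ggb_mono[OF B, of "max B C"] by (intro exI ggb_SucI) auto
  qed
  then show "\<forall>k. \<exists>B. ggb k B g" using g by metis
next
  assume *: "\<forall>k. \<exists>B. ggb k B g"
  have D: "\<exists>B. ggb j B (uderivs I k g)" for k j
  proof (induction k arbitrary: j)
    case 0 then show ?case using * by (simp add: uderivs_def)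
  next
    case (Suc k)
    obtain B where B: "ggb (Suc j) B (uderivs I k g)" using Suc by blast
    then have "has_uderiv I (uderivs I k g) (uderiv I (uderivs I k g))"
      unfolding uderiv_def using someI[of "has_uderiv I (uderivs I k g)"] by auto
    then show ?case using ggb_derivD[OF B] by (auto simp: uderivs_def)
  qed
  have "has_uderiv I (uderivs I k g) (uderivs I (Suc k) g)" for k
    using D[of 1 k] someI[of "has_uderiv I (uderivs I k g)"] by (auto simp: uderivs_def uderiv_def)
  moreover have "g \<in> GG I" using * ggb_GG by blast
  ultimately show "g \<in> GGinf I"
    unfolding GGinf_def by (auto intro!: exI[of _ "\<lambda>k. uderivs I k g"] simp: uderivs_def)
qed

lemma GGinf_GG: "g \<in> GGinf I \<Longrightarrow> g \<in> GG I"
  by (simp add: GGinf_def)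

lemma GGinf_ggb: assumes "g \<in> GGinf I" obtains B where "0 \<le> B" "ggb k B g"
  using assms ggb_mono unfolding GGinf_iff by (metis max.cobounded1 max.cobounded2)

lemma uderiv_has: assumes "g \<in> GGinf I" shows "has_uderiv I g (uderiv I g)"
proof -
  obtain h where "has_uderiv I g h" using assms unfolding GGinf_def by blast
  then show ?thesis unfolding uderiv_def using someI[of "has_uderiv I g"] by blast
qed

lemma has_uderiv_GGinf: assumes "g \<in> GGinf I" "has_uderiv I g h" shows "h \<in> GGinf I"
  using assms ggb_derivD unfolding GGinf_iff by blast

lemma uderiv_GGinf: "g \<in> GGinf I \<Longrightarrow> uderiv I g \<in> GGinf I"
  using has_uderiv_GGinf uderiv_has by blast

lemma uderiv_ae: "g \<in> GGinf I \<Longrightarrow> has_uderiv I g h \<Longrightarrow> ae_eq I (uderiv I g) h"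
  using has_uderiv_unique uderiv_has by blast

lemma GGinf_cong: "g \<in> GGinf I \<Longrightarrow> ae_eq I g h \<Longrightarrow> h \<in> GGinf I"
  using ggb_cong unfolding GGinf_iff by blast

lemma GGinf_I:
  assumes "g \<in> GG I" "has_uderiv I g h" "h \<in> GGinf I" shows "g \<in> GGinf I"
  unfolding GGinf_iff
proof
  fix k
  obtain B where B: "ggb k B h" using assms GGinf_ggb by blast
  obtain C where C: "AE t in lebesgue_on I. norm (g t) \<le> C" using GG_bounded assms by blast
  have "AE t in lebesgue_on I. norm (g t) \<le> max B C" by (rule eventually_mono[OF C]) simp
  then have "ggb (Suc k) (max B C) g"
    using assms ggb_mono[OF B, of "max B C"] by (intro ggb_SucI) auto
  then show "\<exists>B. ggb k B g" using ggb_SucD by blast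
qed

lemma GGinf_const [simp]: "(\<lambda>_. l) \<in> GGinf I"
  unfolding GGinf_iff using ggb_const by blast

lemma GGinf_add: "f \<in> GGinf I \<Longrightarrow> g \<in> GGinf I \<Longrightarrow> (\<lambda>t. f t + g t) \<in> GGinf I"
  unfolding GGinf_iff using ggb_add by blast

lemma GGinf_mult: "f \<in> GGinf I \<Longrightarrow> g \<in> GGinf I \<Longrightarrow> (\<lambda>t. f t * g t) \<in> GGinf I"
  unfolding GGinf_iff[of "\<lambda>t. f t * g t"] using ggb_mult GGinf_ggb by metis

lemma GGinf_cmult: "g \<in> GGinf I \<Longrightarrow> (\<lambda>t. l * g t) \<in> GGinf I"
  using GGinf_mult[OF GGinf_const] by simp

lemma uderivs_0 [simp]: "uderivs I 0 g = g"
  by (simp add: uderivs_def)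

lemma uderivs_Suc: "uderivs I (Suc k) g = uderiv I (uderivs I k g)"
  by (simp add: uderivs_def)

lemma uderivs_Suc2: "uderivs I (Suc k) g = uderivs I k (uderiv I g)"
  by (simp add: uderivs_def funpow_swap1)

lemma uderivs_GGinf: "g \<in> GGinf I \<Longrightarrow> uderivs I k g \<in> GGinf I"
  by (induction k) (auto simp: uderivs_Suc uderiv_GGinf)

lemma uderivs_has: "g \<in> GGinf I \<Longrightarrow> has_uderiv I (uderivs I k g) (uderivs I (Suc k) g)"
  using uderiv_has uderivs_GGinf by (simp add: uderivs_Suc)

lemma uderivs_cong: assumes "g \<in> GGinf I" "ae_eq I g h"
  shows "ae_eq I (uderivs I k g) (uderivs I k h)"
proof (induction k)
  case (Suc k)
  have h: "h \<in> GGinf I" using assms GGinf_cong by blast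
  show ?case
    using has_uderiv_unique[OF has_uderiv_cong[OF uderivs_has[OF assms(1)] Suc ae_eq_refl] uderivs_has[OF h]] .
qed (use assms in simp)

lemma uderivs_step: assumes "g \<in> GGinf I" "has_uderiv I g h"
  shows "ae_eq I (uderivs I (Suc k) g) (uderivs I k h)"
  unfolding uderivs_Suc2 using assms uderiv_ae uderivs_cong uderiv_GGinf by blast

lemma uderivs_add: assumes "f \<in> GGinf I" "g \<in> GGinf I"
  shows "ae_eq I (uderivs I k (\<lambda>t. f t + g t)) (\<lambda>t. uderivs I k f t + uderivs I k g t)"
proof (induction k)
  case (Suc k)
  have 1: "(\<lambda>t. f t + g t) \<in> GGinf I" using assms GGinf_add by blast
  have 2: "has_uderiv I (\<lambda>t. uderivs I k f t + uderivs I k g t)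
      (\<lambda>t. uderivs I (Suc k) f t + uderivs I (Suc k) g t)"
    using assms uderivs_GGinf GGinf_GG uderivs_has by (intro has_uderiv_add) auto
  show ?case
    using has_uderiv_unique[OF has_uderiv_cong[OF uderivs_has[OF 1] Suc ae_eq_refl] 2] .
qed simp

lemma uderivs_cmult: assumes "g \<in> GGinf I"
  shows "ae_eq I (uderivs I k (\<lambda>t. l * g t)) (\<lambda>t. l * uderivs I k g t)"
proof (induction k)
  case (Suc k)
  have 1: "(\<lambda>t. l * g t) \<in> GGinf I" using assms GGinf_cmult by blast
  have 2: "has_uderiv I (\<lambda>t. l * uderivs I k g t) (\<lambda>t. l * uderivs I (Suc k) g t)"
    using assms uderivs_GGinf GGinf_GG uderivs_has by (intro has_uderiv_cmult) auto
  show ?case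
    using has_uderiv_unique[OF has_uderiv_cong[OF uderivs_has[OF 1] Suc ae_eq_refl] 2] .
qed simp

lemma ggb_iff: "g \<in> GGinf I \<Longrightarrow> ggb k B g \<longleftrightarrow> (\<forall>i\<le>k. AE t in lebesgue_on I. norm (uderivs I i g t) \<le> B)"
proof (induction k arbitrary: g)
  case 0 then show ?case using GGinf_GG by simp
next
  case (Suc k)
  have split: "(\<forall>i\<le>Suc k. P i) \<longleftrightarrow> P 0 \<and> (\<forall>i\<le>k. P (Suc i))" for P
    by (metis Suc_le_mono le0 not0_implies_Suc)
  have "ggb (Suc k) B g \<longleftrightarrow> (AE t in lebesgue_on I. norm (g t) \<le> B) \<and> ggb k B (uderiv I g)"
    using ggb_derivD[of k B g] uderiv_has[OF Suc.prems] GGinf_GG[OF Suc.prems] by auto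
  also have "\<dots> \<longleftrightarrow> (\<forall>i\<le>Suc k. AE t in lebesgue_on I. norm (uderivs I i g t) \<le> B)"
    using Suc.IH[OF uderiv_GGinf[OF Suc.prems]]
    by (simp add: split uderivs_Suc2)
  finally show ?case .
qed

lemma not_AE_False: "\<not> (AE t in lebesgue_on I. False)"
proof
  assume *: "AE t in lebesgue_on I. False"
  obtain t where "t \<in> I" using nonempty_I by blast
  then show False using AE_imp_eventually_ess[OF open_I _ *, of t True] by simp
qed

lemma Linf_norm_le_iff:
  assumes "g \<in> GG I" shows "Linf_norm I g \<le> B \<longleftrightarrow> (AE t in lebesgue_on I. norm (g t) \<le> B)"
proof -
  define f where "f = (\<lambda>t. ereal (norm (g t)))"
  have m: "f \<in> borel_measurable (lebesgue_on I)" unfolding f_def using GG_measurable[OF assms] by measurable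
  have ae: "AE t in lebesgue_on I. f t \<le> esssup (lebesgue_on I) f" by (rule esssup_AE)
  have up: "esssup (lebesgue_on I) f \<le> ereal B" if "AE t in lebesgue_on I. norm (g t) \<le> B" for B
    using that m by (intro esssup_I) (auto simp: f_def)
  \<comment> \<open>\<open>real_of_ereal\<close> sends both infinities to 0, so
    \<open>Linf_norm\<close> is faithful only once both are excluded: the upper one by boundedness,
    the lower one because \<open>I\<close> is not a null set.\<close>
  have "esssup (lebesgue_on I) f \<noteq> \<infinity>" 
  proof -
    obtain C where "AE t in lebesgue_on I. norm (g t) \<le> C" using GG_bounded[OF assms] .
    from up[OF this] show ?thesis by auto
  qed
  moreover have "esssup (lebesgue_on I) f \<noteq> -\<infinity>"
  proof
    assume "esssup (lebesgue_on I) f = -\<infinity>"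
    then have "AE t in lebesgue_on I. False" using ae by (auto simp: f_def elim!: eventually_mono)
    then show False using not_AE_False by blast
  qed
  ultimately have eq: "esssup (lebesgue_on I) f = ereal (Linf_norm I g)"
    unfolding Linf_norm_def f_def[symmetric] by (cases "esssup (lebesgue_on I) f") auto
  have "AE t in lebesgue_on I. norm (g t) \<le> Linf_norm I g"
    using ae unfolding eq by (simp add: f_def)
  then show ?thesis using up[of B] unfolding eq by (auto elim!: eventually_mono)
qed

text \<open>The bridge between the norms that define the topology and the predicate used in all
  estimates.\<close>

lemma GG_norm_le_iff:
  assumes "g \<in> GGinf I" shows "GG_norm I k g \<le> B \<longleftrightarrow> ggb k B g"
  unfolding GG_norm_def ggb_iff[OF assms] using Linf_norm_le_iff[OF GGinf_GG[OF uderivs_GGinf[OF assms]]]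
  by auto

end

section \<open>Step functions, continuous functions and primitives\<close>

definition ind :: "real \<Rightarrow> real \<Rightarrow> complex" where
  "ind x t = (if x \<le> t then 1 else 0)"

lemma ess_ind: "eventually (\<lambda>s. ind x s = (if (if b then x \<le> t else x < t) then 1 else 0)) (ess b t)"
proof (cases "x = t")
  case True
  have "eventually (\<lambda>s. s \<in> side b t 1) (ess b t)" by (rule eventually_side) simp
  then show ?thesis
    by (rule eventually_mono) (auto simp: True side_def ind_def split: if_splits)
next
  case False
  then have "eventually (\<lambda>s. s \<in> side b t 1 \<and> s \<in> side b t \<bar>t - x\<bar>) (ess b t)"
    by (intro eventually_conj eventually_side) auto
  then show ?thesis
    by (rule eventually_mono) (use False in \<open>auto simp: side_def ind_def abs_if split: if_splits\<close>)
qed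

lemma slim_ind: "slim b (ind x) t = (if (if b then x \<le> t else x < t) then 1 else 0)"
  by (intro slim_eqI tendsto_eventually ess_ind)

lemma norm_ind_le [simp]: "norm (ind x t) \<le> 1"
  by (simp add: ind_def)

lemma measurable_ind [measurable]: "ind x \<in> borel_measurable borel"
  unfolding ind_def by measurable

lemma measurable_ind_lebesgue [measurable]: "ind x \<in> borel_measurable (lebesgue_on I)"
  by (intro measurable_restrict_space1 measurable_completion) simp

context open_interval
begin

lemma GG_ind: "ind x \<in> GG I"
  using tendsto_eventually[OF ess_ind] by (intro GG_I[of _ 1]) (auto intro: AE_I2)

lemma has_uderiv_ind: "has_uderiv I (ind x) (\<lambda>_. 0)"
  unfolding has_uderiv_iff slim_ind
proof (intro conjI ballI allI)
  fix t b
  show "((\<lambda>s. (ind x s - (if if b then x \<le> t else x < t then 1 else 0)) / complex_of_real (s - t)) \<longlongrightarrow>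
            slim b (\<lambda>_. 0) t) (ess b t)"
    unfolding slim_const
    by (rule tendsto_eventually, rule eventually_mono[OF ess_ind[of x b t]]) simp
qed simp

lemma GGinf_ind: "ind x \<in> GGinf I"
  by (rule GGinf_I[OF GG_ind has_uderiv_ind GGinf_const])

lemma GG_continuous:
  assumes "continuous_on I f" "\<And>t. t \<in> I \<Longrightarrow> norm (f t) \<le> B"
  shows "f \<in> GG I"
proof (rule GG_I)
  show "f \<in> borel_measurable (lebesgue_on I)"
    using assms by (intro continuous_imp_measurable_on_sets_lebesgue) auto
  show "AE t in lebesgue_on I. norm (f t) \<le> B" using assms by (intro AE_I2) auto
  fix t b assume "t \<in> I"
  then have "(f \<longlongrightarrow> f t) (at t)"
    using assms open_I by (simp add: continuous_on_eq_continuous_at continuous_at)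
  then show "\<exists>l. (f \<longlongrightarrow> l) (ess b t)" using ess_le_at tendsto_mono by blast
qed

lemma slim_continuous: assumes "continuous_on I f" "t \<in> I" shows "slim b f t = f t"
proof (rule slim_eqI)
  have "(f \<longlongrightarrow> f t) (at t)"
    using assms open_I by (simp add: continuous_on_eq_continuous_at continuous_at)
  then show "(f \<longlongrightarrow> f t) (ess b t)" using ess_le_at tendsto_mono by blast
qed

lemma has_uderiv_classical:
  assumes "continuous_on I f" "continuous_on I f'" "\<And>t. t \<in> I \<Longrightarrow> norm (f' t) \<le> B"
    "\<And>t. t \<in> I \<Longrightarrow> ((\<lambda>s. (f s - f t) / of_real (s - t)) \<longlongrightarrow> f' t) (at t)"
  shows "has_uderiv I f f'"
  unfolding has_uderiv_iff
proof (intro conjI ballI allI)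
  show "f' \<in> GG I" using assms GG_continuous by blast
  fix t b assume "t \<in> I"
  then show "((\<lambda>s. (f s - slim b f t) / complex_of_real (s - t)) \<longlongrightarrow> slim b f' t) (ess b t)"
    using tendsto_mono[OF ess_le_at assms(4)]
    by (simp add: slim_continuous[OF assms(1)] slim_continuous[OF assms(2)])
qed

text \<open>The right limits of \<open>D\<close> form a classically differentiable function with derivative zero.\<close>

lemma uderiv_zero_const:
  assumes D: "D \<in> GG I" "has_uderiv I D (\<lambda>_. 0)" and j: "\<And>t. t \<in> I \<Longrightarrow> slim True D t = slim False D t"
  shows "\<exists>l. ae_eq I D (\<lambda>_. l)"
proof -
  define E where "E = slim True D"
  have slE: "slim b D t = E t" if "t \<in> I" for t b using j[OF that] by (cases b) (auto simp: E_def)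
  have "(E has_derivative (\<lambda>_. 0)) (at t)" if t: "t \<in> I" for t
    unfolding has_derivative_at_alt
  proof (intro conjI allI impI)
    fix e :: real assume e: "e > 0"
    obtain r where r: "r > 0" "ball t r \<subseteq> I" using open_I t open_contains_ball by blast
    have "\<exists>d>0. \<forall>s\<in>side b t d. norm (E s - E t) \<le> e * \<bar>s - t\<bar>" for b
    proof -
      have "((\<lambda>s. (D s - E t) / of_real (s - t)) \<longlongrightarrow> 0) (ess b t)"
        using has_uderivD[OF D(2) t, of b] by (simp add: slE t)
      then have "eventually (\<lambda>s. norm ((D s - E t) / of_real (s - t)) < e) (ess b t)"
        using e by (auto simp: tendsto_iff)
      then obtain d where d: "d > 0" "AE s in lebesgue. s \<in> side b t d \<longrightarrow> norm ((D s - E t) / of_real (s - t)) < e"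
        unfolding eventually_ess by blast
      \<comment> \<open>The estimate for \<open>D\<close> holds almost everywhere near
        \<open>s\<close>; since \<open>E s\<close> is a right limit of \<open>D\<close>, it survives
        as an estimate for \<open>E\<close> at every \<open>s\<close>. Taking the minimum with
        \<open>r\<close> keeps \<open>s\<close> in \<open>I\<close>.\<close>
      have "norm (E s - E t) \<le> e * \<bar>s - t\<bar>" if s: "s \<in> side b t (min d r)" for s
      proof (rule tendsto_le[OF ess_nontrivial])
        have sI: "s \<in> I" using s r by (auto simp: side_def dist_real_def split: if_splits)
        show "((\<lambda>x. norm (D x - E t)) \<longlongrightarrow> norm (E s - E t)) (ess True s)"
          using GG_tendsto[OF D(1) sI, of True] slE[OF sI] by (intro tendsto_norm tendsto_diff tendsto_const) simp
        show "((\<lambda>x. e * \<bar>x - t\<bar>) \<longlongrightarrow> e * \<bar>s - t\<bar>) (ess True s)"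
          by (intro tendsto_intros tendsto_mono[OF ess_le_at])
        have os: "open (side b t d)" "s \<in> side b t d" using s by (auto simp: side_def split: if_splits)
        have "eventually (\<lambda>x. x \<in> side b t d) (ess True s)"
          by (intro eventually_ess_id eventually_at_in_open') (use os in auto)
        moreover have "eventually (\<lambda>x. x \<in> side b t d \<longrightarrow> norm ((D x - E t) / of_real (x - t)) < e) (ess True s)"
          unfolding eventually_ess using d(2) by (intro exI[of _ 1]) (auto elim: eventually_mono)
        ultimately show "eventually (\<lambda>x. norm (D x - E t) \<le> e * \<bar>x - t\<bar>) (ess True s)"
        proof eventually_elim
          case (elim x)
          then have "x \<noteq> t" by (auto simp: side_def split: if_splits)
          then have "0 < \<bar>x - t\<bar>" by simp
          have "norm (D x - E t) / \<bar>x - t\<bar> < e"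
            using elim by (simp add: norm_divide norm_of_real del: of_real_diff)
          then have "norm (D x - E t) < e * \<bar>x - t\<bar>"
            using \<open>0 < \<bar>x - t\<bar>\<close> by (simp only: pos_divide_less_eq)
          then show ?case by simp
        qed
      qed
      then show ?thesis using d(1) r(1) by (intro exI[of _ "min d r"]) auto
    qed
    then obtain d1 d2 where d: "d1 > 0" "d2 > 0"
      "\<forall>s\<in>side True t d1. norm (E s - E t) \<le> e * \<bar>s - t\<bar>"
      "\<forall>s\<in>side False t d2. norm (E s - E t) \<le> e * \<bar>s - t\<bar>" by meson
    show "\<exists>d>0. \<forall>y. norm (y - t) < d \<longrightarrow> norm (E y - E t - 0) \<le> e * norm (y - t)"
    proof (intro exI[of _ "min d1 d2"] conjI allI impI)
      fix y assume y: "norm (y - t) < min d1 d2"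
      consider "y = t" | "y \<in> side True t d1" | "y \<in> side False t d2"
        using y by (cases y t rule: linorder_cases) (auto simp: side_def abs_if split: if_splits)
      then show "norm (E y - E t - 0) \<le> e * norm (y - t)" using d by cases auto
    qed (use d in auto)
  qed simp
  then have "\<exists>l. \<forall>t\<in>I. E t = l"
    using interval_I has_derivative_at_withinI is_interval_convex
    by (intro has_derivative_zero_constant) blast+
  then obtain l where l: "\<And>t. t \<in> I \<Longrightarrow> E t = l" by blast
  have "ae_eq I D (\<lambda>_. l)" by (rule ae_eq_slimI[OF D(1) GG_const]) (simp add: slE l)
  then show ?thesis ..
qed

subsection \<open>Primitives\<close>

text \<open>Requiring both endpoints in \<open>I\<close> makes \<open>{u..v}\<close> a compact
  subset of \<open>I\<close>, so that this describes a support condition fit for test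
  functions.\<close>

definition van :: "real \<Rightarrow> real \<Rightarrow> (real \<Rightarrow> complex) \<Rightarrow> bool" where
  "van u v \<psi> \<longleftrightarrow> u \<in> I \<and> v \<in> I \<and> (AE t in lebesgue_on I. t \<notin> {u..v} \<longrightarrow> \<psi> t = 0)"

text \<open>Integration runs from \<open>t\<close> to the right end of \<open>I\<close>, so the
  result vanishes to the right of the support and its derivative is the negative of the
  integrand.\<close>

definition prim :: "(real \<Rightarrow> complex) \<Rightarrow> real \<Rightarrow> complex" where
  "prim \<psi> t = (LINT x|lebesgue_on I. ind t x * \<psi> x)"

lemma van_AE: "van u v \<psi> \<Longrightarrow> AE t in lebesgue_on I. t \<notin> {u..v} \<longrightarrow> \<psi> t = 0"
  by (simp add: van_def)

lemma van_mono: "van u v \<psi> \<Longrightarrow> u' \<in> I \<Longrightarrow> v' \<in> I \<Longrightarrow> u' \<le> u \<Longrightarrow> v \<le> v' \<Longrightarrow> van u' v' \<psi>"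
  unfolding van_def by (auto elim!: eventually_mono)

lemma van_cong: assumes "van u v \<psi>" "ae_eq I \<psi> \<phi>" shows "van u v \<phi>"
proof -
  have "AE t in lebesgue_on I. t \<notin> {u..v} \<longrightarrow> \<phi> t = 0"
    using van_AE[OF assms(1)] assms(2) unfolding ae_eq_def by eventually_elim auto
  then show ?thesis using assms(1) by (simp add: van_def)
qed

lemma van_add: assumes "van u v \<psi>" "van u v \<phi>" shows "van u v (\<lambda>t. \<psi> t + \<phi> t)"
proof -
  have "AE t in lebesgue_on I. t \<notin> {u..v} \<longrightarrow> \<psi> t + \<phi> t = 0"
    using van_AE[OF assms(1)] van_AE[OF assms(2)] by eventually_elim auto
  then show ?thesis using assms(1) by (simp add: van_def)
qed

lemma van_mult: "van u v \<psi> \<Longrightarrow> van u v (\<lambda>t. g t * \<psi> t)"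
  unfolding van_def by (auto elim!: eventually_mono)

lemma van_sum: "u \<in> I \<Longrightarrow> v \<in> I \<Longrightarrow> (\<And>i. i \<in> A \<Longrightarrow> van u v (f i)) \<Longrightarrow> van u v (\<lambda>t. \<Sum>i\<in>A. f i t)"
  by (induction A rule: infinite_finite_induct) (auto simp: van_def[of _ _ "\<lambda>_. 0"] intro: van_add)

lemma sets_Icc: "{u..v} \<subseteq> I \<Longrightarrow> {u..v} \<in> sets (lebesgue_on I)"
  by (auto simp: sets_restrict_space_iff)

lemma emeasure_Icc: "{u..v} \<subseteq> I \<Longrightarrow> emeasure (lebesgue_on I) {u..v} < \<infinity>"
  by (subst emeasure_restrict_space) (auto simp: emeasure_lborel_Icc_eq)

lemma measure_Icc: "u \<le> v \<Longrightarrow> {u..v} \<subseteq> I \<Longrightarrow> measure (lebesgue_on I) {u..v} = v - u"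
  by (subst measure_restrict_space) auto

lemma integrable_van:
  assumes "\<psi> \<in> GG I" "van u v \<psi>" shows "integrable (lebesgue_on I) \<psi>"
proof -
  have uv: "{u..v} \<subseteq> I" using assms(2) atLeastAtMost_subset_I by (simp add: van_def)
  obtain B where "AE t in lebesgue_on I. norm (\<psi> t) \<le> B" using GG_bounded[OF assms(1)] .
  then show ?thesis
    by (intro integrableI_bounded_set[OF sets_Icc[OF uv] GG_measurable[OF assms(1)] emeasure_Icc[OF uv], of B]
        van_AE assms) (auto elim: eventually_mono)
qed

lemma integral_Icc_bound:
  fixes g :: "real \<Rightarrow> complex"
  assumes uv: "u \<le> v" "{u..v} \<subseteq> I" and g: "g \<in> borel_measurable (lebesgue_on I)"
    and B: "AE x in lebesgue_on I. norm (g x) \<le> B * indicator {u..v} x"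
  shows "norm (LINT x|lebesgue_on I. g x) \<le> B * (v - u)"
proof -
  have i: "integrable (lebesgue_on I) (\<lambda>x. B * indicator {u..v} x)"
    using sets_Icc[OF uv(2)] emeasure_Icc[OF uv(2)] by auto
  have "integrable (lebesgue_on I) g"
    by (rule Bochner_Integration.integrable_bound[OF i g]) (use B in \<open>auto elim!: eventually_mono\<close>)
  then have "norm (LINT x|lebesgue_on I. g x) \<le> (LINT x|lebesgue_on I. B * indicator {u..v} x)"
    by (intro order_trans[OF integral_norm_bound] integral_mono_AE i B integrable_norm)
  also have "\<dots> = B * (v - u)"
    using sets_Icc[OF uv(2)] uv by (simp add: measure_Icc Int_absorb2)
  finally show ?thesis .
qed

lemma van_ind: "van u v \<psi> \<Longrightarrow> van u v (\<lambda>x. ind t x * \<psi> x)"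
  by (rule van_mult)

lemma integrable_ind: "\<psi> \<in> GG I \<Longrightarrow> van u v \<psi> \<Longrightarrow> integrable (lebesgue_on I) (\<lambda>x. ind t x * \<psi> x)"
  by (rule integrable_van[OF GG_mult[OF GG_ind] van_ind])

lemma prim_cong: "ae_eq I \<psi> \<phi> \<Longrightarrow> \<psi> \<in> GG I \<Longrightarrow> prim \<psi> t = prim \<phi> t"
  unfolding prim_def
  by (rule integral_cong_AE) (auto simp: ae_eq_def GG_measurable GG_ae_cong elim!: eventually_mono
    intro!: borel_measurable_times)

lemma prim_add: "\<psi> \<in> GG I \<Longrightarrow> van u v \<psi> \<Longrightarrow> \<phi> \<in> GG I \<Longrightarrow> van u' v' \<phi> \<Longrightarrow>
    prim (\<lambda>x. \<psi> x + \<phi> x) t = prim \<psi> t + prim \<phi> t"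
  unfolding prim_def distrib_left by (intro Bochner_Integration.integral_add integrable_ind)

lemma prim_cmult: "prim (\<lambda>x. l * \<psi> x) t = l * prim \<psi> t"
proof -
  have "(\<lambda>x. ind t x * (l * \<psi> x)) = (\<lambda>x. l * (ind t x * \<psi> x))" by (simp add: fun_eq_iff)
  then show ?thesis unfolding prim_def by simp
qed

text \<open>Comparison of a primitive with a linear function. The slope \<open>l = 0\<close> gives
  the Lipschitz bound, \<open>l = slim b \<psi> t\<close> the difference quotient, and
  \<open>B = 0\<close> the exact value for a constant integrand.\<close>

lemma prim_diff:
  assumes "\<psi> \<in> GG I" "van u v \<psi>" "s \<in> I" "t \<in> I" "s \<le> t"
    and l: "AE x in lebesgue_on I. x \<in> {s<..<t} \<longrightarrow> norm (\<psi> x - l) \<le> B" "0 \<le> B"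
  shows "norm (prim \<psi> s - prim \<psi> t - l * of_real (t - s)) \<le> B * (t - s)"
proof -
  have st: "{s..t} \<subseteq> I" using assms atLeastAtMost_subset_I by blast
  have il: "integrable (lebesgue_on I) (\<lambda>x. (ind s x - ind t x) * l)"
    and ile: "(LINT x|lebesgue_on I. (ind s x - ind t x) * l) = l * of_real (t - s)"
  proof -
    have n: "AE x in lebesgue_on I. x \<noteq> t"
      unfolding AE_I using AE_not_in[of "{t}" lebesgue] by (auto elim!: eventually_mono)
    have ae: "AE x in lebesgue_on I. indicator {s..t} x *\<^sub>R l = (ind s x - ind t x) * l"
      using n by eventually_elim (use assms(5) in \<open>auto simp: ind_def indicator_def\<close>)
    have hb: "has_bochner_integral (lebesgue_on I) (\<lambda>x. indicator {s..t} x *\<^sub>R l) (measure (lebesgue_on I) {s..t} *\<^sub>R l)"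
      using sets_Icc[OF st] emeasure_Icc[OF st] by (intro has_bochner_integral_indicator) auto
    have "has_bochner_integral (lebesgue_on I) (\<lambda>x. (ind s x - ind t x) * l) (measure (lebesgue_on I) {s..t} *\<^sub>R l)"
      by (subst has_bochner_integral_cong_AE[OF _ _ ae, symmetric])
        (use hb in \<open>auto intro!: borel_measurable_times borel_measurable_diff borel_measurable_scaleR
           borel_measurable_indicator sets_Icc[OF st]\<close>)
    then show "integrable (lebesgue_on I) (\<lambda>x. (ind s x - ind t x) * l)"
      "(LINT x|lebesgue_on I. (ind s x - ind t x) * l) = l * of_real (t - s)"
      using assms(5) st by (auto simp: has_bochner_integral_iff measure_Icc scaleR_conv_of_real mult.commute)
  qed
  have "prim \<psi> s - prim \<psi> t - l * of_real (t - s) = (LINT x|lebesgue_on I. (ind s x - ind t x) * (\<psi> x - l))"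
  proof -
    have "prim \<psi> s - prim \<psi> t = (LINT x|lebesgue_on I. ind s x * \<psi> x - ind t x * \<psi> x)"
      unfolding prim_def by (intro Bochner_Integration.integral_diff[symmetric] integrable_ind[OF assms(1,2)])
    also have "\<dots> - l * of_real (t - s) = (LINT x|lebesgue_on I. (ind s x * \<psi> x - ind t x * \<psi> x) - (ind s x - ind t x) * l)"
      unfolding ile[symmetric]
      by (intro Bochner_Integration.integral_diff[symmetric] il Bochner_Integration.integrable_diff integrable_ind[OF assms(1,2)])
    finally show ?thesis by (simp add: algebra_simps)
  qed
  also have "norm \<dots> \<le> B * (t - s)"
  proof (rule integral_Icc_bound[OF assms(5) st])
    show "(\<lambda>x. (ind s x - ind t x) * (\<psi> x - l)) \<in> borel_measurable (lebesgue_on I)"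
      using GG_measurable[OF assms(1)] by (auto intro!: borel_measurable_times borel_measurable_diff)
    have n: "AE x in lebesgue_on I. x \<noteq> y" for y
      unfolding AE_I using AE_not_in[of "{y}" lebesgue] by (auto elim!: eventually_mono)
    show "AE x in lebesgue_on I. norm ((ind s x - ind t x) * (\<psi> x - l)) \<le> B * indicator {s..t} x"
      using l(1) n[of s] n[of t] by eventually_elim (use assms(5) l(2) in \<open>auto simp: ind_def indicator_def\<close>)
  qed
  finally show ?thesis .
qed

lemma prim_bound:
  assumes "\<psi> \<in> GG I" "van u v \<psi>" "u \<le> v" and B: "AE x in lebesgue_on I. norm (\<psi> x) \<le> B"
  shows "norm (prim \<psi> t) \<le> B * (v - u)"
  unfolding prim_def
proof (rule integral_Icc_bound)
  show "{u..v} \<subseteq> I" using assms(2) atLeastAtMost_subset_I by (simp add: van_def)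
  show "(\<lambda>x. ind t x * \<psi> x) \<in> borel_measurable (lebesgue_on I)"
    using GG_measurable[OF assms(1)] by (auto intro!: borel_measurable_times)
  show "AE x in lebesgue_on I. norm (ind t x * \<psi> x) \<le> B * indicator {u..v} x"
    using B van_AE[OF assms(2)]
  proof eventually_elim
    case (elim x)
    then have "0 \<le> B" using norm_ge_zero order_trans by blast
    then show ?case using elim by (auto simp: ind_def indicator_def)
  qed
qed (use assms in auto)

lemma prim_zero: assumes "van u v \<psi>" "v < t" shows "prim \<psi> t = 0"
proof -
  have "AE x in lebesgue_on I. ind t x * \<psi> x = 0"
    using van_AE[OF assms(1)] by eventually_elim (use assms(2) in \<open>auto simp: ind_def\<close>)
  then show ?thesis unfolding prim_def by (rule integral_eq_zero_AE)
qed

lemma prim_tendsto: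
  assumes "\<psi> \<in> GG I" "van u v \<psi>" "t \<in> I"
  shows "((\<lambda>s. (prim \<psi> s - prim \<psi> t) / of_real (s - t)) \<longlongrightarrow> - slim b \<psi> t) (ess b t)"
proof (rule tendstoI)
  fix e :: real assume e: "e > 0"
  define l where "l = slim b \<psi> t"
  obtain r where r: "r > 0" "ball t r \<subseteq> I" using open_I assms(3) open_contains_ball by blast
  have "eventually (\<lambda>s. dist (\<psi> s) l < e / 2) (ess b t)"
    unfolding l_def using tendstoD[OF GG_tendsto[OF assms(1,3), of b], of "e / 2"] e by simp
  then obtain d where d: "d > 0" "AE s in lebesgue. s \<in> side b t d \<longrightarrow> dist (\<psi> s) l < e / 2"
    unfolding eventually_ess by blast
  have "dist ((prim \<psi> s - prim \<psi> t) / of_real (s - t)) (- l) < e" if s: "s \<in> side b t (min d r)" for s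
  proof -
    have sI: "s \<in> I" using s r by (auto simp: side_def dist_real_def split: if_splits)
    have ne: "s \<noteq> t" using s by (auto simp: side_def split: if_splits)
    have ae: "AE x in lebesgue_on I. x \<in> {min s t<..<max s t} \<longrightarrow> norm (\<psi> x - l) \<le> e / 2"
      using d(2) unfolding AE_I
      by eventually_elim (use s in \<open>auto simp: side_def dist_norm split: if_splits\<close>)
    have "norm (prim \<psi> (min s t) - prim \<psi> (max s t) - l * of_real (max s t - min s t)) \<le> e / 2 * (max s t - min s t)"
      by (rule prim_diff[OF assms(1,2) _ _ _ ae]) (use sI assms e in \<open>auto simp: min_def max_def\<close>)
    then have "norm (prim \<psi> s - prim \<psi> t + l * of_real (s - t)) \<le> e / 2 * \<bar>s - t\<bar>"
    proof (cases "s \<le> t")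
      case True
      then have "prim \<psi> s - prim \<psi> t + l * of_real (s - t) = prim \<psi> s - prim \<psi> t - l * of_real (t - s)"
        by (simp add: algebra_simps)
      then show ?thesis using \<open>norm (prim \<psi> (min s t) - _ - _) \<le> _\<close> True by (simp add: min_def max_def)
    next
      case False
      then have "norm (prim \<psi> s - prim \<psi> t + l * of_real (s - t)) = norm (prim \<psi> t - prim \<psi> s - l * of_real (s - t))"
        by (subst norm_minus_cancel[symmetric]) (simp add: algebra_simps)
      then show ?thesis using \<open>norm (prim \<psi> (min s t) - _ - _) \<le> _\<close> False by (simp add: min_def max_def)
    qed
    then have "norm ((prim \<psi> s - prim \<psi> t + l * of_real (s - t)) / of_real (s - t)) \<le> e / 2"
      using ne by (simp add: norm_divide pos_divide_le_eq norm_of_real del: of_real_diff)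
    moreover have "(prim \<psi> s - prim \<psi> t + l * of_real (s - t)) / of_real (s - t) = (prim \<psi> s - prim \<psi> t) / of_real (s - t) - (- l)"
      using ne by (simp add: add_divide_distrib del: of_real_diff)
    ultimately show ?thesis using e by (simp only: dist_norm)
  qed
  then show "eventually (\<lambda>s. dist ((prim \<psi> s - prim \<psi> t) / of_real (s - t)) (- slim b \<psi> t) < e) (ess b t)"
    unfolding l_def using eventually_side[of "min d r" b t] d(1) r(1) by (auto elim: eventually_mono)
qed

lemma prim_continuous: assumes "\<psi> \<in> GG I" "van u v \<psi>" shows "continuous_on I (prim \<psi>)"
proof -
  obtain B where B: "0 \<le> B" "AE x in lebesgue_on I. norm (\<psi> x) \<le> B" using GG_bounded[OF assms(1)] .
  have d: "dist (prim \<psi> s) (prim \<psi> t) \<le> B * dist s t" if "s \<in> I" "t \<in> I" for s t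
  proof -
    have *: "norm (prim \<psi> s - prim \<psi> t) \<le> B * (t - s)" if "s \<in> I" "t \<in> I" "s \<le> t" for s t
    proof -
      have "AE x in lebesgue_on I. x \<in> {s<..<t} \<longrightarrow> norm (\<psi> x - 0) \<le> B"
        using B(2) by (auto elim: eventually_mono)
      from prim_diff[OF assms that this B(1)] show ?thesis by simp
    qed
    show ?thesis using *[of s t] *[of t s] that
      by (cases "s \<le> t") (auto simp: dist_norm norm_minus_commute)
  qed
  then have "B-lipschitz_on I (prim \<psi>)" using B(1) by (intro lipschitz_onI) auto
  then show ?thesis by (rule lipschitz_on_continuous_on)
qed

lemma prim_has_uderiv:
  assumes "\<psi> \<in> GG I" "van u v \<psi>" shows "prim \<psi> \<in> GG I" "has_uderiv I (prim \<psi>) (\<lambda>t. - \<psi> t)"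
proof -
  obtain B where B: "AE x in lebesgue_on I. norm (\<psi> x) \<le> B" using GG_bounded[OF assms(1)] .
  have uvI: "u \<in> I" "v \<in> I" using assms(2) by (auto simp: van_def)
  then have "van u (max u v) \<psi>" using van_mono[OF assms(2)] by (simp add: max_def)
  from prim_bound[OF assms(1) this _ B] show "prim \<psi> \<in> GG I"
    by (intro GG_continuous prim_continuous[OF assms]) auto
  show "has_uderiv I (prim \<psi>) (\<lambda>t. - \<psi> t)"
    unfolding has_uderiv_iff
  proof (intro conjI ballI allI)
    show g: "(\<lambda>t. - \<psi> t) \<in> GG I" using GG_cmult[OF assms(1), of "-1"] by simp
    fix t b assume t: "t \<in> I"
    have "slim b (\<lambda>t. - \<psi> t) t = - slim b \<psi> t" using slim_cmult[OF assms(1) t, of b "-1"] by simp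
    then show "((\<lambda>s. (prim \<psi> s - slim b (prim \<psi>) t) / complex_of_real (s - t)) \<longlongrightarrow> slim b (\<lambda>t. - \<psi> t) t) (ess b t)"
      using prim_tendsto[OF assms t] slim_continuous[OF prim_continuous[OF assms] t] by simp
  qed
qed

text \<open>The length \<open>v - u\<close> controls the primitive itself; the 1 in the maximum
  covers its derivatives, which are those of the integrand.\<close>

lemma ggb_prim:
  assumes "ggb k B \<psi>" "van u v \<psi>" "u \<le> v"
  shows "ggb (Suc k) (max 1 (v - u) * B) (prim \<psi>)"
proof (rule ggb_SucI[OF prim_has_uderiv(1)[OF _ assms(2)] _ prim_has_uderiv(2)[OF _ assms(2)]])
  obtain x where "norm (\<psi> x) \<le> B"
    using ggb_AE[OF assms(1)] not_AE_False by (metis (mono_tags, lifting) eventually_mono)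
  then have "0 \<le> B" using norm_ge_zero order_trans by blast
  then have le: "B * (v - u) \<le> max 1 (v - u) * B" "B \<le> max 1 (v - u) * B"
    using mult_right_mono[of "v - u" "max 1 (v - u)" B] mult_right_mono[of 1 "max 1 (v - u)" B]
    by (auto simp: mult.commute)
  show "\<psi> \<in> GG I" "\<psi> \<in> GG I" using assms ggb_GG by auto
  show "AE t in lebesgue_on I. norm (prim \<psi> t) \<le> max 1 (v - u) * B"
    using prim_bound[OF ggb_GG[OF assms(1)] assms(2,3) ggb_AE[OF assms(1)]] le(1) order_trans
    by (intro AE_I2) blast
  show "ggb k (max 1 (v - u) * B) (\<lambda>t. - \<psi> t)"
    using ggb_mono[OF ggb_cmult[OF assms(1), of "-1"], of "max 1 (v - u) * B"] le(2) by simp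
qed

end

section \<open>Test functions and the dual space\<close>

context open_interval
begin

lemma gsupp_slim: "gsupp I g = I \<inter> closure {t \<in> I. \<exists>b. slim b g t \<noteq> 0}"
proof -
  have "(\<exists>b. slim b g t \<noteq> 0) \<longleftrightarrow> llim g t \<noteq> 0 \<or> rlim g t \<noteq> 0" for t
    by (metis (full_types) slim_True slim_False)
  then show ?thesis by (simp add: gsupp_def)
qed

lemma gsuppI: "t \<in> I \<Longrightarrow> slim b g t \<noteq> 0 \<Longrightarrow> t \<in> gsupp I g"
  unfolding gsupp_slim using closure_subset[of "{t \<in> I. \<exists>b. slim b g t \<noteq> 0}"] by auto

lemma has_uderiv_cutl: "(\<lambda>t. 1 - ind x t) \<in> GG I" "has_uderiv I (\<lambda>t. 1 - ind x t) (\<lambda>_. 0)"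
  using GG_add[OF GG_const GG_cmult[OF GG_ind], of 1 "-1" x]
    has_uderiv_add[OF has_uderiv_const has_uderiv_cmult[OF has_uderiv_ind GG_ind] GG_const GG_cmult[OF GG_ind], of 1 "-1" x]
  by auto

lemma AE_ne: "AE x in lebesgue_on I. x \<noteq> y"
  unfolding AE_I using AE_not_in[of "{y}" lebesgue] by (auto elim!: eventually_mono)

text \<open>Multiplication by a step function commutes with differentiation. The parts of
  \<open>g\<close> left of \<open>u\<close> and right of \<open>v\<close> are 0 almost everywhere,
  so uniqueness of derivatives annihilates the same parts of \<open>h\<close>.\<close>

lemma van_uderiv: assumes "van u v g" "g \<in> GG I" "has_uderiv I g h" shows "van u v h"
proof -
  have 1: "ae_eq I (\<lambda>t. (1 - ind u t) * g t) (\<lambda>_. 0)" "ae_eq I (\<lambda>t. ind v t * g t) (\<lambda>_. 0)"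
    unfolding ae_eq_def using van_AE[OF assms(1)] AE_ne[of u] AE_ne[of v]
    by (eventually_elim, force simp: ind_def)+
  have "has_uderiv I (\<lambda>t. (1 - ind u t) * g t) (\<lambda>t. (1 - ind u t) * h t)"
    "has_uderiv I (\<lambda>t. ind v t * g t) (\<lambda>t. ind v t * h t)"
    using has_uderiv_mult[OF has_uderiv_cutl(2) assms(3) has_uderiv_cutl(1) assms(2)]
      has_uderiv_mult[OF has_uderiv_ind assms(3) GG_ind assms(2)] by auto
  then have "ae_eq I (\<lambda>t. (1 - ind u t) * h t) (\<lambda>_. 0)" "ae_eq I (\<lambda>t. ind v t * h t) (\<lambda>_. 0)"
    using has_uderiv_cong[OF has_uderiv_const ae_eq_sym[OF 1(1)] ae_eq_refl] has_uderiv_cong[OF has_uderiv_const ae_eq_sym[OF 1(2)] ae_eq_refl]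
      has_uderiv_unique by blast+
  then have "AE t in lebesgue_on I. t \<notin> {u..v} \<longrightarrow> h t = 0"
    unfolding ae_eq_def by eventually_elim (auto simp: ind_def split: if_splits)
  then show ?thesis using assms(1) by (simp add: van_def)
qed

lemma van_slim: assumes "van u v g" "t \<in> I" "t \<notin> {u..v}" shows "slim b g t = 0"
proof (rule slim_eqI)
  have "eventually (\<lambda>s. s \<in> - {u..v}) (ess b t)"
    using assms(3) by (intro eventually_ess_id eventually_at_in_open') auto
  moreover have "eventually (\<lambda>s. s \<notin> {u..v} \<longrightarrow> g s = 0) (ess b t)"
    using AE_imp_eventually_ess[OF open_I assms(2) van_AE[OF assms(1)]] .
  ultimately have "eventually (\<lambda>s. g s = 0) (ess b t)" by eventually_elim auto
  then show "(g \<longlongrightarrow> 0) (ess b t)" by (rule tendsto_eventually)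
qed

lemma van_gsupp: assumes "van u v g" shows "gsupp I g \<subseteq> {u..v}" "compact (gsupp I g)"
proof -
  have uv: "{u..v} \<subseteq> I" using assms atLeastAtMost_subset_I by (simp add: van_def)
  have "{t \<in> I. \<exists>b. slim b g t \<noteq> 0} \<subseteq> {u..v}" using van_slim[OF assms] by blast
  then have *: "closure {t \<in> I. \<exists>b. slim b g t \<noteq> 0} \<subseteq> {u..v}" by (intro closure_minimal) auto
  then have eq: "gsupp I g = closure {t \<in> I. \<exists>b. slim b g t \<noteq> 0}" using uv by (auto simp: gsupp_slim)
  show "gsupp I g \<subseteq> {u..v}" using * eq by simp
  show "compact (gsupp I g)" unfolding eq
    using * by (meson bounded_closed_interval bounded_subset closed_closure compact_eq_bounded_closed)
qed

lemma RR_I: "g \<in> GGinf I \<Longrightarrow> van u v g \<Longrightarrow> g \<in> RR I"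
  unfolding RR_def using van_gsupp(2) by blast

lemma RR_GGinf: "g \<in> RR I \<Longrightarrow> g \<in> GGinf I"
  by (simp add: RR_def)

lemma RR_GG: "g \<in> RR I \<Longrightarrow> g \<in> GG I"
  using RR_GGinf GGinf_GG by blast

text \<open>The compact support has extreme points inside the open set \<open>J\<close>, which
  leaves room to widen it on both sides within \<open>J\<close>. With
  \<open>J = I \<inter> {..<t0}\<close> the support interval ends strictly before
  \<open>t0\<close>.\<close>

lemma RR_van_in:
  assumes g: "g \<in> RR I" and J: "open J" "J \<noteq> {}" "J \<subseteq> I" "gsupp I g \<subseteq> J"
  obtains u v where "u \<in> J" "v \<in> J" "u \<le> v" "van u v g"
proof (cases "gsupp I g = {}")
  case True
  then have "slim b g t = 0" if "t \<in> I" for t b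
    using gsuppI[OF that, of b g] by auto
  then have "ae_eq I g (\<lambda>_. 0)" by (intro ae_eq_slimI RR_GG[OF g]) auto
  then have *: "AE t in lebesgue_on I. g t = 0" by (simp add: ae_eq_def)
  obtain x where x: "x \<in> J" using J by blast
  have "van x x g" unfolding van_def using x J(3) * by (auto elim!: eventually_mono)
  then show ?thesis using that x by blast
next
  case False
  have K: "compact (gsupp I g)" using g by (simp add: RR_def)
  obtain m where m: "m \<in> gsupp I g" "\<forall>t\<in>gsupp I g. m \<le> t" using compact_attains_inf[OF K False] by blast
  obtain n where n: "n \<in> gsupp I g" "\<forall>t\<in>gsupp I g. t \<le> n" using compact_attains_sup[OF K False] by blast
  obtain r where r: "r > 0" "ball m r \<subseteq> J" using m J open_contains_ball by blast
  obtain r' where r': "r' > 0" "ball n r' \<subseteq> J" using n J open_contains_ball by blast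
  define u where "u = m - r / 2"
  define v where "v = n + r' / 2"
  have u: "u \<in> J" "u < m" using r by (auto simp: u_def subset_iff dist_real_def)
  have v: "v \<in> J" "n < v" using r' by (auto simp: v_def subset_iff dist_real_def)
  have supp: "m \<le> t \<and> t \<le> n" if "t \<in> I" "slim b g t \<noteq> 0" for t b
  proof -
    have "t \<in> gsupp I g" using gsuppI that by blast
    then show ?thesis using m n by blast
  qed
  then have supp': "slim b g t = 0 \<or> m \<le> t \<and> t \<le> n" if "t \<in> I" for t b using that by blast
  have "ae_eq I (\<lambda>t. (1 - ind u t) * g t) (\<lambda>_. 0)"
  proof (rule ae_eq_slimI[OF GG_mult[OF has_uderiv_cutl(1) RR_GG[OF g]] GG_const])
    fix t b assume t: "t \<in> I"
    have "slim b (\<lambda>t. 1 - ind u t) t = 1 - slim b (ind u) t" using slim_diff[OF GG_const GG_ind t, of b 1 u] by simp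
    then show "slim b (\<lambda>t. (1 - ind u t) * g t) t = slim b (\<lambda>_. 0) t"
      using supp'[OF t, of b] u(2) by (auto simp: slim_mult[OF has_uderiv_cutl(1) RR_GG[OF g] t] slim_ind)
  qed
  moreover have "ae_eq I (\<lambda>t. ind v t * g t) (\<lambda>_. 0)"
  proof (rule ae_eq_slimI[OF GG_mult[OF GG_ind RR_GG[OF g]] GG_const])
    fix t b assume t: "t \<in> I"
    show "slim b (\<lambda>t. ind v t * g t) t = slim b (\<lambda>_. 0) t"
      using supp'[OF t, of b] v(2) by (auto simp: slim_mult[OF GG_ind RR_GG[OF g] t] slim_ind)
  qed
  ultimately have "AE t in lebesgue_on I. t \<notin> {u..v} \<longrightarrow> g t = 0"
    unfolding ae_eq_def by eventually_elim (auto simp: ind_def split: if_splits)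
  then have "van u v g" using u v J by (auto simp: van_def)
  then show ?thesis using that[of u v] u v m(2) n(1) by auto
qed

lemma RR_van: assumes "g \<in> RR I" obtains u v where "u \<in> I" "v \<in> I" "u \<le> v" "van u v g"
  using RR_van_in[OF assms open_I nonempty_I] by (auto simp: gsupp_def)

lemma van_common:
  assumes "van u v f" "van u' v' g"
  obtains x y where "x \<in> I" "y \<in> I" "x \<le> y" "van x y f" "van x y g"
proof -
  have i: "u \<in> I" "v \<in> I" "u' \<in> I" "v' \<in> I" using assms by (auto simp: van_def)
  define x where "x = min u u'"
  define y where "y = max (max v v') u"
  have "x \<in> I" "y \<in> I" "x \<le> y" using i by (auto simp: x_def y_def min_def max_def)
  moreover have "van x y f" "van x y g"
    using van_mono[OF assms(1), of x y] van_mono[OF assms(2), of x y] \<open>x \<in> I\<close> \<open>y \<in> I\<close> by (auto simp: x_def y_def)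
  ultimately show ?thesis using that by blast
qed

lemma RR_add: assumes "f \<in> RR I" "g \<in> RR I" shows "(\<lambda>t. f t + g t) \<in> RR I"
proof -
  obtain u v where "van u v f" using RR_van[OF assms(1)] .
  moreover obtain u' v' where "van u' v' g" using RR_van[OF assms(2)] .
  ultimately obtain x y where "van x y f" "van x y g" using van_common by blast
  then show ?thesis using RR_I[OF GGinf_add van_add] assms RR_GGinf by blast
qed

lemma RR_mult: assumes "g \<in> GGinf I" "f \<in> RR I" shows "(\<lambda>t. g t * f t) \<in> RR I"
  using RR_van[OF assms(2)] RR_I[OF GGinf_mult van_mult] assms RR_GGinf by metis

lemma RR_cmult: "f \<in> RR I \<Longrightarrow> (\<lambda>t. l * f t) \<in> RR I"
  using RR_mult[OF GGinf_const] .

lemma RR_lin: "f \<in> RR I \<Longrightarrow> g \<in> RR I \<Longrightarrow> (\<lambda>t. c * f t + d * g t) \<in> RR I"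
  by (intro RR_add RR_cmult)

lemma RR_cong: "f \<in> RR I \<Longrightarrow> ae_eq I f g \<Longrightarrow> g \<in> RR I"
  using RR_van RR_I GGinf_cong van_cong RR_GGinf by metis

lemma RR_zero [simp]: "(\<lambda>_. 0) \<in> RR I"
proof -
  obtain x where "x \<in> I" using nonempty_I by blast
  then show ?thesis by (intro RR_I[of _ x x]) (auto simp: van_def)
qed

lemma RR_sum: "(\<And>i. i \<in> A \<Longrightarrow> f i \<in> RR I) \<Longrightarrow> (\<lambda>t. \<Sum>i\<in>A. f i t) \<in> RR I"
  by (induction A rule: infinite_finite_induct) (auto intro: RR_add)

lemma RR_uderiv: assumes "f \<in> RR I" shows "uderiv I f \<in> RR I"
  using RR_van[OF assms] RR_I van_uderiv uderiv_has uderiv_GGinf RR_GGinf[OF assms] RR_GG[OF assms] by metis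

lemma ggb_nonneg: assumes "ggb k B g" shows "0 \<le> B"
proof -
  obtain x where "norm (g x) \<le> B"
    using ggb_AE[OF assms] not_AE_False by (metis (mono_tags, lifting) eventually_mono)
  then show ?thesis using norm_ge_zero order_trans by blast
qed

text \<open>The point is that the whole space is a zero neighbourhood: a function vanishing outside
  \<open>J\<close> has its support in the compact set \<open>closure J\<close>, so each step of the
  inductive limit lies in \<open>RR I\<close>.\<close>

lemma topspace_RR: "topspace (RR_topology I) = RR I"
proof
  show "topspace (RR_topology I) \<subseteq> RR I"
    unfolding topspace_def openin_RR_topology RR_open_def by blast
  have plus: "(\<lambda>t. f t + g t) = f + g" for f g :: "real \<Rightarrow> complex" by (simp add: fun_eq_iff)
  have "zero_nbhd I (RR I)"
    unfolding zero_nbhd_def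
  proof (intro conjI ballI allI impI)
    fix J assume J: "is_interval J \<and> bounded J \<and> closure J \<subseteq> I"
    have "RR_on I J \<subseteq> RR I"
    proof
      fix g assume g: "g \<in> RR_on I J"
      have "{t \<in> I. \<exists>b. slim b g t \<noteq> 0} \<subseteq> closure J"
      proof
        fix t assume "t \<in> {t \<in> I. \<exists>b. slim b g t \<noteq> 0}"
        then obtain b where t: "t \<in> I" "slim b g t \<noteq> 0" by blast
        show "t \<in> closure J"
        proof (rule ccontr)
          assume n: "t \<notin> closure J"
          have "eventually (\<lambda>s. s \<in> - closure J) (ess b t)"
            using n by (intro eventually_ess_id eventually_at_in_open') auto
          moreover have "eventually (\<lambda>s. s \<notin> J \<longrightarrow> g s = 0) (ess b t)"
            using AE_imp_eventually_ess[OF open_I t(1)] g unfolding RR_on_def by blast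
          ultimately have "eventually (\<lambda>s. g s = 0) (ess b t)"
            by eventually_elim (use closure_subset in auto)
          then have "slim b g t = 0" by (intro slim_eqI tendsto_eventually)
          then show False using t by simp
        qed
      qed
      then have *: "closure {t \<in> I. \<exists>b. slim b g t \<noteq> 0} \<subseteq> closure J" by (intro closure_minimal) auto
      then have eq: "gsupp I g = closure {t \<in> I. \<exists>b. slim b g t \<noteq> 0}" using J by (auto simp: gsupp_slim)
      have "compact (gsupp I g)" unfolding eq
        using * J by (meson bounded_closure bounded_subset closed_closure compact_eq_bounded_closed)
      then show "g \<in> RR I" using g by (simp add: RR_def RR_on_def)
    qed
    then show "\<exists>k. \<exists>e>0. {\<phi> \<in> RR_on I J. GG_norm I k \<phi> < e} \<subseteq> RR I"
      by (intro exI[of _ 0] exI[of _ 1]) auto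
  qed (auto intro: RR_lin)
  then have "RR_open I (RR I)"
    unfolding RR_open_def using RR_add by (auto intro!: exI[of _ "RR I"] simp: plus[symmetric])
  then show "RR I \<subseteq> topspace (RR_topology I)"
    unfolding topspace_def openin_RR_topology by blast
qed

lemma RR_on_van: "u \<in> I \<Longrightarrow> v \<in> I \<Longrightarrow> g \<in> RR_on I {u..v} \<longleftrightarrow> g \<in> GGinf I \<and> van u v g"
  by (auto simp: RR_on_def van_def)

text \<open>Continuity on the inductive limit, read step by step: over each compact interval one
  norm dominates. For linear functionals \<open>RR_dual_I\<close> and \<open>RR_dual_dbound\<close>
  show this to be equivalent to continuity.\<close>

definition dbound :: "((real \<Rightarrow> complex) \<Rightarrow> complex) \<Rightarrow> bool" where
  "dbound f \<longleftrightarrow> (\<forall>u\<in>I. \<forall>v\<in>I. u \<le> v \<longrightarrow> (\<exists>k. \<exists>C\<ge>0. \<forall>\<phi> B. \<phi> \<in> GGinf I \<longrightarrow> van u v \<phi> \<longrightarrow> ggb k B \<phi> \<longrightarrow>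
     norm (f \<phi>) \<le> C * B))"

lemma RR_dual_lin: "f \<in> RR_dual I \<Longrightarrow> \<phi> \<in> RR I \<Longrightarrow> \<psi> \<in> RR I \<Longrightarrow>
    f (\<lambda>t. c * \<phi> t + d * \<psi> t) = c * f \<phi> + d * f \<psi>"
  unfolding RR_dual_def by blast

lemma RR_dual_cong: "f \<in> RR_dual I \<Longrightarrow> \<phi> \<in> RR I \<Longrightarrow> ae_eq I \<phi> \<psi> \<Longrightarrow> f \<phi> = f \<psi>"
  using RR_cong unfolding RR_dual_def by blast

lemma RR_dual_outside: "f \<in> RR_dual I \<Longrightarrow> \<phi> \<notin> RR I \<Longrightarrow> f \<phi> = 0"
  by (simp add: RR_dual_def)

lemma RR_dual_add: "f \<in> RR_dual I \<Longrightarrow> \<phi> \<in> RR I \<Longrightarrow> \<psi> \<in> RR I \<Longrightarrow> f (\<lambda>t. \<phi> t + \<psi> t) = f \<phi> + f \<psi>"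
  using RR_dual_lin[of f \<phi> \<psi> 1 1] by simp

lemma RR_dual_cmult: "f \<in> RR_dual I \<Longrightarrow> \<phi> \<in> RR I \<Longrightarrow> f (\<lambda>t. c * \<phi> t) = c * f \<phi>"
  using RR_dual_lin[of f \<phi> "\<lambda>_. 0" c 0] by simp

lemma RR_dual_zero: "f \<in> RR_dual I \<Longrightarrow> f (\<lambda>_. 0) = 0"
  using RR_dual_cmult[of f "\<lambda>_. 0" 0] by simp

lemma RR_dual_sum: "f \<in> RR_dual I \<Longrightarrow> (\<And>i. i \<in> A \<Longrightarrow> \<phi> i \<in> RR I) \<Longrightarrow>
    f (\<lambda>t. \<Sum>i\<in>A. \<phi> i t) = (\<Sum>i\<in>A. f (\<phi> i))"
proof (induction A rule: infinite_finite_induct)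
  case (insert x F)
  have "f (\<lambda>t. \<phi> x t + (\<Sum>i\<in>F. \<phi> i t)) = f (\<phi> x) + f (\<lambda>t. \<Sum>i\<in>F. \<phi> i t)"
    using insert.prems by (intro RR_dual_add RR_sum) auto
  then show ?case using insert by simp
qed (auto simp: RR_dual_zero)

text \<open>The set where \<open>norm (f v) < e\<close> is absolutely convex by linearity and
  contains a ball of each step by \<open>dbound\<close>, so it is a zero neighbourhood; translation
  gives continuity everywhere.\<close>

lemma RR_dual_I:
  assumes lin: "\<And>\<phi> \<psi> c d. \<phi> \<in> RR I \<Longrightarrow> \<psi> \<in> RR I \<Longrightarrow> f (\<lambda>t. c * \<phi> t + d * \<psi> t) = c * f \<phi> + d * f \<psi>"
    and out: "\<And>\<phi>. \<phi> \<notin> RR I \<Longrightarrow> f \<phi> = 0" and bd: "dbound f"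
  shows "f \<in> RR_dual I"
proof -
  \<comment> \<open>Invariance under null sets comes for free: the difference is bounded by 0 in
    every order, and \<open>dbound\<close> then forces its value to be 0.\<close>
  have cong: "f \<phi> = f \<psi>" if "\<phi> \<in> RR I" "\<psi> \<in> RR I" "ae_eq I \<phi> \<psi>" for \<phi> \<psi>
  proof -
    define d where "d = (\<lambda>t. 1 * \<phi> t + (-1) * \<psi> t)"
    have dR: "d \<in> RR I" unfolding d_def by (intro RR_lin that)
    have ae: "ae_eq I d (\<lambda>_. 0)" using that(3) unfolding d_def ae_eq_def by (auto elim: eventually_mono)
    obtain x where x: "x \<in> I" using nonempty_I by blast
    have "van x x d" unfolding van_def using x ae unfolding ae_eq_def by (auto elim!: eventually_mono)
    moreover have "ggb k 0 d" for k by (rule ggb_cong[OF ggb_const ae_eq_sym[OF ae]]) simp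
    ultimately have "norm (f d) \<le> 0"
      using bd x RR_GGinf[OF dR] unfolding dbound_def by (metis mult_zero_right order_refl)
    moreover have "f d = f \<phi> - f \<psi>" unfolding d_def using lin[OF that(1,2), of 1 "-1"] by simp
    ultimately show ?thesis by simp
  qed
  have "continuous_map (RR_topology I) euclidean f"
    unfolding continuous_map_def topspace_RR
  proof (intro conjI allI impI)
    fix U :: "complex set" assume U: "openin euclidean U"
    show "openin (RR_topology I) {x \<in> RR I. f x \<in> U}"
      unfolding openin_RR_topology RR_open_def
    proof (intro conjI ballI)
      fix \<phi> assume "\<phi> \<in> {x \<in> RR I. f x \<in> U}"
      then have \<phi>: "\<phi> \<in> RR I" "f \<phi> \<in> U" by auto
      obtain e where e: "e > 0" "ball (f \<phi>) e \<subseteq> U" using U \<phi>(2) open_contains_ball by force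
      define V where "V = {v \<in> RR I. norm (f v) < e}"
      have "zero_nbhd I V"
        unfolding zero_nbhd_def
      proof (intro conjI ballI allI impI)
        fix x y and c d :: complex assume xy: "x \<in> V" "y \<in> V" and cd: "norm c + norm d \<le> 1"
        have "norm (c * f x + d * f y) \<le> norm c * norm (f x) + norm d * norm (f y)"
          by (metis norm_mult norm_triangle_ineq)
        also have "\<dots> \<le> norm c * max (norm (f x)) (norm (f y)) + norm d * max (norm (f x)) (norm (f y))"
          by (intro add_mono mult_left_mono) auto
        also have "\<dots> \<le> 1 * max (norm (f x)) (norm (f y))"
          unfolding distrib_right[symmetric] using cd by (intro mult_right_mono) (auto simp: le_max_iff_disj)
        also have "\<dots> < e" using xy by (simp add: V_def)
        finally show "(\<lambda>t. c * x t + d * y t) \<in> V" using xy lin by (simp add: V_def RR_lin)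
      next
        fix J assume J: "is_interval J \<and> bounded J \<and> closure J \<subseteq> I"
        obtain u v where uv: "u \<in> I" "v \<in> I" "u \<le> v" "J \<subseteq> {u..v}"
        proof (cases "J = {}")
          case True then show ?thesis using that nonempty_I by blast
        next
          case False
          have K: "compact (closure J)" "closure J \<noteq> {}" using J False by (auto simp: compact_closure)
          obtain m where "m \<in> closure J" "\<forall>t\<in>closure J. m \<le> t" using compact_attains_inf[OF K] by blast
          moreover obtain n where "n \<in> closure J" "\<forall>t\<in>closure J. t \<le> n" using compact_attains_sup[OF K] by blast
          ultimately show ?thesis using that[of m n] J closure_subset[of J] by (auto simp: subset_iff)
        qed
        obtain k C where kC: "C \<ge> 0" "\<And>\<phi> B. \<phi> \<in> GGinf I \<Longrightarrow> van u v \<phi> \<Longrightarrow> ggb k B \<phi> \<Longrightarrow> norm (f \<phi>) \<le> C * B"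
          using bd uv unfolding dbound_def by meson
        \<comment> \<open>The 1 added to \<open>C\<close> admits \<open>C = 0\<close> and makes the
          final inequality strict.\<close>
        have "{\<phi> \<in> RR_on I J. GG_norm I k \<phi> < e / (C + 1)} \<subseteq> V"
        proof
          fix \<phi> assume "\<phi> \<in> {\<phi> \<in> RR_on I J. GG_norm I k \<phi> < e / (C + 1)}"
          then have \<phi>: "\<phi> \<in> GGinf I" "AE t in lebesgue_on I. t \<notin> J \<longrightarrow> \<phi> t = 0" "GG_norm I k \<phi> < e / (C + 1)"
            by (auto simp: RR_on_def)
          have v: "van u v \<phi>" unfolding van_def using uv \<phi>(2) by (auto elim!: eventually_mono)
          have g: "ggb k (GG_norm I k \<phi>) \<phi>" using GG_norm_le_iff[OF \<phi>(1)] by blast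
          have "norm (f \<phi>) \<le> C * GG_norm I k \<phi>" using kC(2)[OF \<phi>(1) v g] .
          also have "\<dots> \<le> C * (e / (C + 1))" using \<phi>(3) kC(1) by (intro mult_left_mono) auto
          also have "\<dots> < e" using e(1) kC(1) by (simp add: field_simps)
          finally show "\<phi> \<in> V" using RR_I[OF \<phi>(1) v] by (simp add: V_def)
        qed
        then show "\<exists>k. \<exists>e>0. {\<phi> \<in> RR_on I J. GG_norm I k \<phi> < e} \<subseteq> V"
          using e(1) kC(1) by (intro exI[of _ k] exI[of _ "e / (C + 1)"]) auto
      qed (auto simp: V_def)
      moreover have "(\<lambda>v. \<phi> + v) ` V \<subseteq> {x \<in> RR I. f x \<in> U}"
      proof (rule image_subsetI)
        fix v assume v: "v \<in> V"
        have eq: "\<phi> + v = (\<lambda>t. 1 * \<phi> t + 1 * v t)" by (simp add: fun_eq_iff)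
        have "\<phi> + v \<in> RR I" unfolding eq using v by (intro RR_lin \<phi>) (simp add: V_def)
        moreover have "f (\<phi> + v) = f \<phi> + f v"
          unfolding eq using v lin[OF \<phi>(1), of v 1 1] by (simp add: V_def)
        ultimately show "\<phi> + v \<in> {x \<in> RR I. f x \<in> U}"
          using e(2) v by (auto simp: V_def dist_norm subset_iff)
      qed
      ultimately show "\<exists>V. zero_nbhd I V \<and> (\<lambda>v. \<phi> + v) ` V \<subseteq> {x \<in> RR I. f x \<in> U}" by blast
    qed auto
  qed auto
  then show ?thesis unfolding RR_dual_def using cong lin out by blast
qed

text \<open>By continuity \<open>norm (f \<phi>) < 1\<close> on a ball of some norm in the given
  step, and homogeneity spreads this to all sizes.\<close>

lemma RR_dual_dbound: assumes f: "f \<in> RR_dual I" shows "dbound f"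
  unfolding dbound_def
proof (intro ballI impI)
  fix u v assume uv: "u \<in> I" "v \<in> I" "u \<le> v"
  have "openin (RR_topology I) {x \<in> topspace (RR_topology I). f x \<in> ball 0 1}"
    using f by (intro openin_continuous_map_preimage[where Y = euclidean]) (auto simp: RR_dual_def)
  then have "RR_open I {x \<in> RR I. f x \<in> ball 0 1}" by (simp add: openin_RR_topology topspace_RR)
  moreover have "(\<lambda>_. 0) \<in> {x \<in> RR I. f x \<in> ball 0 1}" using RR_dual_zero[OF f] by simp
  ultimately obtain V where V: "zero_nbhd I V" "(\<lambda>v. (\<lambda>_. 0) + v) ` V \<subseteq> {x \<in> RR I. f x \<in> ball 0 1}"
    unfolding RR_open_def by blast
  have z: "(\<lambda>_. 0) + v = v" for v :: "real \<Rightarrow> complex" by (simp add: fun_eq_iff)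
  have VU: "V \<subseteq> {x \<in> RR I. f x \<in> ball 0 1}" using V(2) unfolding z by simp
  have "is_interval {u..v} \<and> bounded {u..v} \<and> closure {u..v} \<subseteq> I"
    using uv atLeastAtMost_subset_I by (auto simp: is_interval_cc)
  then obtain k e where e: "e > 0" "{\<phi> \<in> RR_on I {u..v}. GG_norm I k \<phi> < e} \<subseteq> V"
    using V(1) unfolding zero_nbhd_def by meson
  have "norm (f \<phi>) \<le> 2 / e * B" if \<phi>: "\<phi> \<in> GGinf I" "van u v \<phi>" "ggb k B \<phi>" for \<phi> B
  proof (rule field_le_epsilon)
    fix r :: real assume r: "r > 0"
    \<comment> \<open>Enlarging \<open>B\<close> makes it positive, so that scaling to norm
      \<open>e / 2\<close> is possible even for \<open>B = 0\<close>; the amount is chosen so that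
      the final bound exceeds \<open>2 / e * B\<close> by exactly \<open>r\<close>.\<close>
    define B' where "B' = B + r * e / 2"
    have B: "B' > 0" "B \<le> B'" using ggb_nonneg[OF \<phi>(3)] r e(1) by (auto simp: B'_def add_nonneg_pos)
    define s where "s = e / (2 * B')"
    have s: "s > 0" using B e by (simp add: s_def)
    define \<psi> where "\<psi> = (\<lambda>t. of_real s * \<phi> t)"
    have "ggb k (norm (complex_of_real s) * B') \<psi>"
      unfolding \<psi>_def by (rule ggb_cmult) (rule ggb_mono[OF \<phi>(3) B(2)])
    moreover have "norm (complex_of_real s) * B' = e / 2"
    proof -
      have "norm (complex_of_real s) = s" using s by simp
      then show ?thesis using B by (simp add: s_def del: norm_of_real)
    qed
    ultimately have "ggb k (e / 2) \<psi>" by (simp only:)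
    then have "GG_norm I k \<psi> \<le> e / 2"
      using GG_norm_le_iff[of \<psi> k "e / 2"] GGinf_cmult[OF \<phi>(1)] by (simp add: \<psi>_def)
    then have "\<psi> \<in> V" using e uv \<phi> by (auto intro!: subsetD[OF e(2)] simp: RR_on_van \<psi>_def GGinf_cmult van_mult)
    then have "norm (f \<psi>) < 1" using VU by auto
    moreover have "f \<psi> = of_real s * f \<phi>" unfolding \<psi>_def using RR_dual_cmult[OF f RR_I[OF \<phi>(1,2)]] .
    ultimately have "s * norm (f \<phi>) < 1" using s by (simp add: norm_mult)
    then have "norm (f \<phi>) < 1 / s" using s by (simp add: field_simps)
    also have "1 / s = 2 / e * B + r" using e B by (simp add: s_def B'_def field_simps)
    finally show "norm (f \<phi>) \<le> 2 / e * B + r" by simp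
  qed
  then show "\<exists>k. \<exists>C\<ge>0. \<forall>\<phi> B. \<phi> \<in> GGinf I \<longrightarrow> van u v \<phi> \<longrightarrow> ggb k B \<phi> \<longrightarrow> norm (f \<phi>) \<le> C * B"
    using e(1) by (intro exI[of _ k] exI[of _ "2 / e"]) auto
qed

subsection \<open>Transposed operators\<close>

text \<open>The order \<open>j\<close> of the input may exceed the order \<open>k\<close> of the
  output, as for differentiation, while one target interval serves all orders.\<close>

definition op_bd :: "((real \<Rightarrow> complex) \<Rightarrow> (real \<Rightarrow> complex)) \<Rightarrow> real \<Rightarrow> real \<Rightarrow> real \<Rightarrow> real \<Rightarrow> bool" where
  "op_bd T u v u' v' \<longleftrightarrow> (\<forall>k. \<exists>j. \<exists>C\<ge>0. \<forall>\<phi> B. \<phi> \<in> GGinf I \<longrightarrow> van u v \<phi> \<longrightarrow> ggb j B \<phi> \<longrightarrow>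
     van u' v' (T \<phi>) \<and> ggb k (C * B) (T \<phi>))"

text \<open>Linearity is asked modulo null sets because \<open>uderiv\<close> and the resolvent pick
  arbitrary representatives.\<close>

definition RR_op :: "((real \<Rightarrow> complex) \<Rightarrow> (real \<Rightarrow> complex)) \<Rightarrow> bool" where
  "RR_op T \<longleftrightarrow> (\<forall>\<phi>\<in>RR I. T \<phi> \<in> RR I) \<and>
     (\<forall>\<phi>\<in>RR I. \<forall>\<psi>\<in>RR I. \<forall>c d. ae_eq I (T (\<lambda>t. c * \<phi> t + d * \<psi> t)) (\<lambda>t. c * T \<phi> t + d * T \<psi> t)) \<and>
     (\<forall>u\<in>I. \<forall>v\<in>I. u \<le> v \<longrightarrow> (\<exists>u'\<in>I. \<exists>v'\<in>I. u' \<le> v' \<and> op_bd T u v u' v'))"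

definition pull :: "((real \<Rightarrow> complex) \<Rightarrow> (real \<Rightarrow> complex)) \<Rightarrow> ((real \<Rightarrow> complex) \<Rightarrow> complex) \<Rightarrow>
    ((real \<Rightarrow> complex) \<Rightarrow> complex)" where
  "pull T f = (\<lambda>\<phi>. if \<phi> \<in> RR I then f (T \<phi>) else 0)"

lemma RR_op_RR: "RR_op T \<Longrightarrow> \<phi> \<in> RR I \<Longrightarrow> T \<phi> \<in> RR I"
  by (simp add: RR_op_def)

lemma RR_op_lin: "RR_op T \<Longrightarrow> \<phi> \<in> RR I \<Longrightarrow> \<psi> \<in> RR I \<Longrightarrow>
    ae_eq I (T (\<lambda>t. c * \<phi> t + d * \<psi> t)) (\<lambda>t. c * T \<phi> t + d * T \<psi> t)"
  by (simp add: RR_op_def)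

lemma RR_op_bd: assumes "RR_op T" "u \<in> I" "v \<in> I" "u \<le> v"
  obtains u' v' where "u' \<in> I" "v' \<in> I" "u' \<le> v'" "op_bd T u v u' v'"
  using assms unfolding RR_op_def by blast

lemma pull_RR_dual: assumes T: "RR_op T" and f: "f \<in> RR_dual I" shows "pull T f \<in> RR_dual I"
proof (rule RR_dual_I)
  fix \<phi> \<psi> and c d :: complex assume *: "\<phi> \<in> RR I" "\<psi> \<in> RR I"
  have "f (T (\<lambda>t. c * \<phi> t + d * \<psi> t)) = f (\<lambda>t. c * T \<phi> t + d * T \<psi> t)"
    by (rule RR_dual_cong[OF f RR_op_RR[OF T RR_lin[OF *]] RR_op_lin[OF T *]])
  then show "pull T f (\<lambda>t. c * \<phi> t + d * \<psi> t) = c * pull T f \<phi> + d * pull T f \<psi>"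
    using * RR_lin[OF *] RR_dual_lin[OF f RR_op_RR[OF T *(1)] RR_op_RR[OF T *(2)]] by (simp add: pull_def)
next
  show "dbound (pull T f)"
    unfolding dbound_def
  proof (intro ballI impI)
    fix u v assume uv: "u \<in> I" "v \<in> I" "u \<le> v"
    obtain u' v' where u'v': "u' \<in> I" "v' \<in> I" "u' \<le> v'" "op_bd T u v u' v'"
      using RR_op_bd[OF T uv] by blast
    obtain k C where kC: "C \<ge> 0" "\<And>\<phi> B. \<phi> \<in> GGinf I \<Longrightarrow> van u' v' \<phi> \<Longrightarrow> ggb k B \<phi> \<Longrightarrow> norm (f \<phi>) \<le> C * B"
      using RR_dual_dbound[OF f] u'v'(1-3) unfolding dbound_def by meson
    obtain j D where jD: "D \<ge> 0" "\<And>\<phi> B. \<phi> \<in> GGinf I \<Longrightarrow> van u v \<phi> \<Longrightarrow> ggb j B \<phi> \<Longrightarrow> van u' v' (T \<phi>) \<and> ggb k (D * B) (T \<phi>)"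
      using u'v'(4) unfolding op_bd_def by meson
    have "norm (pull T f \<phi>) \<le> (C * D) * B" if "\<phi> \<in> GGinf I" "van u v \<phi>" "ggb j B \<phi>" for \<phi> B
      using kC(2)[of "T \<phi>" "D * B"] jD(2)[OF that] RR_GGinf[OF RR_op_RR[OF T RR_I[OF that(1,2)]]] RR_I[OF that(1,2)]
      by (simp add: pull_def mult.assoc)
    then show "\<exists>k. \<exists>C\<ge>0. \<forall>\<phi> B. \<phi> \<in> GGinf I \<longrightarrow> van u v \<phi> \<longrightarrow> ggb k B \<phi> \<longrightarrow> norm (pull T f \<phi>) \<le> C * B"
      using kC(1) jD(1) by (intro exI[of _ j] exI[of _ "C * D"]) auto
  qed
qed (simp add: pull_def)

lemma RR_op_mult: assumes g: "g \<in> GGinf I" shows "RR_op (\<lambda>\<phi> t. g t * \<phi> t)"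
  unfolding RR_op_def
proof (intro conjI ballI allI impI)
  fix u v assume uv: "u \<in> I" "v \<in> I" "u \<le> v"
  have "\<exists>C\<ge>0. \<forall>\<phi> B. \<phi> \<in> GGinf I \<longrightarrow> van u v \<phi> \<longrightarrow> ggb k B \<phi> \<longrightarrow>
      van u v (\<lambda>t. g t * \<phi> t) \<and> ggb k (C * B) (\<lambda>t. g t * \<phi> t)" for k
  proof -
    obtain G where G: "0 \<le> G" "ggb k G g" using GGinf_ggb[OF g] .
    then have "ggb k ((2 ^ k * G) * B) (\<lambda>t. g t * \<phi> t)" if "ggb k B \<phi>" for \<phi> B
      using ggb_mult[OF G(1) ggb_nonneg[OF that] G(2) that] by (simp add: mult.assoc)
    then show ?thesis using G(1) van_mult by (intro exI[of _ "2 ^ k * G"]) auto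
  qed
  then have "op_bd (\<lambda>\<phi> t. g t * \<phi> t) u v u v" unfolding op_bd_def by blast
  then show "\<exists>u'\<in>I. \<exists>v'\<in>I. u' \<le> v' \<and> op_bd (\<lambda>\<phi> t. g t * \<phi> t) u v u' v'"
    using uv by blast
qed (auto intro: RR_mult[OF g] simp: distrib_left mult.left_commute)

lemma uderiv_lin:
  assumes "\<phi> \<in> GGinf I" "\<psi> \<in> GGinf I"
  shows "ae_eq I (uderiv I (\<lambda>t. c * \<phi> t + d * \<psi> t)) (\<lambda>t. c * uderiv I \<phi> t + d * uderiv I \<psi> t)"
  using assms by (intro uderiv_ae GGinf_add GGinf_cmult has_uderiv_add has_uderiv_cmult uderiv_has GGinf_GG)

lemma RR_op_uderiv: "RR_op (uderiv I)"
  unfolding RR_op_def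
proof (intro conjI ballI allI impI)
  fix u v assume uv: "u \<in> I" "v \<in> I" "u \<le> v"
  have "van u v (uderiv I \<phi>) \<and> ggb k (1 * B) (uderiv I \<phi>)" if "\<phi> \<in> GGinf I" "van u v \<phi>" "ggb (Suc k) B \<phi>" for \<phi> B k
    using that ggb_derivD[OF that(3) uderiv_has] van_uderiv[OF that(2) GGinf_GG uderiv_has] by simp
  then have "op_bd (uderiv I) u v u v" unfolding op_bd_def using zero_le_one by blast
  then show "\<exists>u'\<in>I. \<exists>v'\<in>I. u' \<le> v' \<and> op_bd (uderiv I) u v u' v'"
    using uv by blast
qed (auto intro: RR_uderiv uderiv_lin RR_GGinf)

lemma RR_dual_lincomb: assumes "f \<in> RR_dual I" "g \<in> RR_dual I"
  shows "(\<lambda>\<phi>. c * f \<phi> + d * g \<phi>) \<in> RR_dual I"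
proof (rule RR_dual_I)
  show "dbound (\<lambda>\<phi>. c * f \<phi> + d * g \<phi>)"
    unfolding dbound_def
  proof (intro ballI impI)
    fix u v assume uv: "u \<in> I" "v \<in> I" "u \<le> v"
    obtain k C where kC: "C \<ge> 0" "\<And>\<phi> B. \<phi> \<in> GGinf I \<Longrightarrow> van u v \<phi> \<Longrightarrow> ggb k B \<phi> \<Longrightarrow> norm (f \<phi>) \<le> C * B"
      using RR_dual_dbound[OF assms(1)] uv unfolding dbound_def by meson
    obtain l D where lD: "D \<ge> 0" "\<And>\<phi> B. \<phi> \<in> GGinf I \<Longrightarrow> van u v \<phi> \<Longrightarrow> ggb l B \<phi> \<Longrightarrow> norm (g \<phi>) \<le> D * B"
      using RR_dual_dbound[OF assms(2)] uv unfolding dbound_def by meson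
    have "norm (c * f \<phi> + d * g \<phi>) \<le> (norm c * C + norm d * D) * B"
      if \<phi>: "\<phi> \<in> GGinf I" "van u v \<phi>" "ggb (max k l) B \<phi>" for \<phi> B
    proof -
      have "norm (c * f \<phi> + d * g \<phi>) \<le> norm c * norm (f \<phi>) + norm d * norm (g \<phi>)"
        by (metis norm_mult norm_triangle_ineq)
      also have "\<dots> \<le> norm c * (C * B) + norm d * (D * B)"
        using kC(2)[OF \<phi>(1,2) ggb_le[OF \<phi>(3)]] lD(2)[OF \<phi>(1,2) ggb_le[OF \<phi>(3)]]
        by (intro add_mono mult_left_mono) auto
      finally show ?thesis by (simp add: algebra_simps)
    qed
    then show "\<exists>k. \<exists>C\<ge>0. \<forall>\<phi> B. \<phi> \<in> GGinf I \<longrightarrow> van u v \<phi> \<longrightarrow> ggb k B \<phi> \<longrightarrow> norm (c * f \<phi> + d * g \<phi>) \<le> C * B"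
      using kC(1) lD(1) by (intro exI[of _ "max k l"] exI[of _ "norm c * C + norm d * D"]) auto
  qed
qed (auto simp: RR_dual_lin assms RR_dual_outside algebra_simps)

lemma RR_dual_zero_fun: "(\<lambda>_. 0) \<in> RR_dual I"
  by (rule RR_dual_I) (auto simp: dbound_def intro!: exI[of _ 0])

lemma RR_dual_fun_add: "f \<in> RR_dual I \<Longrightarrow> g \<in> RR_dual I \<Longrightarrow> (\<lambda>\<phi>. f \<phi> + g \<phi>) \<in> RR_dual I"
  using RR_dual_lincomb[of f g 1 1] by simp

lemma RR_dual_fun_diff: "f \<in> RR_dual I \<Longrightarrow> g \<in> RR_dual I \<Longrightarrow> (\<lambda>\<phi>. f \<phi> - g \<phi>) \<in> RR_dual I"
  using RR_dual_lincomb[of f g 1 "-1"] by simp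

lemma RR_dual_fun_cmult: "f \<in> RR_dual I \<Longrightarrow> (\<lambda>\<phi>. c * f \<phi>) \<in> RR_dual I"
  using RR_dual_lincomb[of f f c 0] by simp

end

section \<open>The truncated primitive and multivalued derivatives\<close>

lemma module_fun: "module (\<lambda>(c :: complex) (g :: real \<Rightarrow> complex) t. c * g t)"
  by unfold_locales (auto simp: fun_eq_iff algebra_simps)

context open_interval
begin

lemma jump_slim: "jump t g = slim True g t - slim False g t"
  by (simp add: jump_def slim_True slim_False)

text \<open>Fundamental theorem of calculus with jumps. After adding the primitive of the derivative
  and a step function that cancels the jumps, the derivative is 0 and no jump is left, so the sum is
  constant; to the right of the support that constant is 0.\<close>

lemma ftc_jumps:
  assumes \<phi>: "\<phi> \<in> GG I" "van u v \<phi>" "has_uderiv I \<phi> h"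
    and J: "finite J" "J \<subseteq> I" "\<And>t. t \<in> I \<Longrightarrow> t \<notin> J \<Longrightarrow> jump t \<phi> = 0"
  shows "ae_eq I \<phi> (\<lambda>t. - prim h t - (\<Sum>s\<in>J. jump s \<phi> * (1 - ind s t)))"
proof -
  have hG: "h \<in> GG I" using \<phi> has_uderiv_GG by blast
  have hv: "van u v h" using van_uderiv \<phi> by blast
  note p = prim_has_uderiv[OF hG hv]
  define S where "S = (\<lambda>t. \<Sum>s\<in>J. jump s \<phi> * (1 - ind s t))"
  define D where "D = (\<lambda>t. (\<phi> t + prim h t) + S t)"
  have SG: "S \<in> GG I" unfolding S_def by (intro GG_sum GG_cmult has_uderiv_cutl)
  have slS: "slim b S t = (\<Sum>s\<in>J. jump s \<phi> * (1 - slim b (ind s) t))" if "t \<in> I" for b t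
    unfolding S_def by (intro slim_eqI tendsto_sum tendsto_mult tendsto_diff tendsto_const GG_tendsto GG_ind that)
  have Su: "has_uderiv I S (\<lambda>_. 0)"
    using J(1) unfolding S_def
  proof (induction J rule: finite_induct)
    case (insert x F)
    have "has_uderiv I (\<lambda>t. jump x \<phi> * (1 - ind x t) + (\<Sum>s\<in>F. jump s \<phi> * (1 - ind s t))) (\<lambda>t. jump x \<phi> * 0 + 0)"
      by (intro has_uderiv_add has_uderiv_cmult has_uderiv_cutl insert GG_sum GG_cmult)
    then show ?case using insert by simp
  qed simp
  have DG: "D \<in> GG I" unfolding D_def by (intro GG_add \<phi> p SG)
  have "has_uderiv I D (\<lambda>t. (h t + - h t) + 0)"
    unfolding D_def by (intro has_uderiv_add \<phi> p SG Su GG_add)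
  then have Du: "has_uderiv I D (\<lambda>_. 0)" by simp
  have slD: "slim b D t = slim b \<phi> t + prim h t + (\<Sum>s\<in>J. jump s \<phi> * (1 - slim b (ind s) t))" if "t \<in> I" for b t
    unfolding D_def using that
    by (simp add: slim_add \<phi> p SG GG_add slS slim_continuous prim_continuous[OF hG hv])
  have "slim True D t = slim False D t" if t: "t \<in> I" for t
  proof -
    have "slim True D t - slim False D t = jump t \<phi> + (\<Sum>s\<in>J. jump s \<phi> * (slim False (ind s) t - slim True (ind s) t))"
    proof -
      have "(\<Sum>s\<in>J. jump s \<phi> * (1 - slim True (ind s) t)) - (\<Sum>s\<in>J. jump s \<phi> * (1 - slim False (ind s) t))
          = (\<Sum>s\<in>J. jump s \<phi> * (slim False (ind s) t - slim True (ind s) t))"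
        unfolding sum_subtractf[symmetric] by (rule sum.cong) (auto simp: algebra_simps)
      then show ?thesis unfolding slD[OF t] jump_slim[of t] by (simp add: algebra_simps)
    qed
    \<comment> \<open>The two one-sided limits of \<open>ind s\<close> at \<open>t\<close> differ
      only for \<open>s = t\<close>.\<close>
    also have "(\<Sum>s\<in>J. jump s \<phi> * (slim False (ind s) t - slim True (ind s) t)) = (\<Sum>s\<in>J. if s = t then - jump t \<phi> else 0)"
      by (rule sum.cong) (auto simp: slim_ind)
    also have "\<dots> = - jump t \<phi>" using J t by auto
    finally show ?thesis by simp
  qed
  then obtain l where l: "ae_eq I D (\<lambda>_. l)" using uderiv_zero_const[OF DG Du] by blast
  \<comment> \<open>A point of \<open>I\<close> to the right of both the support and all jumps;
    \<open>x\<close> lies slightly beyond it, where the constant can be read off.\<close>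
  define M where "M = Max (insert v J)"
  have M: "M \<in> I" "v \<le> M" "\<And>s. s \<in> J \<Longrightarrow> s \<le> M"
  proof -
    have "M \<in> insert v J" unfolding M_def using J(1) by (intro Max_in) auto
    then show "M \<in> I" using J(2) \<phi>(2) by (auto simp: van_def)
  qed (use J(1) in \<open>auto simp: M_def\<close>)
  obtain r where r: "r > 0" "ball M r \<subseteq> I" using open_I M(1) open_contains_ball by blast
  define x where "x = M + r / 2"
  have x: "x \<in> I" "M < x" using r by (auto simp: x_def subset_iff dist_real_def)
  have "slim True D x = 0"
  proof -
    have "slim True \<phi> x = 0" using van_slim[OF \<phi>(2) x(1)] x M by auto
    moreover have "prim h x = 0" using prim_zero[OF hv] x M by auto
    moreover have "(\<Sum>s\<in>J. jump s \<phi> * (1 - slim True (ind s) x)) = 0"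
      using M x by (intro sum.neutral) (force simp: slim_ind)
    ultimately show ?thesis by (simp add: slD x)
  qed
  then have "l = 0" using slim_cong(1)[OF open_I x(1) l, of True] by simp
  then have ae: "AE t in lebesgue_on I. D t = 0" using l by (simp add: ae_eq_def)
  show ?thesis unfolding ae_eq_def
    using ae by eventually_elim (simp add: D_def S_def eq_neg_iff_add_eq_0 add.assoc algebra_simps)
qed

lemma jump_cong: "ae_eq I f g \<Longrightarrow> t \<in> I \<Longrightarrow> jump t f = jump t g"
  using slim_cong(1)[OF open_I] unfolding jump_slim by metis

lemma jump_add: "f \<in> GG I \<Longrightarrow> g \<in> GG I \<Longrightarrow> t \<in> I \<Longrightarrow> jump t (\<lambda>s. f s + g s) = jump t f + jump t g"
  by (simp add: jump_slim slim_add)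

lemma jump_cmult: "g \<in> GG I \<Longrightarrow> t \<in> I \<Longrightarrow> jump t (\<lambda>s. l * g s) = l * jump t g"
  by (simp add: jump_slim slim_cmult algebra_simps)

text \<open>For \<open>k\<close> different from 0 the function itself is the derivative of order 0
  and hence continuous, so jumps can occur for \<open>k = 0\<close> only, where they form a locally
  finite set.\<close>

lemma FF_k_jumps:
  assumes "g \<in> FF_k I k" "compact K" "K \<subseteq> I"
  shows "finite {t \<in> K. jump t g \<noteq> 0}"
proof (cases "k = 0")
  case False
  then have "g \<in> bdd_continuous I" using assms(1) unfolding FF_k_def by force
  then obtain h where h: "ae_eq I g h" "continuous_on I h" unfolding bdd_continuous_def by blast
  have "jump t g = 0" if "t \<in> I" for t
    using jump_cong[OF h(1) that] slim_continuous[OF h(2) that] by (simp add: jump_slim)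
  then have "{t \<in> K. jump t g \<noteq> 0} = {}" using assms(3) by auto
  then show ?thesis by (simp only: finite.emptyI)
next
  case True
  then have "g \<in> piecewise_continuous I" using assms(1) unfolding FF_k_def by force
  then obtain h S where h: "ae_eq I g h" and S: "\<And>K. compact K \<Longrightarrow> K \<subseteq> I \<Longrightarrow> finite (K \<inter> S)"
    and c: "continuous_on (I - S) h" unfolding piecewise_continuous_def by blast
  have "jump t g = 0" if t: "t \<in> I" "t \<notin> S" for t
  proof -
    obtain r where r: "r > 0" "cball t r \<subseteq> I" using open_I t open_contains_cball by blast
    \<comment> \<open>Only finitely many exceptional points lie near \<open>t\<close>, so removing
      them leaves an open neighbourhood on which \<open>h\<close> is continuous.\<close>
    define U where "U = ball t r - (cball t r \<inter> S)"
    have U: "open U" "t \<in> U" "U \<subseteq> I - S"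
      unfolding U_def using r t S[OF compact_cball r(2)]
      by (auto intro!: open_Diff finite_imp_closed simp: subset_iff)
    have "(h \<longlongrightarrow> h t) (at t)"
      using U c by (meson continuous_on_eq_continuous_at continuous_on_subset isCont_def)
    then have "slim b h t = h t" for b using ess_le_at tendsto_mono slim_eqI by blast
    then show ?thesis using jump_cong[OF h t(1)] by (simp add: jump_slim)
  qed
  then have "{t \<in> K. jump t g \<noteq> 0} \<subseteq> K \<inter> S" using assms(3) by blast
  then show ?thesis using S[OF assms(2,3)] finite_subset by blast
qed

text \<open>Induction over the span; membership in \<open>GGinf I\<close> is carried along because
  \<open>jump\<close> is additive only for functions with one-sided limits.\<close>

lemma FF_jumps:
  assumes "g \<in> FF I" "compact K" "K \<subseteq> I"
  shows "g \<in> GGinf I \<and> finite {t \<in> K. jump t g \<noteq> 0}"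
  using assms(1) unfolding FF_def
proof (rule module.span_induct_alt[OF module_fun])
  have "jump t (0 :: real \<Rightarrow> complex) = 0" for t
    using slim_const[of _ 0 t] by (simp add: jump_slim zero_fun_def)
  then show "0 \<in> GGinf I \<and> finite {t \<in> K. jump t 0 \<noteq> 0}" using GGinf_const[of 0] by (simp add: zero_fun_def)
next
  fix l x and y :: "real \<Rightarrow> complex"
  assume x: "x \<in> (\<Union>k. FF_k I k)" and y: "y \<in> GGinf I \<and> finite {t \<in> K. jump t y \<noteq> 0}"
  obtain k where k: "x \<in> FF_k I k" using x by blast
  then have xG: "x \<in> GGinf I" by (simp add: FF_k_def)
  have eq: "(\<lambda>t. l * x t) + y = (\<lambda>t. l * x t + y t)" by (simp add: fun_eq_iff)
  have "{t \<in> K. jump t (\<lambda>t. l * x t + y t) \<noteq> 0} \<subseteq> {t \<in> K. jump t x \<noteq> 0} \<union> {t \<in> K. jump t y \<noteq> 0}"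
    using assms(3) by (auto simp: jump_add jump_cmult GG_cmult GGinf_GG xG y subset_iff)
  then have "finite {t \<in> K. jump t (\<lambda>t. l * x t + y t) \<noteq> 0}"
    using y FF_k_jumps[OF k assms(2,3)] finite_subset by blast
  then show "(\<lambda>t. l * x t) + y \<in> GGinf I \<and> finite {t \<in> K. jump t ((\<lambda>t. l * x t) + y) \<noteq> 0}"
    unfolding eq using GGinf_add[OF GGinf_cmult[OF xG]] y by blast
qed

lemma FF_add: assumes "f \<in> FF I" "g \<in> FF I" shows "(\<lambda>t. f t + g t) \<in> FF I"
proof -
  have "f + g \<in> FF I" using assms unfolding FF_def by (rule module.span_add[OF module_fun])
  moreover have "f + g = (\<lambda>t. f t + g t)" by (simp add: fun_eq_iff)
  ultimately show ?thesis by simp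
qed

lemma FF_cmult: "f \<in> FF I \<Longrightarrow> (\<lambda>t. l * f t) \<in> FF I"
  unfolding FF_def by (rule module.span_scale[OF module_fun])

lemma FF_zero: "(\<lambda>_. 0) \<in> FF I"
  using module.span_zero[OF module_fun] unfolding FF_def zero_fun_def .

lemma FF_sum: "(\<And>i. i \<in> A \<Longrightarrow> f i \<in> FF I) \<Longrightarrow> (\<lambda>t. \<Sum>i\<in>A. f i t) \<in> FF I"
  by (induction A rule: infinite_finite_induct) (auto intro: FF_add FF_zero)

lemma FF_base: "f \<in> FF_k I k \<Longrightarrow> f \<in> FF I"
  unfolding FF_def by (rule module.span_base[OF module_fun]) blast

end

section \<open>The truncated primitive and its transpose\<close>

locale truncated = open_interval +
  fixes c :: real assumes c_I: "c \<in> I"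
begin

text \<open>The inner cut confines the integrand to the right of \<open>c\<close>, so that bounds
  involve the length \<open>w - c\<close> alone; the outer cut gives the result compact support,
  with a jump at \<open>c\<close>.\<close>

definition PP :: "(real \<Rightarrow> complex) \<Rightarrow> real \<Rightarrow> complex" where
  "PP \<psi> t = ind c t * prim (\<lambda>x. ind c x * \<psi> x) t"

lemma PP_prim: "PP \<psi> t = ind c t * prim \<psi> t"
proof (cases "c \<le> t")
  case True
  then have "ind t x * (ind c x * \<psi> x) = ind t x * \<psi> x" for x by (auto simp: ind_def)
  then show ?thesis unfolding PP_def prim_def by (simp only:)
qed (simp add: PP_def ind_def)

lemma van_cut:
  assumes "van u v \<psi>" "w \<in> I" "c \<le> w" "v \<le> w" shows "van c w (\<lambda>x. ind c x * \<psi> x)"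
proof -
  have "AE t in lebesgue_on I. t \<notin> {c..w} \<longrightarrow> ind c t * \<psi> t = 0"
    using van_AE[OF assms(1)] by eventually_elim (use assms in \<open>auto simp: ind_def\<close>)
  then show ?thesis using c_I assms by (simp add: van_def)
qed

lemma cut_ex:
  assumes "van u v \<psi>" obtains w where "w \<in> I" "c \<le> w" "v \<le> w" "van c w (\<lambda>x. ind c x * \<psi> x)"
proof -
  have "max c v \<in> I" using assms c_I by (simp add: van_def max_def)
  then show ?thesis using van_cut[OF assms, of "max c v"] that by simp
qed

lemma ggb_PP:
  assumes "ggb k B \<psi>" "van u v \<psi>" "w \<in> I" "c \<le> w" "v \<le> w"
  shows "ggb (Suc k) (max 1 (w - c) * B) (PP \<psi>)"
proof -
  have "PP \<psi> = (\<lambda>t. ind c t * prim (\<lambda>x. ind c x * \<psi> x) t)" by (simp add: fun_eq_iff PP_def)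
  moreover have "ggb (Suc k) (max 1 (w - c) * B) (prim (\<lambda>x. ind c x * \<psi> x))"
    by (intro ggb_prim[OF _ van_cut[OF assms(2-5)]] ggb_cut GG_ind has_uderiv_ind assms) simp
  ultimately show ?thesis by (simp only:) (intro ggb_cut GG_ind has_uderiv_ind norm_ind_le)
qed

lemma van_PP: assumes "van u v \<psi>" "w \<in> I" "c \<le> w" "v \<le> w" shows "van c w (PP \<psi>)"
proof -
  have "PP \<psi> t = 0" if "t \<notin> {c..w}" for t
    using prim_zero[OF van_cut[OF assms], of t] that by (auto simp: PP_def ind_def)
  then show ?thesis using assms c_I by (auto simp: van_def intro: AE_I2)
qed

lemma PP_uderiv:
  assumes "\<psi> \<in> GG I" "van u v \<psi>"
  shows "PP \<psi> \<in> GG I" "has_uderiv I (PP \<psi>) (\<lambda>t. - (ind c t * \<psi> t))"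
proof -
  obtain w where w: "van c w (\<lambda>x. ind c x * \<psi> x)" using cut_ex[OF assms(2)] .
  note p = prim_has_uderiv[OF GG_mult[OF GG_ind assms(1)] w]
  have eq: "PP \<psi> = (\<lambda>t. ind c t * prim (\<lambda>x. ind c x * \<psi> x) t)" by (simp add: fun_eq_iff PP_def)
  show "PP \<psi> \<in> GG I" unfolding eq by (intro GG_mult GG_ind p)
  have "(\<lambda>t. 0 * prim (\<lambda>x. ind c x * \<psi> x) t + ind c t * - (ind c t * \<psi> t)) = (\<lambda>t. - (ind c t * \<psi> t))"
    by (auto simp: fun_eq_iff ind_def)
  then show "has_uderiv I (PP \<psi>) (\<lambda>t. - (ind c t * \<psi> t))"
    using has_uderiv_mult[OF has_uderiv_ind p(2) GG_ind p(1), of c] unfolding eq by simp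
qed

lemma slim_PP:
  assumes "\<psi> \<in> GG I" "van u v \<psi>" "t \<in> I"
  shows "slim b (PP \<psi>) t = slim b (ind c) t * prim \<psi> t"
  unfolding PP_prim using slim_mult[OF GG_ind prim_has_uderiv(1)[OF assms(1,2)] assms(3)]
    slim_continuous[OF prim_continuous[OF assms(1,2)] assms(3)] by simp

lemma RR_PP: assumes "\<psi> \<in> RR I" shows "PP \<psi> \<in> RR I"
proof -
  obtain u v where v: "van u v \<psi>" using RR_van[OF assms] .
  obtain w where w: "w \<in> I" "c \<le> w" "v \<le> w" using cut_ex[OF v] by blast
  have "\<exists>B. ggb k B (PP \<psi>)" for k
    using ggb_PP[OF _ v w] ggb_SucD GGinf_ggb[OF RR_GGinf[OF assms]] by meson
  then have "PP \<psi> \<in> GGinf I" by (simp add: GGinf_iff)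
  then show ?thesis using RR_I van_PP[OF v w] by blast
qed

lemma PP_lin:
  assumes "\<phi> \<in> GG I" "van u v \<phi>" "\<psi> \<in> GG I" "van u' v' \<psi>"
  shows "PP (\<lambda>t. a * \<phi> t + d * \<psi> t) = (\<lambda>t. a * PP \<phi> t + d * PP \<psi> t)"
proof
  fix t show "PP (\<lambda>t. a * \<phi> t + d * \<psi> t) t = a * PP \<phi> t + d * PP \<psi> t"
    unfolding PP_prim
    using prim_add[OF GG_cmult[OF assms(1)] van_mult[OF assms(2)] GG_cmult[OF assms(3)] van_mult[OF assms(4)], of a d t]
    by (simp add: prim_cmult algebra_simps)
qed

lemma PP_cong: assumes "\<phi> \<in> GG I" "ae_eq I \<phi> \<psi>" shows "PP \<phi> = PP \<psi>"
  using prim_cong[OF assms(2,1)] by (simp add: fun_eq_iff PP_prim)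

lemma RR_op_PP: "RR_op PP"
  unfolding RR_op_def
proof (intro conjI ballI allI impI)
  fix \<phi> \<psi> a d assume *: "\<phi> \<in> RR I" "\<psi> \<in> RR I"
  obtain u v where v: "van u v \<phi>" using RR_van[OF *(1)] .
  obtain u' v' where v': "van u' v' \<psi>" using RR_van[OF *(2)] .
  show "ae_eq I (PP (\<lambda>t. a * \<phi> t + d * \<psi> t)) (\<lambda>t. a * PP \<phi> t + d * PP \<psi> t)"
    using PP_lin[OF RR_GG[OF *(1)] v RR_GG[OF *(2)] v'] by simp
next
  fix u v assume uv: "u \<in> I" "v \<in> I" "u \<le> v"
  define w where "w = max c v"
  have w: "w \<in> I" "c \<le> w" "v \<le> w" using uv c_I by (auto simp: w_def max_def)
  have "van c w (PP \<phi>) \<and> ggb k (max 1 (w - c) * B) (PP \<phi>)" if "van u v \<phi>" "ggb k B \<phi>" for \<phi> B k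
    using ggb_SucD[OF ggb_PP[OF that(2,1) w]] van_PP[OF that(1) w] by blast
  moreover have "0 \<le> max 1 (w - c)" by simp
  ultimately have "op_bd PP u v c w" unfolding op_bd_def by blast
  then show "\<exists>u'\<in>I. \<exists>v'\<in>I. u' \<le> v' \<and> op_bd PP u v u' v'" using w c_I by blast
qed (rule RR_PP)

definition zb :: "real \<Rightarrow> ((real \<Rightarrow> complex) \<Rightarrow> complex) \<Rightarrow> bool" where
  "zb t0 f \<longleftrightarrow> (\<forall>\<phi>\<in>RR I. gsupp I \<phi> \<subseteq> I \<inter> {..<t0} \<longrightarrow> f \<phi> = 0)"

lemma zb_van: assumes "zb t0 f" "\<phi> \<in> RR I" "van u v \<phi>" "v < t0" shows "f \<phi> = 0"
proof -
  have "gsupp I \<phi> \<subseteq> I \<inter> {..<t0}" using van_gsupp(1)[OF assms(3)] assms(4) by (auto simp: gsupp_def)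
  then show ?thesis using assms unfolding zb_def by blast
qed

lemma cutl_RR: assumes "\<phi> \<in> RR I"
  obtains u where "van u c (\<lambda>t. (1 - ind c t) * \<phi> t)" "(\<lambda>t. (1 - ind c t) * \<phi> t) \<in> RR I"
proof -
  obtain u v where v: "u \<in> I" "van u v \<phi>" using RR_van[OF assms] .
  have "AE t in lebesgue_on I. t \<notin> {u..c} \<longrightarrow> (1 - ind c t) * \<phi> t = 0"
    using van_AE[OF v(2)] by eventually_elim (auto simp: ind_def)
  then have "van u c (\<lambda>t. (1 - ind c t) * \<phi> t)" using v c_I by (simp add: van_def)
  moreover have "(\<lambda>t. (1 - ind c t) * \<phi> t) \<in> RR I"
    using GGinf_add[OF GGinf_const GGinf_cmult[OF GGinf_ind], of 1 "-1" c] by (intro RR_mult assms) simp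
  ultimately show ?thesis using that by blast
qed

text \<open>The part of the test function that is cut away is supported to the left of
  \<open>c\<close>, hence before \<open>t0\<close>.\<close>

lemma zb_cut: assumes "zb t0 f" "f \<in> RR_dual I" "c < t0" "\<phi> \<in> RR I"
  shows "f (\<lambda>t. ind c t * \<phi> t) = f \<phi>"
proof -
  obtain u where u: "van u c (\<lambda>t. (1 - ind c t) * \<phi> t)" "(\<lambda>t. (1 - ind c t) * \<phi> t) \<in> RR I"
    using cutl_RR[OF assms(4)] .
  have "f (\<lambda>t. ind c t * \<phi> t + (1 - ind c t) * \<phi> t) = f (\<lambda>t. ind c t * \<phi> t) + 0"
    using RR_dual_add[OF assms(2) RR_mult[OF GGinf_ind assms(4)] u(2)] zb_van[OF assms(1) u(2,1) assms(3)] by simp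
  moreover have "(\<lambda>t. ind c t * \<phi> t + (1 - ind c t) * \<phi> t) = \<phi>" by (simp add: fun_eq_iff algebra_simps)
  ultimately show ?thesis by simp
qed

lemma ddt_pull: "ddt I f = (\<lambda>\<phi>. - pull (uderiv I) f \<phi>)"
  by (simp add: fun_eq_iff ddt_def pull_def)

lemma derivs_pull_PP:
  assumes G: "G \<in> RR_dual I" "zb t0 G" "c < t0"
  shows "G \<in> derivs I (pull PP G)"
proof -
  define g where "g = (\<lambda>\<phi>. G \<phi> + pull (uderiv I) (pull PP G) \<phi>)"
  \<comment> \<open>\<open>e s\<close> is the indicator function of \<open>[c, s)\<close>: what a
    jump at \<open>s\<close> leaves behind after integration from the right and truncation at
    \<open>c\<close>. Its values under \<open>G\<close> supply the coefficients required by
    \<open>Delta\<close>.\<close>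
  define e where "e = (\<lambda>s t. ind c t * (1 - ind s t))"
  have cutG: "(\<lambda>t. 1 - ind s t) \<in> GGinf I" for s
    using GGinf_add[OF GGinf_const GGinf_cmult[OF GGinf_ind], of 1 "-1" s] by simp
  have eRR: "e s \<in> RR I" if "s \<in> I" for s
  proof (rule RR_I)
    show "e s \<in> GGinf I" unfolding e_def by (intro GGinf_mult GGinf_ind cutG)
    have "max c s \<in> I" using that c_I by (simp add: max_def)
    then show "van c (max c s) (e s)" using c_I by (auto simp: van_def e_def ind_def intro!: AE_I2)
  qed
  have "g \<in> RR_dual I"
    unfolding g_def by (intro RR_dual_fun_add G pull_RR_dual RR_op_uderiv RR_op_PP)
  moreover have "g \<phi> = (\<Sum>t\<in>{t \<in> I. jump t \<phi> \<noteq> 0}. - G (e t) * jump t \<phi>)" if "\<phi> \<in> RR_F I" for \<phi>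
  proof -
    have \<phi>: "\<phi> \<in> RR I" "\<phi> \<in> FF I" using that by (auto simp: RR_F_def)
    obtain u v where v: "u \<in> I" "v \<in> I" "van u v \<phi>" using RR_van[OF \<phi>(1)] .
    have uvI: "{u..v} \<subseteq> I" using v atLeastAtMost_subset_I by blast
    define J where "J = {t \<in> I. jump t \<phi> \<noteq> 0}"
    have "J = {t \<in> {u..v}. jump t \<phi> \<noteq> 0}"
    proof -
      have "jump t \<phi> = 0" if "t \<in> I" "t \<notin> {u..v}" for t
        using van_slim[OF v(3) that] by (simp add: jump_slim)
      then show ?thesis using uvI unfolding J_def by blast
    qed
    then have J: "finite J" "J \<subseteq> I" using FF_jumps[OF \<phi>(2) compact_Icc uvI] by (auto simp: J_def)
    define h where "h = uderiv I \<phi>"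
    have h: "has_uderiv I \<phi> h" "h \<in> RR I" using uderiv_has RR_GGinf RR_uderiv \<phi> by (auto simp: h_def)
    have ae: "ae_eq I \<phi> (\<lambda>t. - prim h t - (\<Sum>s\<in>J. jump s \<phi> * (1 - ind s t)))"
      by (rule ftc_jumps[OF RR_GG[OF \<phi>(1)] v(3) h(1) J]) (auto simp: J_def)
    obtain x where x: "van x c (\<lambda>t. (1 - ind c t) * \<phi> t)" "(\<lambda>t. (1 - ind c t) * \<phi> t) \<in> RR I"
      using cutl_RR[OF \<phi>(1)] .
    have sR: "(\<lambda>t. \<Sum>s\<in>J. - jump s \<phi> * e s t) \<in> RR I"
      using J(2) by (intro RR_sum RR_cmult eRR) auto
    have ae2: "ae_eq I (\<lambda>t. \<phi> t + PP h t) (\<lambda>t. (1 - ind c t) * \<phi> t + (\<Sum>s\<in>J. - jump s \<phi> * e s t))"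
      using ae unfolding ae_eq_def
    proof eventually_elim
      case (elim t)
      have "(\<Sum>s\<in>J. - jump s \<phi> * e s t) = - (ind c t * (\<Sum>s\<in>J. jump s \<phi> * (1 - ind s t)))"
        by (simp add: e_def sum_distrib_left sum_negf mult.left_commute)
      also have "\<dots> = ind c t * (\<phi> t + prim h t)" using elim by simp
      finally show ?case by (simp add: PP_prim algebra_simps)
    qed
    have "g \<phi> = G \<phi> + G (PP h)" using \<phi> h by (simp add: g_def pull_def h_def)
    also have "\<dots> = G (\<lambda>t. \<phi> t + PP h t)" using RR_dual_add[OF G(1) \<phi>(1) RR_PP[OF h(2)]] by simp
    also have "\<dots> = G (\<lambda>t. (1 - ind c t) * \<phi> t + (\<Sum>s\<in>J. - jump s \<phi> * e s t))"
      by (rule RR_dual_cong[OF G(1) RR_add[OF \<phi>(1) RR_PP[OF h(2)]] ae2])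
    also have "\<dots> = 0 + G (\<lambda>t. \<Sum>s\<in>J. - jump s \<phi> * e s t)"
      using RR_dual_add[OF G(1) x(2) sR] zb_van[OF G(2) x(2,1) G(3)] by simp
    also have "\<dots> = (\<Sum>s\<in>J. G (\<lambda>t. - jump s \<phi> * e s t))"
      unfolding add_0 by (rule RR_dual_sum[OF G(1)], rule RR_cmult, rule eRR) (use J(2) in blast)
    also have "\<dots> = (\<Sum>s\<in>J. - G (e s) * jump s \<phi>)"
    proof (rule sum.cong[OF refl])
      fix s assume "s \<in> J"
      then have "e s \<in> RR I" using J(2) eRR by blast
      from RR_dual_cmult[OF G(1) this, of "- jump s \<phi>"]
      show "G (\<lambda>t. - jump s \<phi> * e s t) = - G (e s) * jump s \<phi>" by simp
    qed
    finally show ?thesis by (simp add: J_def)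
  qed
  ultimately have "g \<in> Delta I"
    unfolding Delta_def by (intro CollectI conjI exI[of _ "\<lambda>t. - G (e t)"] ballI)
  moreover have "G = ddt I (pull PP G) + g" by (simp add: fun_eq_iff ddt_pull g_def)
  ultimately show ?thesis unfolding derivs_def by (intro CollectI exI[of _ g] conjI)
qed

end

section \<open>Piecewise polynomials\<close>

text \<open>Classical differentiability in the same difference-quotient form as
  \<open>has_uderiv\<close>, so that it transfers to the essential limits directly.\<close>

definition cderiv :: "(real \<Rightarrow> complex) \<Rightarrow> complex \<Rightarrow> real \<Rightarrow> bool" where
  "cderiv f D t \<longleftrightarrow> ((\<lambda>s. (f s - f t) / of_real (s - t)) \<longlongrightarrow> D) (at t)"

lemma cderiv_const [simp]: "cderiv (\<lambda>_. l) 0 t"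
  by (simp add: cderiv_def)

lemma cderiv_of_real: assumes "(g has_real_derivative D) (at t)"
  shows "cderiv (\<lambda>s. of_real (g s)) (of_real D) t"
  using tendsto_of_real[OF assms[unfolded has_field_derivative_iff], where 'a = complex]
  unfolding cderiv_def by simp

lemma cderiv_id: "cderiv of_real 1 t"
  using cderiv_of_real[OF DERIV_ident, of t] by simp

lemma cderiv_add: "cderiv f D t \<Longrightarrow> cderiv g E t \<Longrightarrow> cderiv (\<lambda>s. f s + g s) (D + E) t"
proof -
  assume *: "cderiv f D t" "cderiv g E t"
  have "(f s + g s - (f t + g t)) / d = (f s - f t) / d + (g s - g t) / d" for s d
    by (simp add: add_divide_distrib[symmetric])
  then show ?thesis using * unfolding cderiv_def by (simp only:) (rule tendsto_add)
qed

lemma cderiv_mult: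
  assumes "cderiv f D t" "cderiv g E t" "isCont g t"
  shows "cderiv (\<lambda>s. f s * g s) (D * g t + f t * E) t"
proof -
  have *: "(f s * g s - f t * g t) / d = (f s - f t) / d * g s + f t * ((g s - g t) / d)" for s d
    by (simp add: add_divide_distrib[symmetric] left_diff_distrib right_diff_distrib)
  have "((\<lambda>s. (f s - f t) / of_real (s - t) * g s + f t * ((g s - g t) / of_real (s - t))) \<longlongrightarrow> D * g t + f t * E) (at t)"
    using assms unfolding cderiv_def isCont_def by (intro tendsto_add tendsto_mult tendsto_const)
  then show ?thesis unfolding cderiv_def * .
qed

lemma cderiv_cmult: "cderiv f D t \<Longrightarrow> cderiv (\<lambda>s. l * f s) (l * D) t"
  unfolding cderiv_def using tendsto_mult[OF tendsto_const, of "\<lambda>s. (f s - f t) / of_real (s - t)" D "at t" l]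
  by (simp add: right_diff_distrib)

lemma cderiv_minus: "cderiv f D t \<Longrightarrow> cderiv (\<lambda>s. - f s) (- D) t"
  using cderiv_cmult[of f D t "-1"] by simp

lemma continuous_poly [continuous_intros]: "continuous_on A (\<lambda>t. poly p (complex_of_real t))"
  by (induction p) (auto intro!: continuous_intros)

lemma cderiv_poly: "cderiv (\<lambda>t. poly p (of_real t)) (poly (pderiv p) (of_real t)) t"
proof (induction p)
  case (pCons a p)
  have c: "isCont (\<lambda>t. poly p (complex_of_real t)) t"
    using continuous_poly[of UNIV p] by (simp add: continuous_on_eq_continuous_at)
  have "cderiv (\<lambda>s. a + of_real s * poly p (of_real s)) (0 + (1 * poly p (of_real t) + of_real t * poly (pderiv p) (of_real t))) t"
    by (intro cderiv_add cderiv_const cderiv_mult cderiv_id pCons c)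
  then show ?case by (simp add: pderiv_pCons)
qed simp

text \<open>Multiplying by the logistic function \<open>\<sigma>\<close> or by \<open>1 - \<sigma>\<close> makes a polynomial bounded on one half-line without
  changing its jump: \<open>(ind x - \<sigma>) p\<close> is bounded with all its derivatives.\<close>

definition lgs :: "real \<Rightarrow> complex" where
  "lgs t = of_real (1 / (1 + exp (- t)))"

lemma cderiv_lgs: "cderiv lgs (lgs t * (1 - lgs t)) t"
proof -
  have pos: "1 + exp (- t) > 0" by (simp add: add_pos_pos)
  have "((\<lambda>t. 1 / (1 + exp (- t))) has_real_derivative (1 / (1 + exp (- t)) * (1 - 1 / (1 + exp (- t))))) (at t)"
    using pos by (auto intro!: derivative_eq_intros simp: field_simps power2_eq_square)
  from cderiv_of_real[OF this] show ?thesis unfolding lgs_def by simp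
qed

lemma continuous_lgs [continuous_intros]: "continuous_on A lgs"
proof -
  have "1 + exp (- t) \<noteq> (0 :: real)" for t :: real using exp_gt_zero[of "-t"] by linarith
  then show ?thesis unfolding lgs_def by (intro continuous_on_of_real continuous_intros) auto
qed

lemma norm_lgs: "norm (lgs t) = 1 / (1 + exp (- t))" "norm (1 - lgs t) = 1 / (1 + exp t)"
proof -
  have p: "1 + exp (- t) > 0" "1 + exp t > 0" by (simp_all add: add_pos_pos)
  show "norm (lgs t) = 1 / (1 + exp (- t))" using p unfolding lgs_def norm_of_real by simp
  have "1 - lgs t = of_real (1 - 1 / (1 + exp (- t)))" by (simp add: lgs_def)
  also have "1 - 1 / (1 + exp (- t)) = 1 / (1 + exp t)"
    using p by (simp add: field_simps exp_minus)
  finally have eq: "1 - lgs t = of_real (1 / (1 + exp t))" .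
  show "norm (1 - lgs t) = 1 / (1 + exp t)" using p unfolding eq norm_of_real by simp
qed

lemma norm_lgs_le: "norm (lgs t) \<le> 1" "norm (lgs t) \<le> exp t" "norm (1 - lgs t) \<le> 1" "norm (1 - lgs t) \<le> exp (- t)"
proof -
  have p: "exp (- t) > 0" "exp t > 0" by simp_all
  have q: "1 + exp (- t) > 0" "1 + exp t > 0" by (simp_all add: add_pos_pos)
  show "norm (lgs t) \<le> 1" "norm (1 - lgs t) \<le> 1"
    unfolding norm_lgs using p by (simp_all add: divide_le_eq_1_pos add_pos_pos)
  have "1 \<le> exp t * (1 + exp (- t))" "1 \<le> exp (- t) * (1 + exp t)"
    by (simp_all add: distrib_left exp_add[symmetric])
  then show "norm (lgs t) \<le> exp t" "norm (1 - lgs t) \<le> exp (- t)"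
    unfolding norm_lgs using q by (simp_all add: pos_divide_le_eq)
qed

lemma norm_lgs_prod_le: "norm (lgs t * (1 - lgs t)) \<le> exp (- \<bar>t\<bar>)"
proof (cases "0 \<le> t")
  case True
  have "norm (lgs t) * norm (1 - lgs t) \<le> 1 * exp (- t)"
    using norm_lgs_le[of t] by (intro mult_mono) auto
  then show ?thesis using True by (simp add: norm_mult)
next
  case False
  have "norm (lgs t) * norm (1 - lgs t) \<le> exp t * 1"
    using norm_lgs_le[of t] by (intro mult_mono) auto
  then show ?thesis using False by (simp add: norm_mult)
qed

text \<open>The step function and the logistic function approach each other exponentially at both
  ends; the factor \<open>exp \<bar>x\<bar>\<close> pays for the stretch between 0 and
  \<open>x\<close>, where they are far apart.\<close>

lemma norm_ind_lgs_le: "norm (ind x t - lgs t) \<le> exp \<bar>x\<bar> * exp (- \<bar>t\<bar>)"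
proof -
  have e: "exp \<bar>x\<bar> * exp (- \<bar>t\<bar>) = exp (\<bar>x\<bar> - \<bar>t\<bar>)" by (simp add: exp_add[symmetric])
  show ?thesis
  proof (cases "x \<le> t")
    case True
    have "norm (1 - lgs t) \<le> exp (\<bar>x\<bar> - \<bar>t\<bar>)"
    proof (cases "0 \<le> t")
      case True
      have "norm (1 - lgs t) \<le> exp (- t)" by (rule norm_lgs_le)
      also have "\<dots> \<le> exp (\<bar>x\<bar> - \<bar>t\<bar>)" using True by simp
      finally show ?thesis .
    next
      case False
      have "norm (1 - lgs t) \<le> exp 0" using norm_lgs_le by simp
      also have "\<dots> \<le> exp (\<bar>x\<bar> - \<bar>t\<bar>)" using False \<open>x \<le> t\<close> by (intro exp_le_cancel_iff[THEN iffD2]) auto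
      finally show ?thesis .
    qed
    then show ?thesis using True by (simp add: ind_def e)
  next
    case False
    have "norm (lgs t) \<le> exp (\<bar>x\<bar> - \<bar>t\<bar>)"
    proof (cases "0 \<le> t")
      case True
      have "norm (lgs t) \<le> exp 0" using norm_lgs_le by simp
      also have "\<dots> \<le> exp (\<bar>x\<bar> - \<bar>t\<bar>)" using True \<open>\<not> x \<le> t\<close> by (intro exp_le_cancel_iff[THEN iffD2]) auto
      finally show ?thesis .
    next
      case False
      have "norm (lgs t) \<le> exp t" by (rule norm_lgs_le)
      also have "\<dots> \<le> exp (\<bar>x\<bar> - \<bar>t\<bar>)" using False by simp
      finally show ?thesis .
    qed
    then show ?thesis using False by (simp add: ind_def e)
  qed
qed

text \<open>Raise \<open>1 + \<bar>t\<bar> \<le> N * (1 + \<bar>t\<bar> / N) \<le> N * exp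
  (\<bar>t\<bar> / N)\<close> to the power \<open>N\<close>. For \<open>N = 0\<close> the right-hand
  side is \<open>0 ^ 0 = 1\<close>.\<close>

lemma exp_power_bound: "exp (- \<bar>t\<bar>) * (1 + \<bar>t\<bar>) ^ N \<le> real N ^ N"
proof (cases "N = 0")
  case False
  then have N: "real N > 0" "1 \<le> real N" by auto
  have "1 + \<bar>t\<bar> \<le> real N * (1 + \<bar>t\<bar> / real N)" using N by (simp add: distrib_left)
  also have "\<dots> \<le> real N * exp (\<bar>t\<bar> / real N)" using N by (intro mult_left_mono exp_ge_add_one_self) auto
  finally have "(1 + \<bar>t\<bar>) ^ N \<le> (real N * exp (\<bar>t\<bar> / real N)) ^ N" by (intro power_mono) auto
  also have "\<dots> = real N ^ N * exp \<bar>t\<bar>" using N by (simp add: power_mult_distrib exp_of_nat_mult[symmetric])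
  finally have "exp (- \<bar>t\<bar>) * (1 + \<bar>t\<bar>) ^ N \<le> exp (- \<bar>t\<bar>) * (real N ^ N * exp \<bar>t\<bar>)"
    by (intro mult_left_mono) auto
  also have "\<dots> = real N ^ N * (exp (- \<bar>t\<bar>) * exp \<bar>t\<bar>)" by (simp only: mult_ac)
  also have "exp (- \<bar>t\<bar>) * exp \<bar>t\<bar> = 1" by (simp add: exp_add[symmetric])
  finally show ?thesis by simp
qed simp

text \<open>An algebra of functions of polynomial growth that is closed under differentiation,
  because the logistic function satisfies \<open>lgs' = lgs * (1 - lgs)\<close>. The exponentially
  small factor \<open>lgs * (1 - lgs)\<close> therefore tames all derivatives at once.\<close>

inductive_set slow :: "(real \<Rightarrow> complex) set" where
  const: "(\<lambda>_. l) \<in> slow"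
| id: "of_real \<in> slow"
| lgs: "lgs \<in> slow"
| add: "f \<in> slow \<Longrightarrow> g \<in> slow \<Longrightarrow> (\<lambda>t. f t + g t) \<in> slow"
| mult: "f \<in> slow \<Longrightarrow> g \<in> slow \<Longrightarrow> (\<lambda>t. f t * g t) \<in> slow"

lemma slow_power: "f \<in> slow \<Longrightarrow> (\<lambda>t. f t ^ n) \<in> slow"
  by (induction n) (auto intro: slow.intros)

lemma slow_growth: "f \<in> slow \<Longrightarrow> \<exists>C\<ge>0. \<exists>N. \<forall>t. norm (f t) \<le> C * (1 + \<bar>t\<bar>) ^ N"
proof (induction rule: slow.induct)
  case (const l) then show ?case by (intro exI[of _ "norm l"] conjI exI[of _ 0]) auto
next
  case id then show ?case by (intro exI[of _ 1] conjI exI[of _ "1::nat"]) auto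
next
  case lgs then show ?case using norm_lgs_le by (intro exI[of _ 1] conjI exI[of _ "0::nat"]) auto
next
  case (add f g)
  then obtain C N D M where *: "0 \<le> C" "0 \<le> D" "\<And>t. norm (f t) \<le> C * (1 + \<bar>t\<bar>) ^ N" "\<And>t. norm (g t) \<le> D * (1 + \<bar>t\<bar>) ^ M"
    by blast
  have "norm (f t + g t) \<le> (C + D) * (1 + \<bar>t\<bar>) ^ max N M" for t
  proof -
    have "norm (f t) \<le> C * (1 + \<bar>t\<bar>) ^ max N M" "norm (g t) \<le> D * (1 + \<bar>t\<bar>) ^ max N M"
      using *(3)[of t] *(4)[of t] mult_left_mono[OF power_increasing[of N "max N M" "1 + \<bar>t\<bar>"] *(1)]
        mult_left_mono[OF power_increasing[of M "max N M" "1 + \<bar>t\<bar>"] *(2)] by (auto intro: order_trans)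
    then show ?thesis using norm_triangle_ineq[of "f t" "g t"] by (simp add: distrib_right)
  qed
  then show ?case using *(1,2) by (intro exI[of _ "C + D"]) auto
next
  case (mult f g)
  then obtain C N D M where *: "0 \<le> C" "0 \<le> D" "\<And>t. norm (f t) \<le> C * (1 + \<bar>t\<bar>) ^ N" "\<And>t. norm (g t) \<le> D * (1 + \<bar>t\<bar>) ^ M"
    by blast
  have "norm (f t * g t) \<le> (C * D) * (1 + \<bar>t\<bar>) ^ (N + M)" for t
  proof -
    have "norm (f t) * norm (g t) \<le> (C * (1 + \<bar>t\<bar>) ^ N) * (D * (1 + \<bar>t\<bar>) ^ M)"
      using * by (intro mult_mono) auto
    then show ?thesis by (simp add: norm_mult power_add mult_ac)
  qed
  then show ?case using *(1,2) by (intro exI[of _ "C * D"]) auto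
qed

lemma slow_deriv: "f \<in> slow \<Longrightarrow> continuous_on UNIV f \<and> (\<exists>f'\<in>slow. \<forall>t. cderiv f (f' t) t)"
proof (induction rule: slow.induct)
  case (const l) then show ?case by (auto intro!: bexI[of _ "\<lambda>_. 0"] slow.const)
next
  case id then show ?case by (auto intro!: bexI[of _ "\<lambda>_. 1"] slow.const cderiv_id continuous_intros)
next
  case lgs
  have "(\<lambda>t. lgs t * (1 + (-1) * lgs t)) \<in> slow" by (intro slow.intros)
  then show ?case using cderiv_lgs by (intro conjI continuous_lgs bexI[of _ "\<lambda>t. lgs t * (1 + (-1) * lgs t)"]) auto
next
  case (add f g)
  then obtain f' g' where "f' \<in> slow" "g' \<in> slow" "\<And>t. cderiv f (f' t) t" "\<And>t. cderiv g (g' t) t" by blast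
  then show ?case using add
    by (auto intro!: continuous_intros bexI[of _ "\<lambda>t. f' t + g' t"] slow.add cderiv_add)
next
  case (mult f g)
  then obtain f' g' where "f' \<in> slow" "g' \<in> slow" "\<And>t. cderiv f (f' t) t" "\<And>t. cderiv g (g' t) t" by blast
  moreover have "isCont g t" for t using mult by (simp add: continuous_on_eq_continuous_at)
  ultimately show ?case using mult
    by (auto intro!: continuous_intros bexI[of _ "\<lambda>t. f' t * g t + f t * g' t"] slow.add slow.mult cderiv_mult)
qed

section \<open>Bounded smooth functions, and functions with one discontinuous derivative\<close>

context open_interval
begin

definition bsmooth :: "(real \<Rightarrow> complex) set" where
  "bsmooth = {f \<in> GGinf I. \<forall>i. uderivs I i f \<in> bdd_continuous I}"

lemma bdd_continuous_cong: "f \<in> bdd_continuous I \<Longrightarrow> ae_eq I f g \<Longrightarrow> g \<in> bdd_continuous I"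
  unfolding bdd_continuous_def using ae_eq_trans[OF ae_eq_sym, of f g] by blast

lemma bdd_continuousI: "continuous_on I f \<Longrightarrow> (\<And>t. t \<in> I \<Longrightarrow> norm (f t) \<le> B) \<Longrightarrow> f \<in> bdd_continuous I"
  unfolding bdd_continuous_def bounded_iff by (auto intro!: exI[of _ f])

lemma piecewise_continuous_cong:
  assumes "f \<in> piecewise_continuous I" "ae_eq I f g" shows "g \<in> piecewise_continuous I"
proof -
  obtain h S where h: "ae_eq I f h" "S \<subseteq> I" "\<forall>K. compact K \<and> K \<subseteq> I \<longrightarrow> finite (K \<inter> S)" "continuous_on (I - S) h"
    and f: "f \<in> GG I" using assms(1) unfolding piecewise_continuous_def by blast
  have "ae_eq I g h" using ae_eq_trans[OF ae_eq_sym[OF assms(2)] h(1)] .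
  moreover have "g \<in> GG I" using GG_ae_cong[OF f assms(2)] .
  ultimately show ?thesis using h unfolding piecewise_continuous_def by blast
qed

lemma bsmooth_GGinf: "f \<in> bsmooth \<Longrightarrow> f \<in> GGinf I"
  by (simp add: bsmooth_def)

lemma bsmooth_bdd: assumes "f \<in> bsmooth" shows "f \<in> bdd_continuous I"
proof -
  have "uderivs I 0 f \<in> bdd_continuous I" using assms unfolding bsmooth_def by blast
  then show ?thesis by simp
qed

lemma bdd_continuous_lin:
  assumes "f \<in> bdd_continuous I" "g \<in> bdd_continuous I" shows "(\<lambda>t. l * f t + g t) \<in> bdd_continuous I"
proof -
  obtain f1 g1 where *: "ae_eq I f f1" "ae_eq I g g1" "continuous_on I f1" "continuous_on I g1"
    "bounded (f1 ` I)" "bounded (g1 ` I)" using assms unfolding bdd_continuous_def by blast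
  obtain B where B: "\<And>t. t \<in> I \<Longrightarrow> norm (f1 t) \<le> B" using *(5) unfolding bounded_iff by blast
  obtain D where D: "\<And>t. t \<in> I \<Longrightarrow> norm (g1 t) \<le> D" using *(6) unfolding bounded_iff by blast
  have "norm (l * f1 t + g1 t) \<le> norm l * B + D" if "t \<in> I" for t
    using norm_triangle_ineq[of "l * f1 t" "g1 t"] mult_left_mono[OF B[OF that] norm_ge_zero[of l]] D[OF that]
    by (simp add: norm_mult)
  then have "(\<lambda>t. l * f1 t + g1 t) \<in> bdd_continuous I"
    using * by (intro bdd_continuousI continuous_intros) auto
  moreover have "ae_eq I (\<lambda>t. l * f1 t + g1 t) (\<lambda>t. l * f t + g t)"
    using *(1,2) unfolding ae_eq_def by eventually_elim simp
  ultimately show ?thesis using bdd_continuous_cong by blast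
qed

lemma bsmooth_lin: assumes "f \<in> bsmooth" "g \<in> bsmooth" shows "(\<lambda>t. l * f t + g t) \<in> bsmooth"
proof -
  have G: "f \<in> GGinf I" "g \<in> GGinf I" using assms by (auto simp: bsmooth_def)
  have "uderivs I i (\<lambda>t. l * f t + g t) \<in> bdd_continuous I" for i
  proof -
    have "ae_eq I (\<lambda>t. l * uderivs I i f t + uderivs I i g t) (uderivs I i (\<lambda>t. l * f t + g t))"
      using uderivs_cmult[OF G(1), of i l] uderivs_add[OF GGinf_cmult[OF G(1), of l] G(2), of i]
      unfolding ae_eq_def by eventually_elim simp
    then show ?thesis
      using bdd_continuous_lin[of "uderivs I i f" "uderivs I i g" l] assms bdd_continuous_cong
      unfolding bsmooth_def by blast
  qed
  then show ?thesis using G by (simp add: bsmooth_def GGinf_add GGinf_cmult)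
qed

lemma bsmooth_zero: "(\<lambda>_. 0) \<in> bsmooth"
proof -
  have "ae_eq I (\<lambda>_. 0) (uderivs I i (\<lambda>_. 0))" for i
    using uderivs_cmult[OF GGinf_const, of i 0 0] ae_eq_sym by simp
  moreover have "(\<lambda>_. 0) \<in> bdd_continuous I" by (rule bdd_continuousI[of _ 0]) auto
  ultimately show ?thesis using bdd_continuous_cong unfolding bsmooth_def by auto
qed

lemma bsmooth_uderiv: assumes "f \<in> bsmooth" "has_uderiv I f h" shows "h \<in> bsmooth"
proof -
  have G: "f \<in> GGinf I" using assms by (simp add: bsmooth_def)
  have "uderivs I i h \<in> bdd_continuous I" for i
    using bdd_continuous_cong[OF _ uderivs_step[OF G assms(2), of i]] assms(1) unfolding bsmooth_def by blast
  then show ?thesis using has_uderiv_GGinf[OF G assms(2)] by (simp add: bsmooth_def)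
qed

text \<open>A coinduction principle: if a class of bounded continuous functions contains a
  derivative of each of its members, iterating that choice yields a full chain, which agrees with
  \<open>uderivs\<close> modulo null sets.\<close>

lemma bsmooth_coinduct:
  assumes X: "\<And>f. f \<in> X \<Longrightarrow> continuous_on I f \<and> (\<exists>B. \<forall>t\<in>I. norm (f t) \<le> B) \<and> (\<exists>g\<in>X. has_uderiv I f g)"
    and f: "f \<in> X"
  shows "f \<in> bsmooth"
proof -
  obtain d where d: "\<And>f. f \<in> X \<Longrightarrow> d f \<in> X \<and> has_uderiv I f (d f)" using X by metis
  have dX: "(d ^^ k) f \<in> X" for k using f d by (induction k) auto
  have b: "g \<in> bdd_continuous I" if "g \<in> X" for g using X[OF that] bdd_continuousI by blast
  have "f \<in> GG I" using X[OF f] GG_continuous by blast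
  moreover have "has_uderiv I ((d ^^ k) f) ((d ^^ Suc k) f)" for k using d[OF dX[of k]] by simp
  ultimately have G: "f \<in> GGinf I" unfolding GGinf_def by (auto intro!: exI[of _ "\<lambda>k. (d ^^ k) f"])
  have "ae_eq I ((d ^^ k) f) (uderivs I k f)" for k
  proof (induction k)
    case (Suc k)
    show ?case
      using has_uderiv_unique[OF has_uderiv_cong[OF d[THEN conjunct2, OF dX] Suc ae_eq_refl] uderivs_has[OF G]] by simp
  qed simp
  then show ?thesis using G b[OF dX] bdd_continuous_cong unfolding bsmooth_def by blast
qed

lemma bsmooth_slow: assumes "w \<in> slow" shows "(\<lambda>t. lgs t * (1 - lgs t) * w t) \<in> bsmooth"
proof (rule bsmooth_coinduct)
  let ?X = "(\<lambda>w t. lgs t * (1 - lgs t) * w t) ` slow"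
  show "(\<lambda>t. lgs t * (1 - lgs t) * w t) \<in> ?X" using assms by blast
  have bd: "\<exists>B. \<forall>t. norm (lgs t * (1 - lgs t) * w t) \<le> B" if w: "w \<in> slow" for w
  proof -
    obtain C N where C: "0 \<le> C" "\<And>t. norm (w t) \<le> C * (1 + \<bar>t\<bar>) ^ N" using slow_growth[OF w] by blast
    have "norm (lgs t * (1 - lgs t) * w t) \<le> C * real N ^ N" for t
    proof -
      have "norm (lgs t * (1 - lgs t)) * norm (w t) \<le> exp (- \<bar>t\<bar>) * (C * (1 + \<bar>t\<bar>) ^ N)"
        using C norm_lgs_prod_le by (intro mult_mono) auto
      also have "\<dots> = C * (exp (- \<bar>t\<bar>) * (1 + \<bar>t\<bar>) ^ N)" by simp
      also have "\<dots> \<le> C * real N ^ N" by (intro mult_left_mono exp_power_bound C)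
      finally show ?thesis by (simp add: norm_mult)
    qed
    then show ?thesis by blast
  qed
  fix f assume "f \<in> ?X"
  then obtain w where w: "w \<in> slow" "f = (\<lambda>t. lgs t * (1 - lgs t) * w t)" by blast
  obtain w' where w': "w' \<in> slow" "\<And>t. cderiv w (w' t) t" and wc: "continuous_on UNIV w" using slow_deriv[OF w(1)] by blast
  \<comment> \<open>The cofactor after differentiation: the logarithmic derivative of
    \<open>lgs * (1 - lgs)\<close> is \<open>1 - 2 * lgs\<close>, so the class of products with
    \<open>slow\<close> functions reproduces itself.\<close>
  define z where "z = (\<lambda>t. (1 + (-2) * lgs t) * w t + w' t)"
  have z: "z \<in> slow" unfolding z_def by (intro slow.intros w w')
  have fc: "continuous_on A f" for A unfolding w(2) using continuous_on_subset[OF wc]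
    by (intro continuous_intros) auto
  have zc: "continuous_on A (\<lambda>t. lgs t * (1 - lgs t) * z t)" for A
    using slow_deriv[OF z] continuous_on_subset by (intro continuous_intros) blast
  have der: "cderiv f (lgs t * (1 - lgs t) * z t) t" for t
  proof -
    have "continuous_on UNIV (\<lambda>t. 1 - lgs t)" by (intro continuous_intros)
    then have c: "isCont w t" "isCont (\<lambda>t. 1 - lgs t) t" using wc by (auto simp: continuous_on_eq_continuous_at)
    have 1: "cderiv (\<lambda>t. 1 - lgs t) (- (lgs t * (1 - lgs t))) t"
      using cderiv_add[OF cderiv_const cderiv_minus[OF cderiv_lgs], of 1 t] by simp
    have "cderiv f ((lgs t * (1 - lgs t) * (1 - lgs t) + lgs t * (- (lgs t * (1 - lgs t)))) * w t + (lgs t * (1 - lgs t)) * w' t) t"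
      unfolding w(2) by (intro cderiv_mult cderiv_lgs 1 w' c)
    then show ?thesis by (simp add: z_def algebra_simps)
  qed
  obtain B where B: "\<And>t. norm (lgs t * (1 - lgs t) * z t) \<le> B" using bd[OF z] by blast
  have "has_uderiv I f (\<lambda>t. lgs t * (1 - lgs t) * z t)"
    using der B by (intro has_uderiv_classical fc zc) (auto simp: cderiv_def)
  then show "continuous_on I f \<and> (\<exists>B. \<forall>t\<in>I. norm (f t) \<le> B) \<and> (\<exists>g\<in>?X. has_uderiv I f g)"
    using fc bd[OF w(1)] w(2) z by blast
qed

text \<open>Near each point and on each side such a function is constant, so a product with it is
  differentiated one-sidedly as if it were a multiple.\<close>

definition step :: "(real \<Rightarrow> complex) \<Rightarrow> bool" where
  "step w \<longleftrightarrow> w \<in> borel_measurable (lebesgue_on I) \<and> (\<forall>t b. eventually (\<lambda>s. w s = slim b w t) (ess b t))"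

lemma step_const: "step (\<lambda>_. l)"
  by (simp add: step_def)

lemma step_ind: "step (ind x)"
  unfolding step_def slim_ind using ess_ind by simp

lemma step_diff: assumes "step v" "step w" shows "step (\<lambda>t. v t - w t)"
proof -
  have *: "eventually (\<lambda>s. v s - w s = slim b v t - slim b w t) (ess b t)" for t b
  proof -
    have "eventually (\<lambda>s. v s = slim b v t) (ess b t)" "eventually (\<lambda>s. w s = slim b w t) (ess b t)"
      using assms unfolding step_def by auto
    then show ?thesis by eventually_elim simp
  qed
  then have "slim b (\<lambda>t. v t - w t) t = slim b v t - slim b w t" for t b
    by (intro slim_eqI tendsto_eventually)
  then show ?thesis using * assms unfolding step_def by auto
qed

lemma step2_slim:
  assumes w: "step w1" "step w2" and f: "continuous_on I f1" "continuous_on I f2" and t: "t \<in> I"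
  shows "((\<lambda>t. w1 t * f1 t + w2 t * f2 t) \<longlongrightarrow> slim b w1 t * f1 t + slim b w2 t * f2 t) (ess b t)"
proof -
  have "(w1 \<longlongrightarrow> slim b w1 t) (ess b t)" "(w2 \<longlongrightarrow> slim b w2 t) (ess b t)"
    using w unfolding step_def by (auto intro: tendsto_eventually)
  moreover have "(g \<longlongrightarrow> g t) (ess b t)" if "continuous_on I g" for g :: "real \<Rightarrow> complex"
    using that t open_I by (intro tendsto_mono[OF ess_le_at]) (simp add: continuous_on_eq_continuous_at isCont_def)
  from this[OF f(1)] this[OF f(2)] have "(f1 \<longlongrightarrow> f1 t) (ess b t)" "(f2 \<longlongrightarrow> f2 t) (ess b t)" .
  ultimately show ?thesis by (intro tendsto_intros)
qed

text \<open>Two summands are treated together because the bound is imposed on their sum alone: a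
  truncated power and its logistic counterpart can each be unbounded on \<open>I\<close> while their
  difference is bounded.\<close>

lemma step2_GG:
  assumes w: "step w1" "step w2" and f: "continuous_on I f1" "continuous_on I f2"
    and B: "\<And>t. t \<in> I \<Longrightarrow> norm (w1 t * f1 t + w2 t * f2 t) \<le> B"
  shows "(\<lambda>t. w1 t * f1 t + w2 t * f2 t) \<in> GG I"
proof (rule GG_I)
  have "f1 \<in> borel_measurable (lebesgue_on I)" "f2 \<in> borel_measurable (lebesgue_on I)"
    using f by (auto intro: continuous_imp_measurable_on_sets_lebesgue)
  then show "(\<lambda>t. w1 t * f1 t + w2 t * f2 t) \<in> borel_measurable (lebesgue_on I)"
    using w unfolding step_def by (intro borel_measurable_add borel_measurable_times) auto
  show "AE t in lebesgue_on I. norm (w1 t * f1 t + w2 t * f2 t) \<le> B" using B by (intro AE_I2) auto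
qed (use step2_slim[OF w f] in blast)

lemma step2_uderiv:
  assumes w: "step w1" "step w2" and f: "continuous_on I f1" "continuous_on I f2"
    and f': "continuous_on I f1'" "continuous_on I f2'"
    and d: "\<And>t. t \<in> I \<Longrightarrow> cderiv f1 (f1' t) t" "\<And>t. t \<in> I \<Longrightarrow> cderiv f2 (f2' t) t"
    and B: "\<And>t. t \<in> I \<Longrightarrow> norm (w1 t * f1' t + w2 t * f2' t) \<le> B"
  shows "has_uderiv I (\<lambda>t. w1 t * f1 t + w2 t * f2 t) (\<lambda>t. w1 t * f1' t + w2 t * f2' t)"
  unfolding has_uderiv_iff
proof (intro conjI ballI allI)
  show "(\<lambda>t. w1 t * f1' t + w2 t * f2' t) \<in> GG I" by (rule step2_GG[OF w f' B])
  fix t b assume t: "t \<in> I"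
  let ?a = "slim b w1 t" and ?b = "slim b w2 t"
  have g: "slim b (\<lambda>t. w1 t * f1 t + w2 t * f2 t) t = ?a * f1 t + ?b * f2 t"
    by (rule slim_eqI[OF step2_slim[OF w f t]])
  have h: "slim b (\<lambda>t. w1 t * f1' t + w2 t * f2' t) t = ?a * f1' t + ?b * f2' t"
    by (rule slim_eqI[OF step2_slim[OF w f' t]])
  have "cderiv (\<lambda>s. ?a * f1 s + ?b * f2 s) (?a * f1' t + ?b * f2' t) t"
    by (intro cderiv_add cderiv_cmult d t)
  then have lim: "((\<lambda>s. (?a * f1 s + ?b * f2 s - (?a * f1 t + ?b * f2 t)) / of_real (s - t)) \<longlongrightarrow> ?a * f1' t + ?b * f2' t) (ess b t)"
    unfolding cderiv_def by (rule tendsto_mono[OF ess_le_at])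
  have "eventually (\<lambda>s. w1 s = ?a) (ess b t)" "eventually (\<lambda>s. w2 s = ?b) (ess b t)"
    using w unfolding step_def by auto
  then have ev: "eventually (\<lambda>s. (?a * f1 s + ?b * f2 s - (?a * f1 t + ?b * f2 t)) / of_real (s - t) =
      (w1 s * f1 s + w2 s * f2 s - (?a * f1 t + ?b * f2 t)) / of_real (s - t)) (ess b t)"
    by eventually_elim simp
  show "((\<lambda>s. (w1 s * f1 s + w2 s * f2 s - slim b (\<lambda>t. w1 t * f1 t + w2 t * f2 t) t) / complex_of_real (s - t)) \<longlongrightarrow>
      slim b (\<lambda>t. w1 t * f1' t + w2 t * f2' t) t) (ess b t)"
    unfolding g h by (rule Lim_transform_eventually[OF lim ev])
qed

text \<open>An explicit tower of derivatives: \<open>k\<close> bounded continuous levels, one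
  piecewise continuous level, then bounded smooth ones. It can be checked without reference to the
  choices made by \<open>uderivs\<close>.\<close>

primrec FFc :: "nat \<Rightarrow> (real \<Rightarrow> complex) \<Rightarrow> bool" where
  "FFc 0 g \<longleftrightarrow> g \<in> piecewise_continuous I \<and> (\<exists>h. has_uderiv I g h \<and> h \<in> bsmooth)"
| "FFc (Suc k) g \<longleftrightarrow> g \<in> GG I \<and> g \<in> bdd_continuous I \<and> (\<exists>h. has_uderiv I g h \<and> FFc k h)"

lemma FFc_FF_k: "FFc k g \<Longrightarrow> g \<in> FF_k I k"
proof (induction k arbitrary: g)
  case 0
  then obtain h where h: "g \<in> piecewise_continuous I" "has_uderiv I g h" "h \<in> bsmooth" by auto
  then have G: "g \<in> GGinf I" using GGinf_I unfolding piecewise_continuous_def bsmooth_def by blast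
  have "uderivs I i g \<in> bdd_continuous I" if i: "i \<noteq> 0" for i
  proof -
    obtain j where "i = Suc j" using i by (cases i) auto
    then show ?thesis using bdd_continuous_cong[OF _ ae_eq_sym[OF uderivs_step[OF G h(2), of j]]] h(3)
      unfolding bsmooth_def by blast
  qed
  then show ?case using G h(1) unfolding FF_k_def by auto
next
  case (Suc k)
  then obtain h where h: "g \<in> GG I" "g \<in> bdd_continuous I" "has_uderiv I g h" "h \<in> FF_k I k" by auto
  then have G: "g \<in> GGinf I" using GGinf_I unfolding FF_k_def by blast
  note ae = ae_eq_sym[OF uderivs_step[OF G h(3)]]
  have "uderivs I i g \<in> bdd_continuous I" if "i \<noteq> Suc k" for i
  proof (cases i)
    case 0 then show ?thesis using h(2) by simp
  next
    case (Suc j)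
    then have "j \<noteq> k" using that by simp
    then show ?thesis using bdd_continuous_cong[OF _ ae] h(4) Suc unfolding FF_k_def by blast
  qed
  moreover have "uderivs I (Suc k) g \<in> piecewise_continuous I"
    using piecewise_continuous_cong[OF _ ae] h(4) unfolding FF_k_def by blast
  ultimately show ?case using G unfolding FF_k_def by auto
qed

text \<open>The basic function with its only singularity in order \<open>i\<close>: the derivatives
  below order \<open>i\<close> are continuous, and the \<open>i\<close>-th one jumps at
  \<open>x\<close> by the factorial of \<open>i\<close>.\<close>

definition kink :: "real \<Rightarrow> nat \<Rightarrow> real \<Rightarrow> complex" where
  "kink x i t = (ind x t - lgs t) * of_real (t - x) ^ i"

lemma kink_bound: "\<exists>B. \<forall>t. norm (kink x i t) \<le> B"
proof -
  have "norm (kink x i t) \<le> exp \<bar>x\<bar> * (1 + \<bar>x\<bar>) ^ i * real i ^ i" for t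
  proof -
    \<comment> \<open>Splitting off \<open>x\<close> in this way leaves a power of
      \<open>1 + \<bar>t\<bar>\<close>, which the exponential decay absorbs.\<close>
    have "\<bar>t - x\<bar> \<le> (1 + \<bar>x\<bar>) * (1 + \<bar>t\<bar>)" by (simp add: algebra_simps) (smt (verit) mult_nonneg_nonneg abs_ge_zero)
    then have p: "\<bar>t - x\<bar> ^ i \<le> ((1 + \<bar>x\<bar>) * (1 + \<bar>t\<bar>)) ^ i" by (intro power_mono) auto
    have "norm (kink x i t) = norm (ind x t - lgs t) * \<bar>t - x\<bar> ^ i"
      unfolding kink_def norm_mult norm_power norm_of_real ..
    also have "\<dots> \<le> (exp \<bar>x\<bar> * exp (- \<bar>t\<bar>)) * ((1 + \<bar>x\<bar>) * (1 + \<bar>t\<bar>)) ^ i"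
      using norm_ind_lgs_le p by (intro mult_mono) auto
    also have "\<dots> = exp \<bar>x\<bar> * (1 + \<bar>x\<bar>) ^ i * (exp (- \<bar>t\<bar>) * (1 + \<bar>t\<bar>) ^ i)"
      by (simp add: power_mult_distrib mult_ac)
    also have "\<dots> \<le> exp \<bar>x\<bar> * (1 + \<bar>x\<bar>) ^ i * real i ^ i"
      by (intro mult_left_mono exp_power_bound) auto
    finally show ?thesis .
  qed
  then show ?thesis by blast
qed

lemma kink_step: "kink x i = (\<lambda>t. ind x t * of_real (t - x) ^ i + 1 * (- (lgs t * of_real (t - x) ^ i)))"
  by (simp add: fun_eq_iff kink_def algebra_simps)

lemma kink_GG: "kink x i \<in> GG I"
proof -
  obtain B where "\<And>t. norm (kink x i t) \<le> B" using kink_bound by blast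
  then show ?thesis unfolding kink_step
    by (intro step2_GG[of _ _ _ _ B] step_ind step_const continuous_intros) auto
qed

lemma cderiv_pow: "cderiv (\<lambda>t. of_real (t - x) ^ i) (of_nat i * of_real (t - x) ^ (i - 1)) t"
proof -
  have "((\<lambda>t. (t - x) ^ i) has_real_derivative (real i * (t - x) ^ (i - 1))) (at t)"
    by (auto intro!: derivative_eq_intros)
  from cderiv_of_real[OF this] show ?thesis by simp
qed

text \<open>The truncated power loses one degree and the logistic factor leaves a smooth remainder.
  For \<open>i = 0\<close> truncated subtraction gives \<open>kink x 0\<close> again, but with
  coefficient 0.\<close>

lemma kink_uderiv:
  "has_uderiv I (kink x i) (\<lambda>t. of_nat i * kink x (i - 1) t - lgs t * (1 - lgs t) * of_real (t - x) ^ i)"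
proof -
  obtain B where B: "\<And>t. norm (kink x (i - 1) t) \<le> B" using kink_bound by blast
  have sl: "(\<lambda>t. (of_real t + (- of_real x)) ^ i) \<in> slow" by (intro slow_power slow.intros)
  then have "(\<lambda>t. lgs t * (1 - lgs t) * (of_real t + (- of_real x)) ^ i) \<in> bsmooth" by (rule bsmooth_slow)
  define b where "b = (\<lambda>t. lgs t * (1 - lgs t) * of_real (t - x) ^ i)"
  have "\<exists>D. \<forall>t. norm (b t) \<le> D"
  proof -
    obtain C N where C: "0 \<le> C" "\<And>t. norm ((complex_of_real t + (- of_real x)) ^ i) \<le> C * (1 + \<bar>t\<bar>) ^ N"
      using slow_growth[OF sl] by blast
    have "norm (b t) \<le> C * real N ^ N" for t
    proof -
      have "norm (b t) = norm (lgs t * (1 - lgs t)) * norm ((complex_of_real t + (- of_real x)) ^ i)"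
        by (simp add: b_def norm_mult)
      also have "\<dots> \<le> exp (- \<bar>t\<bar>) * (C * (1 + \<bar>t\<bar>) ^ N)"
        using C(2)[of t] norm_lgs_prod_le[of t] by (intro mult_mono) auto
      also have "\<dots> = C * (exp (- \<bar>t\<bar>) * (1 + \<bar>t\<bar>) ^ N)" by simp
      also have "\<dots> \<le> C * real N ^ N" by (intro mult_left_mono exp_power_bound C)
      finally show ?thesis .
    qed
    then show ?thesis by blast
  qed
  then obtain D where D: "\<And>t. norm (b t) \<le> D" by blast
  let ?d = "\<lambda>t. - (lgs t * (1 - lgs t) * of_real (t - x) ^ i + lgs t * (of_nat i * complex_of_real (t - x) ^ (i - 1)))"
  have eq: "ind x t * (of_nat i * of_real (t - x) ^ (i - 1)) + 1 * ?d t = of_nat i * kink x (i - 1) t - b t" for t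
    by (simp add: kink_def b_def algebra_simps)
  have "has_uderiv I (\<lambda>t. ind x t * of_real (t - x) ^ i + 1 * (- (lgs t * of_real (t - x) ^ i)))
    (\<lambda>t. ind x t * (of_nat i * of_real (t - x) ^ (i - 1)) + 1 * ?d t)"
  proof (rule step2_uderiv[where B = "real i * B + D"])
    fix t
    have "isCont (\<lambda>t. complex_of_real (t - x) ^ i) t" by (intro continuous_intros)
    then show "cderiv (\<lambda>t. - (lgs t * of_real (t - x) ^ i)) (?d t) t"
      by (intro cderiv_minus cderiv_mult cderiv_lgs cderiv_pow)
    have "norm (of_nat i * kink x (i - 1) t - b t) \<le> norm (of_nat i * kink x (i - 1) t) + norm (b t)"
      by (rule norm_triangle_ineq4)
    also have "\<dots> \<le> real i * B + D"
      using B[of "t"] D[of t] by (simp add: norm_mult add_mono mult_left_mono)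
    finally show "norm (ind x t * (of_nat i * of_real (t - x) ^ (i - 1)) + 1 * ?d t) \<le> real i * B + D"
      unfolding eq .
  qed (intro step_ind step_const continuous_intros cderiv_pow)+
  then show ?thesis unfolding eq unfolding kink_step[symmetric] b_def .
qed

text \<open>The scalar \<open>l\<close> and the smooth summand \<open>\<beta>\<close> are arbitrary
  because differentiating a kink changes its coefficient and produces such a summand at each stage
  of the induction.\<close>

lemma kink_FFc: "\<beta> \<in> bsmooth \<Longrightarrow> FFc i (\<lambda>t. l * kink x i t + \<beta> t)"
proof (induction i arbitrary: l \<beta>)
  case 0
  note \<beta> = bsmooth_GGinf[OF 0] bsmooth_bdd[OF 0]
  then obtain h where h: "ae_eq I \<beta> h" "continuous_on I h" unfolding bdd_continuous_def by blast
  have G: "(\<lambda>t. l * kink x 0 t + \<beta> t) \<in> GG I" by (intro GG_add GG_cmult kink_GG GGinf_GG \<beta>)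
  have "continuous_on (I - {x}) (\<lambda>t. l * kink x 0 t + h t)"
  proof -
    have "continuous_on (I - {x}) (ind x)"
      unfolding continuous_on_eq_continuous_within
    proof
      fix t assume t: "t \<in> I - {x}"
      have "eventually (\<lambda>s. ind x s = ind x t) (at t within I - {x})"
      proof (cases "x < t")
        case True
        then show ?thesis unfolding eventually_at by (intro exI[of _ "t - x"]) (auto simp: ind_def dist_real_def)
      next
        case False
        then have "t < x" using t by auto
        then show ?thesis unfolding eventually_at by (intro exI[of _ "x - t"]) (auto simp: ind_def dist_real_def)
      qed
      then show "continuous (at t within I - {x}) (ind x)"
        unfolding continuous_within by (rule tendsto_eventually)
    qed
    then show ?thesis unfolding kink_def using h(2) by (auto intro!: continuous_intros intro: continuous_on_subset)
  qed
  moreover have "ae_eq I (\<lambda>t. l * kink x 0 t + \<beta> t) (\<lambda>t. l * kink x 0 t + h t)"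
    using h(1) unfolding ae_eq_def by (auto elim: eventually_mono)
  ultimately have pc: "(\<lambda>t. l * kink x 0 t + \<beta> t) \<in> piecewise_continuous I"
    unfolding piecewise_continuous_def using G
    by (intro CollectI conjI exI[of _ "\<lambda>t. l * kink x 0 t + h t"] exI[of _ "{x} \<inter> I"]) (auto intro: continuous_on_subset)
  have "has_uderiv I (\<lambda>t. l * kink x 0 t + \<beta> t) (\<lambda>t. l * (of_nat 0 * kink x (0 - 1) t - lgs t * (1 - lgs t) * of_real (t - x) ^ 0) + uderiv I \<beta> t)"
    by (intro has_uderiv_add has_uderiv_cmult kink_uderiv GG_cmult kink_GG GGinf_GG \<beta> uderiv_has)
  then have "has_uderiv I (\<lambda>t. l * kink x 0 t + \<beta> t) (\<lambda>t. (- l) * (lgs t * (1 - lgs t) * 1) + uderiv I \<beta> t)"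
    by simp
  moreover have "(\<lambda>t. (- l) * (lgs t * (1 - lgs t) * 1) + uderiv I \<beta> t) \<in> bsmooth"
    by (intro bsmooth_lin bsmooth_slow slow.const bsmooth_uderiv[OF 0] uderiv_has \<beta>)
  ultimately show ?case using pc by (simp only: FFc.simps) blast
next
  case (Suc i)
  note \<beta> = bsmooth_GGinf[OF Suc.prems] bsmooth_bdd[OF Suc.prems]
  have G: "(\<lambda>t. l * kink x (Suc i) t + \<beta> t) \<in> GG I" by (intro GG_add GG_cmult kink_GG GGinf_GG \<beta>)
  obtain B where B: "\<And>t. norm (kink x (Suc i) t) \<le> B" using kink_bound by blast
  have "continuous_on I (kink x (Suc i))"
  proof -
    \<comment> \<open>One factor \<open>t - x\<close> turns the step function into a positive part,
      which exhibits continuity.\<close>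
    have eq: "kink x (Suc i) = (\<lambda>t. complex_of_real (t - x) ^ i * (complex_of_real (max 0 (t - x)) - lgs t * of_real (t - x)))"
      by (auto simp: fun_eq_iff kink_def ind_def max_def algebra_simps)
    show ?thesis unfolding eq by (intro continuous_intros)
  qed
  then have "kink x (Suc i) \<in> bdd_continuous I" using B by (intro bdd_continuousI) auto
  then have bc: "(\<lambda>t. l * kink x (Suc i) t + \<beta> t) \<in> bdd_continuous I" using bdd_continuous_lin \<beta> by blast
  define \<gamma> where "\<gamma> = (\<lambda>t. (- l) * (lgs t * (1 - lgs t) * (of_real t + - of_real x) ^ Suc i) + uderiv I \<beta> t)"
  have "has_uderiv I (\<lambda>t. l * kink x (Suc i) t + \<beta> t) (\<lambda>t. l * (of_nat (Suc i) * kink x (Suc i - 1) t - lgs t * (1 - lgs t) * of_real (t - x) ^ Suc i) + uderiv I \<beta> t)"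
    by (intro has_uderiv_add has_uderiv_cmult kink_uderiv GG_cmult kink_GG GGinf_GG \<beta> uderiv_has)
  moreover have "(\<lambda>t. l * (of_nat (Suc i) * kink x (Suc i - 1) t - lgs t * (1 - lgs t) * of_real (t - x) ^ Suc i) + uderiv I \<beta> t)
    = (\<lambda>t. (l * of_nat (Suc i)) * kink x i t + \<gamma> t)"
    by (simp add: fun_eq_iff \<gamma>_def algebra_simps)
  moreover have "\<gamma> \<in> bsmooth" unfolding \<gamma>_def
    by (intro bsmooth_lin bsmooth_slow slow_power slow.intros bsmooth_uderiv[OF Suc.prems] uderiv_has \<beta>)
  ultimately show ?case using G bc Suc.IH by (simp only: FFc.simps) metis
qed

lemma kink_FF: "kink x i \<in> FF I"
  using FF_base[OF FFc_FF_k[OF kink_FFc[OF bsmooth_zero, of i 1 x]]] by simp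

text \<open>Expanding the polynomial in powers of \<open>t - x\<close> writes the function as a
  linear combination of kinks at \<open>x\<close>.\<close>

lemma ind_lgs_poly_FF: "(\<lambda>t. (ind x t - lgs t) * poly p (of_real t)) \<in> FF I"
proof -
  define q where "q = pcompose p [:of_real x, 1:]"
  have "poly p (of_real t) = (\<Sum>i\<le>degree q. coeff q i * of_real (t - x) ^ i)" for t
  proof -
    have "poly p (of_real t) = poly q (of_real (t - x))" by (simp add: q_def poly_pcompose)
    then show ?thesis unfolding poly_altdef .
  qed
  then have "(\<lambda>t. (ind x t - lgs t) * poly p (of_real t)) = (\<lambda>t. \<Sum>i\<le>degree q. coeff q i * kink x i t)"
    by (simp add: fun_eq_iff kink_def sum_distrib_left mult_ac del: of_real_diff)
  then show ?thesis by (simp only:) (intro FF_sum FF_cmult kink_FF)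
qed

definition bx :: "real \<Rightarrow> real \<Rightarrow> complex poly \<Rightarrow> real \<Rightarrow> complex" where
  "bx x y p t = (ind x t - ind y t) * poly p (of_real t)"

text \<open>The logistic terms belonging to the two endpoints cancel, so a polynomial cut to
  \<open>[x, y)\<close> is a difference of functions that are bounded with all derivatives.\<close>

lemma bx_FF: "bx x y p \<in> FF I"
proof -
  have "bx x y p = (\<lambda>t. (ind x t - lgs t) * poly p (of_real t) + (-1) * ((ind y t - lgs t) * poly p (of_real t)))"
    by (simp add: fun_eq_iff bx_def algebra_simps)
  then show ?thesis by (simp only:) (intro FF_add FF_cmult ind_lgs_poly_FF)
qed

end

section \<open>Density of piecewise polynomials\<close>

lemma pderiv_surj: "\<exists>q. pderiv q = (p :: complex poly)"
proof
  have sum: "pderiv (\<Sum>i\<in>A. f i) = (\<Sum>i\<in>A. pderiv (f i))" for A :: "nat set" and f :: "nat \<Rightarrow> complex poly"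
    by (induction A rule: infinite_finite_induct) (auto simp: pderiv_add)
  have "pderiv (\<Sum>i\<le>degree p. monom (coeff p i / of_nat (Suc i)) (Suc i)) = (\<Sum>i\<le>degree p. monom (coeff p i) i)"
    unfolding sum by (intro sum.cong refl) (simp add: pderiv_monom del: of_nat_Suc)
  then show "pderiv (\<Sum>i\<le>degree p. monom (coeff p i / of_nat (Suc i)) (Suc i)) = p"
    by (simp add: poly_as_sum_of_monoms)
qed

context open_interval
begin

lemma bx_outside: "x \<le> y \<Longrightarrow> t \<notin> {x..<y} \<Longrightarrow> bx x y p t = 0"
  by (auto simp: bx_def ind_def)

lemma bx_bound: assumes "x \<le> y" shows "\<exists>B. \<forall>t. norm (bx x y p t) \<le> B"
proof -
  have "compact ((\<lambda>t. poly p (complex_of_real t)) ` {x..y})"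
    by (intro compact_continuous_image continuous_poly compact_Icc)
  then obtain B where B: "\<And>t. t \<in> {x..y} \<Longrightarrow> norm (poly p (complex_of_real t)) \<le> B"
    using compact_imp_bounded bounded_iff by (metis imageI)
  have "0 \<le> B" using B[of x] assms norm_ge_zero order_trans by (metis atLeastAtMost_iff order_refl)
  then have "norm (bx x y p t) \<le> B" for t using B[of t] assms by (auto simp: bx_def ind_def)
  then show ?thesis by blast
qed

lemma bx_step: "bx x y p = (\<lambda>t. (ind x t - ind y t) * poly p (of_real t) + 0 * 0)"
  by (simp add: fun_eq_iff bx_def)

lemma bx_GG: assumes "x \<le> y" shows "bx x y p \<in> GG I"
proof -
  obtain B where B: "\<And>t. norm (bx x y p t) \<le> B" using bx_bound[OF assms] by blast
  then show ?thesis unfolding bx_step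
    by (intro step2_GG[where B = B] step_diff step_ind step_const continuous_intros) auto
qed

lemma bx_uderiv: assumes "x \<le> y" shows "has_uderiv I (bx x y p) (bx x y (pderiv p))"
proof -
  obtain B where B: "\<And>t. norm (bx x y (pderiv p) t) \<le> B" using bx_bound[OF assms] by blast
  then show ?thesis unfolding bx_step
    by (intro step2_uderiv[where B = B] step_diff step_ind step_const continuous_intros cderiv_poly cderiv_const) auto
qed

lemma slim_bx: "t \<in> I \<Longrightarrow> slim b (bx x y p) t = (slim b (ind x) t - slim b (ind y) t) * poly p (of_real t)"
proof -
  assume t: "t \<in> I"
  have "slim b (\<lambda>t. ind x t - ind y t) t = slim b (ind x) t - slim b (ind y) t"
    by (rule slim_diff[OF GG_ind GG_ind t])
  then show ?thesis unfolding bx_step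
    using slim_eqI[OF step2_slim[OF step_diff[OF step_ind step_ind] step_const continuous_poly continuous_on_const t], of b x y p 0 0]
    by simp
qed

lemma bx_GGinf: assumes "x \<le> y" shows "bx x y p \<in> GGinf I"
proof -
  have "has_uderiv I (bx x y ((pderiv ^^ k) p)) (bx x y ((pderiv ^^ Suc k) p))" for k
    using bx_uderiv[OF assms] by simp
  then show ?thesis unfolding GGinf_def using bx_GG[OF assms]
    by (intro CollectI conjI exI[of _ "\<lambda>k. bx x y ((pderiv ^^ k) p)"]) auto
qed

inductive ppol :: "real \<Rightarrow> real \<Rightarrow> (real \<Rightarrow> complex) \<Rightarrow> bool" for u v where
  base: "u \<le> x \<Longrightarrow> x \<le> y \<Longrightarrow> y \<le> v \<Longrightarrow> ppol u v (bx x y p)"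
| add: "ppol u v f \<Longrightarrow> ppol u v g \<Longrightarrow> ppol u v (\<lambda>t. f t + g t)"

lemma ppol_mono: "ppol u v f \<Longrightarrow> u' \<le> u \<Longrightarrow> v \<le> v' \<Longrightarrow> ppol u' v' f"
  by (induction rule: ppol.induct) (auto intro: ppol.intros)

lemma ppol_outside: "ppol u v f \<Longrightarrow> t \<notin> {u..<v} \<Longrightarrow> f t = 0"
  by (induction rule: ppol.induct) (auto simp: bx_outside)

lemma ppol_GGinf: "ppol u v f \<Longrightarrow> f \<in> GGinf I"
  by (induction rule: ppol.induct) (auto intro: GGinf_add bx_GGinf)

lemma ppol_van: "ppol u v f \<Longrightarrow> u \<in> I \<Longrightarrow> v \<in> I \<Longrightarrow> van u v f"
  unfolding van_def using ppol_outside[of u v f] by (auto intro!: AE_I2)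

text \<open>On a one-sided neighbourhood of \<open>t\<close> all derivatives up to order \<open>k\<close> of the Taylor polynomial
  are close to those of \<open>\<psi>\<close>, because they have the same one-sided limits at \<open>t\<close>.\<close>

lemma taylor_side:
  assumes "\<psi> \<in> GGinf I" "t \<in> I" "e > 0"
  shows "\<exists>p. \<exists>d>0. \<forall>x y. x \<le> y \<longrightarrow> {x<..<y} \<subseteq> side b t d \<longrightarrow>
     ggb k e (\<lambda>s. (ind x s - ind y s) * \<psi> s - bx x y p s)"
  using assms(1)
proof (induction k arbitrary: \<psi>)
  have AEb: "AE s in lebesgue_on I. norm ((ind x s - ind y s) * \<psi> s - bx x y p s) \<le> e"
    if "AE s in lebesgue. s \<in> side b t d \<longrightarrow> norm (\<psi> s - poly p (of_real s)) < e"
      "x \<le> y" "{x<..<y} \<subseteq> side b t d" for \<psi> p d x y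
  proof -
    have 1: "AE s in lebesgue_on I. s \<in> side b t d \<longrightarrow> norm (\<psi> s - poly p (of_real s)) < e"
      unfolding AE_I using that(1) by eventually_elim blast
    \<comment> \<open>The point \<open>x\<close> is discarded because it belongs to the half-open
      interval selected by \<open>ind x - ind y\<close> but not to the open interval on which the
      estimate is known.\<close>
    show ?thesis using 1 AE_ne[of x]
    proof eventually_elim
      case (elim s)
      show ?case
      proof (cases "s \<in> {x<..<y}")
        case True
        then show ?thesis using elim that(3) by (auto simp: bx_def ind_def)
      next
        case False
        then have "ind x s - ind y s = 0" using elim(2) that(2) by (auto simp: ind_def)
        then show ?thesis using assms(3) by (simp add: bx_def)
      qed
    qed
  qed
  have near: "\<exists>d>0. AE s in lebesgue. s \<in> side b t d \<longrightarrow> norm (\<psi> s - poly p (of_real s)) < e"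
    if "\<psi> \<in> GGinf I" "poly p (of_real t) = slim b \<psi> t" for \<psi> p
  proof -
    have "((\<lambda>s. poly p (complex_of_real s)) \<longlongrightarrow> poly p (of_real t)) (ess b t)"
      using continuous_poly[of UNIV p] by (intro tendsto_mono[OF ess_le_at]) (simp add: continuous_on_eq_continuous_at isCont_def)
    then have "((\<lambda>s. \<psi> s - poly p (of_real s)) \<longlongrightarrow> 0) (ess b t)"
      using tendsto_diff[OF GG_tendsto[OF GGinf_GG[OF that(1)] assms(2), of b]] that(2) by fastforce
    then have "eventually (\<lambda>s. norm (\<psi> s - poly p (of_real s)) < e) (ess b t)"
      using tendstoD[OF _ assms(3)] by (fastforce simp: dist_norm)
    then show ?thesis unfolding eventually_ess .
  qed
  have G: "(\<lambda>s. (ind x s - ind y s) * \<psi> s - bx x y p s) \<in> GG I" if "\<psi> \<in> GG I" "x \<le> y" for \<psi> x y p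
    using GG_add[OF GG_mult[OF GG_add[OF GG_ind GG_cmult[OF GG_ind, of "-1"]] that(1)] GG_cmult[OF bx_GG[OF that(2)], of "-1"]]
    by simp
  {
    case 0
    obtain d where d: "d > 0" "AE s in lebesgue. s \<in> side b t d \<longrightarrow> norm (\<psi> s - poly [:slim b \<psi> t:] (of_real s)) < e"
      using near[OF 0, of "[:slim b \<psi> t:]"] by auto
    show ?case
      using AEb[OF d(2)] G[OF GGinf_GG[OF 0]] d(1) by (intro exI[of _ "[:slim b \<psi> t:]"] exI[of _ d]) simp
  next
    case (Suc k)
    obtain p d where d: "d > 0" "\<And>x y. x \<le> y \<Longrightarrow> {x<..<y} \<subseteq> side b t d \<Longrightarrow>
       ggb k e (\<lambda>s. (ind x s - ind y s) * uderiv I \<psi> s - bx x y p s)"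
      using Suc.IH[OF uderiv_GGinf[OF Suc.prems]] by blast
    obtain q0 where q0: "pderiv q0 = p" using pderiv_surj by blast
    \<comment> \<open>The constant of integration is fixed so that the value at \<open>t\<close>
      matches the one-sided limit of \<open>\<psi>\<close>.\<close>
    define q where "q = q0 + [:slim b \<psi> t - poly q0 (of_real t):]"
    have q: "pderiv q = p" "poly q (of_real t) = slim b \<psi> t" by (auto simp: q_def q0 pderiv_add pderiv_pCons)
    obtain d' where d': "d' > 0" "AE s in lebesgue. s \<in> side b t d' \<longrightarrow> norm (\<psi> s - poly q (of_real s)) < e"
      using near[OF Suc.prems q(2)] by blast
    have "ggb (Suc k) e (\<lambda>s. (ind x s - ind y s) * \<psi> s - bx x y q s)"
      if xy: "x \<le> y" "{x<..<y} \<subseteq> side b t (min d d')" for x y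
    proof (rule ggb_SucI[OF G[OF GGinf_GG[OF Suc.prems] xy(1)]])
      have sub: "{x<..<y} \<subseteq> side b t d" "{x<..<y} \<subseteq> side b t d'" 
        using xy(2) side_mono[of "min d d'" d b t] side_mono[of "min d d'" d' b t] by auto
      show "AE s in lebesgue_on I. norm ((ind x s - ind y s) * \<psi> s - bx x y q s) \<le> e" by (rule AEb[OF d'(2) xy(1) sub(2)])
      show "ggb k e (\<lambda>s. (ind x s - ind y s) * uderiv I \<psi> s - bx x y p s)" by (rule d(2)[OF xy(1) sub(1)])
      have w: "(\<lambda>s. ind x s + (-1) * ind y s) \<in> GG I" "has_uderiv I (\<lambda>s. ind x s + (-1) * ind y s) (\<lambda>_. 0 + (-1) * 0)"
        by (intro GG_add GG_cmult GG_ind has_uderiv_add has_uderiv_cmult has_uderiv_ind)+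
      have "has_uderiv I (\<lambda>s. (ind x s + (-1) * ind y s) * \<psi> s + (-1) * bx x y q s)
        (\<lambda>s. ((0 + (-1) * 0) * \<psi> s + (ind x s + (-1) * ind y s) * uderiv I \<psi> s) + (-1) * bx x y (pderiv q) s)"
        by (intro has_uderiv_add has_uderiv_mult w uderiv_has Suc.prems has_uderiv_cmult bx_uderiv xy GG_mult GGinf_GG bx_GG GG_cmult)
      then show "has_uderiv I (\<lambda>s. (ind x s - ind y s) * \<psi> s - bx x y q s) (\<lambda>s. (ind x s - ind y s) * uderiv I \<psi> s - bx x y p s)"
        by (simp add: q)
    qed
    then show ?case using d(1) d'(1) by (intro exI[of _ q] exI[of _ "min d d'"]) simp
  }
qed

text \<open>At each point only one of the two functions is present, so the common bound is kept.
  This allows any number of pieces to be joined without accumulating error.\<close>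

lemma ggb_glue:
  assumes w: "w \<in> GG I" "has_uderiv I w (\<lambda>_. 0)" "\<And>t. w t = 0 \<or> w t = 1"
  shows "ggb k B f \<Longrightarrow> ggb k B g \<Longrightarrow> ggb k B (\<lambda>t. w t * f t + (1 - w t) * g t)"
proof (induction k arbitrary: f g)
  have w1: "(\<lambda>t. 1 + (-1) * w t) \<in> GG I" "has_uderiv I (\<lambda>t. 1 + (-1) * w t) (\<lambda>_. 0 + (-1) * 0)"
    by (intro GG_add GG_cmult GG_const has_uderiv_add has_uderiv_cmult has_uderiv_const w)+
  have ae: "AE t in lebesgue_on I. norm (w t * f t + (1 - w t) * g t) \<le> B"
    if "AE t in lebesgue_on I. norm (f t) \<le> B" "AE t in lebesgue_on I. norm (g t) \<le> B" for f g
    using that by eventually_elim (metis w(3) add.left_neutral add.right_neutral cancel_comm_monoid_add_class.diff_cancel diff_zero mult_1 mult_zero_left)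
  have G: "(\<lambda>t. w t * f t + (1 - w t) * g t) \<in> GG I" if "f \<in> GG I" "g \<in> GG I" for f g
    using GG_add[OF GG_mult[OF w(1) that(1)] GG_mult[OF w1(1) that(2)]] by simp
  {
    case 0
    then show ?case using ae G by simp
  next
    case (Suc k)
    obtain f' g' where fg: "has_uderiv I f f'" "has_uderiv I g g'" "ggb k B f'" "ggb k B g'"
      using Suc.prems by auto
    have "has_uderiv I (\<lambda>t. w t * f t + (1 + (-1) * w t) * g t)
       (\<lambda>t. (0 * f t + w t * f' t) + ((0 + (-1) * 0) * g t + (1 + (-1) * w t) * g' t))"
      using Suc.prems ggb_GG by (intro has_uderiv_add has_uderiv_mult w w1 fg GG_mult) blast+
    then have "has_uderiv I (\<lambda>t. w t * f t + (1 - w t) * g t) (\<lambda>t. w t * f' t + (1 - w t) * g' t)" by simp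
    then show ?case using ae[OF ggb_AE[OF Suc.prems(1)] ggb_AE[OF Suc.prems(2)]] G Suc.prems ggb_GG Suc.IH[OF fg(3,4)]
      by (intro ggb_SucI) blast+
  }
qed

text \<open>Compactness by bisection: approximability passes from two adjacent intervals to their
  union, and near each point it holds by the Taylor approximations on its two sides.\<close>

lemma ppol_dense:
  assumes \<psi>: "\<psi> \<in> GGinf I" and uv: "u \<in> I" "v \<in> I" "u \<le> v" and e: "e > 0"
  shows "\<exists>\<eta>. ppol u v \<eta> \<and> ggb k e (\<lambda>s. (ind u s - ind v s) * \<psi> s - \<eta> s)"
proof -
  define Q where "Q = (\<lambda>x y \<eta>. ppol x y \<eta> \<and> ggb k e (\<lambda>s. (ind x s - ind y s) * \<psi> s - \<eta> s))"
  have trans: "\<exists>\<eta>. Q x z \<eta>" if Q2: "\<exists>\<eta>. Q x y \<eta>" "\<exists>\<eta>. Q y z \<eta>" and xyz: "x \<le> y" "y \<le> z" for x y z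
  proof -
    obtain \<eta>1 \<eta>2 where \<eta>: "Q x y \<eta>1" "Q y z \<eta>2" using Q2 by blast
    have p: "ppol x z (\<lambda>t. \<eta>1 t + \<eta>2 t)"
      using \<eta> xyz unfolding Q_def by (intro ppol.add) (auto intro: ppol_mono)
    have "ggb k e (\<lambda>s. ind y s * ((ind y s - ind z s) * \<psi> s - \<eta>2 s) + (1 - ind y s) * ((ind x s - ind y s) * \<psi> s - \<eta>1 s))"
      using \<eta> unfolding Q_def by (intro ggb_glue GG_ind has_uderiv_ind) (auto simp: ind_def)
    moreover have "ind y s * ((ind y s - ind z s) * \<psi> s - \<eta>2 s) + (1 - ind y s) * ((ind x s - ind y s) * \<psi> s - \<eta>1 s)
        = (ind x s - ind z s) * \<psi> s - (\<eta>1 s + \<eta>2 s)" for s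
      using ppol_outside[of x y \<eta>1 s] ppol_outside[of y z \<eta>2 s] \<eta> xyz unfolding Q_def
      by (cases "y \<le> s") (auto simp: ind_def)
    ultimately show ?thesis using p unfolding Q_def by auto
  qed
  have "\<exists>\<eta>. Q u v \<eta>"
  proof (rule Bolzano[OF uv(3)])
    show "\<exists>\<eta>. Q x z \<eta>" if "\<exists>\<eta>. Q x y \<eta>" "\<exists>\<eta>. Q y z \<eta>" "x \<le> y" "y \<le> z" for x y z by (rule trans[OF that])
    fix t assume "u \<le> t" "t \<le> v"
    then have t: "t \<in> I" using atLeastAtMost_subset_I[OF uv(1,2)] by auto
    obtain p d where d: "d > 0" "\<And>x y. x \<le> y \<Longrightarrow> {x<..<y} \<subseteq> side True t d \<Longrightarrow>
       ggb k e (\<lambda>s. (ind x s - ind y s) * \<psi> s - bx x y p s)" using taylor_side[OF \<psi> t e, of True k] by blast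
    obtain p' d' where d': "d' > 0" "\<And>x y. x \<le> y \<Longrightarrow> {x<..<y} \<subseteq> side False t d' \<Longrightarrow>
       ggb k e (\<lambda>s. (ind x s - ind y s) * \<psi> s - bx x y p' s)" using taylor_side[OF \<psi> t e, of False k] by blast
    show "\<exists>d>0. \<forall>a b. a \<le> t \<and> t \<le> b \<and> b - a < d \<longrightarrow> (\<exists>\<eta>. Q a b \<eta>)"
    proof (intro exI[of _ "min d d'"] conjI allI impI)
      fix a b assume ab: "a \<le> t \<and> t \<le> b \<and> b - a < min d d'"
      have "Q a t (bx a t p')" 
      proof -
        have "{a<..<t} \<subseteq> side False t d'" using ab by (auto simp: side_def)
        then show ?thesis unfolding Q_def using ab d'(2)[of a t] by (auto intro: ppol.base)
      qed
      moreover have "Q t b (bx t b p)" 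
      proof -
        have "{t<..<b} \<subseteq> side True t d" using ab by (auto simp: side_def)
        then show ?thesis unfolding Q_def using ab d(2)[of t b] by (auto intro: ppol.base)
      qed
      ultimately show "\<exists>\<eta>. Q a b \<eta>" using trans[of a t b] ab by blast
    qed (use d d' in auto)
  qed
  then show ?thesis by (simp add: Q_def)
qed

end

section \<open>Functionals in Delta and the inversion of the derivative\<close>

context truncated
begin

text \<open>For a single piece, with \<open>q\<close> an antiderivative of \<open>p\<close>, the
  primitive is \<open>q y - q t\<close> on \<open>[x, y)\<close> and the constant
  \<open>q y - q x\<close> on \<open>[c, x)\<close>. It is continuous except at \<open>c\<close> and
  again piecewise polynomial, hence in \<open>FF I\<close>.\<close>

lemma ppol_primitive:
  assumes "ppol c w \<eta>" "w \<in> I"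
  shows "\<exists>\<Phi>. \<Phi> \<in> FF I \<and> \<Phi> \<in> GG I \<and> has_uderiv I \<Phi> (\<lambda>t. - \<eta> t) \<and>
     (\<forall>t\<in>I. t \<noteq> c \<longrightarrow> jump t \<Phi> = 0) \<and> (\<forall>t. t \<notin> {c..<w} \<longrightarrow> \<Phi> t = 0)"
  using assms(1)
proof (induction rule: ppol.induct)
  case (base x y p)
  obtain q where q: "pderiv q = p" using pderiv_surj by blast
  define f where "f = bx x y ([:poly q (of_real y):] - q)"
  define g where "g = bx c x [:poly q (of_real y) - poly q (of_real x):]"
  have "has_uderiv I (\<lambda>t. f t + g t) (\<lambda>t. bx x y (pderiv ([:poly q (of_real y):] - q)) t + bx c x (pderiv [:poly q (of_real y) - poly q (of_real x):]) t)"
    unfolding f_def g_def by (intro has_uderiv_add bx_uderiv bx_GG base)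
  moreover have "(\<lambda>t. bx x y (pderiv ([:poly q (of_real y):] - q)) t + bx c x (pderiv [:poly q (of_real y) - poly q (of_real x):]) t) = (\<lambda>t. - bx x y p t)"
    by (simp add: fun_eq_iff bx_def pderiv_diff pderiv_pCons q)
  ultimately have u: "has_uderiv I (\<lambda>t. f t + g t) (\<lambda>t. - bx x y p t)" by simp
  have G: "f \<in> GG I" "g \<in> GG I" using base by (auto simp: f_def g_def bx_GG)
  have "jump t (\<lambda>t. f t + g t) = 0" if "t \<in> I" "t \<noteq> c" for t
    using that base unfolding jump_slim slim_add[OF G that(1)]
    by (auto simp: f_def g_def slim_bx slim_ind)
  moreover have "f t + g t = 0" if "t \<notin> {c..<w}" for t
    using that base by (auto simp: f_def g_def bx_outside)
  ultimately show ?case using u G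
    by (intro exI[of _ "\<lambda>t. f t + g t"]) (auto intro: GG_add FF_add bx_FF simp: f_def g_def)
next
  case (add f g)
  then obtain F G where *: "F \<in> FF I" "F \<in> GG I" "has_uderiv I F (\<lambda>t. - f t)" "\<forall>t\<in>I. t \<noteq> c \<longrightarrow> jump t F = 0" "\<forall>t. t \<notin> {c..<w} \<longrightarrow> F t = 0"
    "G \<in> FF I" "G \<in> GG I" "has_uderiv I G (\<lambda>t. - g t)" "\<forall>t\<in>I. t \<noteq> c \<longrightarrow> jump t G = 0" "\<forall>t. t \<notin> {c..<w} \<longrightarrow> G t = 0" by blast
  then have "has_uderiv I (\<lambda>t. F t + G t) (\<lambda>t. - f t + - g t)" by (intro has_uderiv_add)
  then show ?case using *
    by (intro exI[of _ "\<lambda>t. F t + G t"]) (auto intro: GG_add FF_add simp: jump_add)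
qed

text \<open>The truncated primitive is, modulo null sets, a function in \<open>RR_F I\<close> with a
  single possible jump, at \<open>c\<close>; only that term of the defining sum of
  \<open>Delta\<close> survives.\<close>

lemma Delta_PP_ppol:
  assumes g: "g \<in> RR_dual I" and coef: "\<And>\<phi>. \<phi> \<in> RR_F I \<Longrightarrow> g \<phi> = (\<Sum>t\<in>{t \<in> I. jump t \<phi> \<noteq> 0}. coef t * jump t \<phi>)"
    and \<eta>: "ppol c w \<eta>" "w \<in> I"
  shows "g (PP \<eta>) = coef c * prim \<eta> c"
proof -
  obtain \<Phi> where \<Phi>: "\<Phi> \<in> FF I" "\<Phi> \<in> GG I" "has_uderiv I \<Phi> (\<lambda>t. - \<eta> t)"
    and j: "\<And>t. t \<in> I \<Longrightarrow> t \<noteq> c \<Longrightarrow> jump t \<Phi> = 0" and z: "\<And>t. t \<notin> {c..<w} \<Longrightarrow> \<Phi> t = 0"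
    using ppol_primitive[OF \<eta>] by blast
  have v: "van c w \<Phi>" using z c_I \<eta>(2) by (auto simp: van_def intro!: AE_I2)
  have \<eta>G: "\<eta> \<in> GGinf I" "van c w \<eta>" using ppol_GGinf ppol_van \<eta> c_I by auto
  have "ae_eq I \<Phi> (\<lambda>t. - prim (\<lambda>t. - \<eta> t) t - (\<Sum>s\<in>{c}. jump s \<Phi> * (1 - ind s t)))"
    by (rule ftc_jumps[OF \<Phi>(2) v \<Phi>(3)]) (use c_I j in auto)
  moreover have "prim (\<lambda>t. - \<eta> t) t = - prim \<eta> t" for t using prim_cmult[of "-1" \<eta> t] by simp
  ultimately have "ae_eq I \<Phi> (\<lambda>t. prim \<eta> t - jump c \<Phi> * (1 - ind c t))" by simp
  then have ae: "ae_eq I (PP \<eta>) \<Phi>"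
    unfolding ae_eq_def
  proof eventually_elim
    case (elim t)
    show ?case
    proof (cases "c \<le> t")
      case True then show ?thesis using elim by (simp add: PP_prim ind_def)
    next
      case False then show ?thesis using z[of t] by (simp add: PP_prim ind_def)
    qed
  qed
  have PR: "PP \<eta> \<in> RR I" using RR_PP[OF RR_I[OF \<eta>G]] .
  have "\<Phi> \<in> RR_F I" using RR_cong[OF PR ae] \<Phi>(1) by (simp add: RR_F_def)
  then have "g (PP \<eta>) = (\<Sum>t\<in>{t \<in> I. jump t \<Phi> \<noteq> 0}. coef t * jump t \<Phi>)"
    using coef RR_dual_cong[OF g PR ae] by simp
  also have "\<dots> = (\<Sum>t\<in>{c}. coef t * jump t \<Phi>)"
    using j c_I by (intro sum.mono_neutral_left) auto
  also have "\<dots> = coef c * jump c \<Phi>" by simp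
  also have "jump c \<Phi> = jump c (PP \<eta>)" using jump_cong[OF ae c_I] by simp
  also have "jump c (PP \<eta>) = prim \<eta> c"
    unfolding jump_slim by (simp add: slim_PP[OF GGinf_GG[OF \<eta>G(1)] \<eta>G(2) c_I] slim_ind)
  finally show ?thesis .
qed

lemma Delta_PP_zero:
  assumes g: "g \<in> Delta I" "zb t0 g" and t0: "c < t0" "t0 \<in> I" and \<psi>: "\<psi> \<in> RR I"
  shows "g (PP \<psi>) = 0"
proof -
  obtain coef where gd: "g \<in> RR_dual I"
    and coef: "\<And>\<phi>. \<phi> \<in> RR_F I \<Longrightarrow> g \<phi> = (\<Sum>t\<in>{t \<in> I. jump t \<phi> \<noteq> 0}. coef t * jump t \<phi>)"
    using g(1) unfolding Delta_def by blast
  have c0: "coef c = 0"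
  proof -
    \<comment> \<open>A test function living between \<open>c\<close> and \<open>t0\<close>: its
      truncated primitive ends before \<open>t0\<close>, where \<open>g\<close> vanishes, yet jumps
      at \<open>c\<close> by \<open>y - c\<close>. Hence the coefficient at \<open>c\<close> must be
      0.\<close>
    define y where "y = (c + t0) / 2"
    have y: "c < y" "y < t0" using t0 by (auto simp: y_def)
    have yI: "y \<in> I" using atLeastAtMost_subset_I[OF c_I t0(2)] y by auto
    define \<eta> where "\<eta> = bx c y 1"
    have \<eta>: "ppol c y \<eta>" unfolding \<eta>_def using y by (intro ppol.base) auto
    have \<eta>G: "\<eta> \<in> GGinf I" "van c y \<eta>" using ppol_GGinf ppol_van \<eta> c_I yI by auto
    have "g (PP \<eta>) = 0"
      using zb_van[OF g(2) RR_PP[OF RR_I[OF \<eta>G]] van_PP[OF \<eta>G(2) yI]] y by auto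
    then have "coef c * prim \<eta> c = 0" using Delta_PP_ppol[OF gd coef \<eta> yI] by simp
    moreover have "prim \<eta> c = of_real (y - c)"
    proof -
      have z: "ind y x * \<eta> x = 0" for x using y by (auto simp: \<eta>_def bx_def ind_def)
      have "prim \<eta> y = 0" unfolding prim_def z by simp
      moreover have "norm (prim \<eta> c - prim \<eta> y - 1 * of_real (y - c)) \<le> 0 * (y - c)"
        using y by (intro prim_diff[OF GGinf_GG[OF \<eta>G(1)] \<eta>G(2) c_I yI] AE_I2) (auto simp: \<eta>_def bx_def ind_def)
      ultimately show ?thesis by simp
    qed
    ultimately show ?thesis using y by simp
  qed
  obtain u v where v: "van u v \<psi>" using RR_van[OF \<psi>] .
  obtain w where w: "w \<in> I" "c \<le> w" "v \<le> w" using cut_ex[OF v] by blast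
  \<comment> \<open>The cut of \<open>\<psi>\<close> to \<open>[c, w)\<close> is what piecewise
    polynomials approximate, and it is all that \<open>PP\<close> sees of
    \<open>\<psi>\<close>.\<close>
  define \<psi>0 where "\<psi>0 = (\<lambda>s. (ind c s - ind w s) * \<psi> s)"
  have PP0: "PP \<psi>0 = PP \<psi>"
  proof -
    have "AE t in lebesgue_on I. \<psi>0 t = ind c t * \<psi> t"
      using van_AE[OF v] AE_ne[of w] by eventually_elim (use w in \<open>auto simp: \<psi>0_def ind_def\<close>)
    then have "ae_eq I (\<lambda>t. ind c t * \<psi> t) \<psi>0" by (auto simp: ae_eq_def elim: eventually_mono)
    then have "PP (\<lambda>t. ind c t * \<psi> t) = PP \<psi>0" by (rule PP_cong[OF GG_mult[OF GG_ind RR_GG[OF \<psi>]]])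
    moreover have "PP (\<lambda>t. ind c t * \<psi> t) t = PP \<psi> t" for t
    proof -
      have "ind c x * (ind c x * \<psi> x) = ind c x * \<psi> x" for x by (simp add: ind_def)
      then show ?thesis unfolding PP_def by (simp only:)
    qed
    ultimately show ?thesis by (simp add: fun_eq_iff)
  qed
  obtain k C where kC: "C \<ge> 0" "\<And>\<phi> B. \<phi> \<in> GGinf I \<Longrightarrow> van c w \<phi> \<Longrightarrow> ggb k B \<phi> \<Longrightarrow> norm (g \<phi>) \<le> C * B"
    using RR_dual_dbound[OF gd] c_I w unfolding dbound_def by meson
  define M where "M = max 1 (w - c)"
  have \<psi>0G: "\<psi>0 \<in> GGinf I" "van c w \<psi>0"
  proof -
    show "\<psi>0 \<in> GGinf I" unfolding \<psi>0_def
      using GGinf_mult[OF GGinf_add[OF GGinf_ind GGinf_cmult[OF GGinf_ind, of "-1"]] RR_GGinf[OF \<psi>], of c w] by simp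
    show "van c w \<psi>0" unfolding van_def using c_I w by (auto simp: \<psi>0_def ind_def intro!: AE_I2)
  qed
  have "norm (g (PP \<psi>)) \<le> 0 + r" if r: "r > 0" for r
  proof -
    \<comment> \<open>\<open>M\<close> bounds the amplification by \<open>PP\<close> and
      \<open>C\<close> that by \<open>g\<close>; adding 1 avoids a division by 0 and keeps the total
      error below \<open>r\<close>.\<close>
    define e where "e = r / (C * M + 1)"
    have M: "M \<ge> 1" by (simp add: M_def)
    have CM: "C * M \<ge> 0" using kC(1) M by simp
    then have e: "e > 0" using r by (simp add: e_def add_nonneg_pos)
    obtain \<eta> where \<eta>: "ppol c w \<eta>" "ggb k e (\<lambda>s. \<psi>0 s - \<eta> s)"
      using ppol_dense[OF RR_GGinf[OF \<psi>] c_I w(1,2) e, of k] unfolding \<psi>0_def by blast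
    have \<eta>G: "\<eta> \<in> GGinf I" "van c w \<eta>" using ppol_GGinf ppol_van \<eta> c_I w by auto
    define D where "D = (\<lambda>s. 1 * \<psi>0 s + (-1) * \<eta> s)"
    have D: "ggb k e D" "van c w D" "D \<in> GGinf I"
    proof -
      show "ggb k e D" using \<eta>(2) by (simp add: D_def)
      show "van c w D" unfolding D_def by (intro van_add van_mult \<psi>0G \<eta>G)
      show "D \<in> GGinf I" unfolding D_def by (intro GGinf_add GGinf_cmult \<psi>0G \<eta>G)
    qed
    have PD: "PP D = (\<lambda>t. 1 * PP \<psi>0 t + (-1) * PP \<eta> t)"
      unfolding D_def by (rule PP_lin[OF GGinf_GG[OF \<psi>0G(1)] \<psi>0G(2) GGinf_GG[OF \<eta>G(1)] \<eta>G(2)])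
    have RRs: "PP \<psi>0 \<in> RR I" "PP \<eta> \<in> RR I" "PP D \<in> RR I"
      using RR_PP RR_I \<psi>0G \<eta>G D by blast+
    have "norm (g (PP D)) \<le> C * (M * e)"
      using kC(2)[OF RR_GGinf[OF RRs(3)] van_PP[OF D(2) w(1,2) order_refl] ggb_SucD[OF ggb_PP[OF D(1,2) w(1,2) order_refl]]]
      unfolding M_def .
    moreover have "g (PP D) = g (PP \<psi>)"
      unfolding PD RR_dual_lin[OF gd RRs(1,2)] using Delta_PP_ppol[OF gd coef \<eta>(1) w(1)] c0 by (simp add: PP0)
    moreover have "C * (M * e) \<le> r"
    proof -
      have "C * (M * e) = (C * M) * (r / (C * M + 1))" by (simp add: e_def)
      also have "\<dots> \<le> r" using CM r by (simp add: field_simps)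
      finally show ?thesis .
    qed
    ultimately show ?thesis by simp
  qed
  then have "norm (g (PP \<psi>)) \<le> 0" by (rule field_le_epsilon)
  then show ?thesis by simp
qed

text \<open>Differentiating \<open>PP \<psi>\<close> returns the negative of \<open>\<psi>\<close>
  cut at \<open>c\<close>, and \<open>f\<close> does not notice the cut. Thus
  \<open>f' \<circ> PP\<close> is \<open>f\<close> plus the contribution of the
  \<open>\<Delta>\<close> term, which vanishes.\<close>

lemma derivs_imp_pull:
  assumes f: "f \<in> RR_dual I" "zb t0 f" and f': "f' \<in> derivs I f" "zb t0 f'" and t0: "c < t0" "t0 \<in> I"
  shows "f' \<in> RR_dual I" "f = pull PP f'"
proof -
  obtain g where g: "g \<in> Delta I" "f' = ddt I f + g" using f'(1) unfolding derivs_def by blast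
  have gd: "g \<in> RR_dual I" using g(1) unfolding Delta_def by blast
  have f'e: "f' \<phi> = - pull (uderiv I) f \<phi> + g \<phi>" for \<phi> using g(2) by (simp add: ddt_pull)
  have "(\<lambda>\<phi>. g \<phi> - pull (uderiv I) f \<phi>) \<in> RR_dual I"
    by (intro RR_dual_fun_diff gd pull_RR_dual RR_op_uderiv f)
  moreover have "f' = (\<lambda>\<phi>. g \<phi> - pull (uderiv I) f \<phi>)" using f'e by (simp add: fun_eq_iff)
  ultimately show "f' \<in> RR_dual I" by simp
  \<comment> \<open>Differentiation does not enlarge supports, so the ambiguity \<open>g\<close>
    inherits vanishing before \<open>t0\<close> from \<open>f\<close> and \<open>f'\<close>.\<close>
  have "zb t0 g"
    unfolding zb_def
  proof (intro ballI impI)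
    fix \<phi> assume \<phi>: "\<phi> \<in> RR I" "gsupp I \<phi> \<subseteq> I \<inter> {..<t0}"
    have "open (I \<inter> {..<t0})" "I \<inter> {..<t0} \<noteq> {}" using open_I c_I t0 by (auto intro: open_Int)
    then obtain u v where v: "v \<in> I \<inter> {..<t0}" "van u v \<phi>"
      using RR_van_in[OF \<phi>(1) _ _ Int_lower1 \<phi>(2)] by blast
    then have v: "v < t0" "van u v \<phi>" by auto
    have "van u v (uderiv I \<phi>)" using van_uderiv[OF v(2) RR_GG[OF \<phi>(1)] uderiv_has[OF RR_GGinf[OF \<phi>(1)]]] .
    then have "f (uderiv I \<phi>) = 0" using zb_van[OF f(2) RR_uderiv[OF \<phi>(1)] _ v(1)] by blast
    moreover have "f' \<phi> = 0" using f'(2) \<phi> unfolding zb_def by blast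
    ultimately show "g \<phi> = 0" using f'e[of \<phi>] \<phi>(1) by (simp add: pull_def)
  qed
  then have gP: "g (PP \<psi>) = 0" if "\<psi> \<in> RR I" for \<psi> using Delta_PP_zero[OF g(1) _ t0 that] by blast
  show "f = pull PP f'"
  proof
    fix \<psi>
    show "f \<psi> = pull PP f' \<psi>"
    proof (cases "\<psi> \<in> RR I")
      case False then show ?thesis using RR_dual_outside[OF f(1)] by (simp add: pull_def)
    next
      case True
      obtain u v where v: "van u v \<psi>" using RR_van[OF True] .
      have "ae_eq I (uderiv I (PP \<psi>)) (\<lambda>t. - (ind c t * \<psi> t))"
        using uderiv_ae[OF RR_GGinf[OF RR_PP[OF True]] PP_uderiv(2)[OF RR_GG[OF True] v]] .
      then have "f (uderiv I (PP \<psi>)) = f (\<lambda>t. (-1) * (ind c t * \<psi> t))"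
        using RR_dual_cong[OF f(1) RR_uderiv[OF RR_PP[OF True]]] by simp
      also have "\<dots> = - f \<psi>"
        using RR_dual_cmult[OF f(1) RR_mult[OF GGinf_ind True], of "-1" c] zb_cut[OF f(2,1) t0(1) True] by simp
      finally show ?thesis using True gP[OF True] RR_PP[OF True] by (simp add: pull_def f'e)
    qed
  qed
qed

end

section \<open>The resolvent of the Volterra operator\<close>

context open_interval
begin

text \<open>Integrating the weight \<open>exp (L * (w - x))\<close> from \<open>t\<close> to
  \<open>w\<close> reproduces it up to the factor \<open>1 / L\<close>. A large rate
  \<open>L\<close> thus makes integration a contraction, whatever the length of the
  interval.\<close>

lemma prim_weighted:
  assumes \<psi>: "\<psi> \<in> GG I" "van u w \<psi>" and L: "L > 0" "B \<ge> 0" and t: "t \<in> I"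
    and bd: "AE x in lebesgue_on I. norm (\<psi> x) \<le> B * exp (L * (w - x))"
  shows "norm (prim \<psi> t) \<le> B / L * exp (L * (w - t))"
proof (cases "t \<le> w")
  case False
  then show ?thesis using prim_zero[OF \<psi>(2), of t] L by simp
next
  case True
  have tw: "{t..w} \<subseteq> I" using t \<psi>(2) atLeastAtMost_subset_I by (simp add: van_def)
  define f where "f = (\<lambda>x. B * exp (L * (w - x)))"
  define F where "F = (\<lambda>x. - (B / L) * exp (L * (w - x)))"
  define g where "g = (\<lambda>x. f x * indicator {t..w} x)"
  have hb: "has_bochner_integral lborel g (F w - F t)" unfolding g_def
  proof (rule has_bochner_integral_FTC_Icc_nonneg)
    show "f \<in> borel_measurable borel" unfolding f_def by measurable
    show "DERIV F x :> f x" for x unfolding F_def f_def using L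
      by (auto intro!: derivative_eq_intros)
  qed (use L True in \<open>auto simp: f_def\<close>)
  then have gb: "g \<in> borel_measurable lborel" "integrable lborel g" "integral\<^sup>L lborel g = F w - F t"
    by (auto simp: has_bochner_integral_iff)
  have gI: "(\<lambda>x. indicator I x *\<^sub>R g x) = g" using tw by (auto simp: g_def indicator_def fun_eq_iff)
  have gi: "integrable (lebesgue_on I) g"
    using gb integrable_completion[OF gb(1)] integrable_restrict_space[of I lebesgue g] unfolding gI by simp
  have ge: "integral\<^sup>L (lebesgue_on I) g = F w - F t"
    using gb integral_completion[OF gb(1)] integral_restrict_space[of I lebesgue g] unfolding gI by simp
  have "norm (prim \<psi> t) \<le> integral\<^sup>L (lebesgue_on I) g"
    unfolding prim_def
  proof (intro order_trans[OF integral_norm_bound] integral_mono_AE gi integrable_norm integrable_ind[OF \<psi>])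
    show "AE x in lebesgue_on I. norm (ind t x * \<psi> x) \<le> g x"
      using bd van_AE[OF \<psi>(2)] by eventually_elim (auto simp: g_def f_def ind_def indicator_def)
  qed
  also have "\<dots> = B / L * exp (L * (w - t)) - B / L" unfolding ge by (simp add: F_def)
  also have "\<dots> \<le> B / L * exp (L * (w - t))" using L by simp
  finally show ?thesis .
qed

lemma ggb_sum: "(\<And>i. i \<in> S \<Longrightarrow> ggb k (B i) (f i)) \<Longrightarrow> ggb k (\<Sum>i\<in>S. B i) (\<lambda>t. \<Sum>i\<in>S. f i t)"
  by (induction S rule: infinite_finite_induct) (auto intro: ggb_add ggb_const)

text \<open>By the Weierstrass test convergence is uniform on \<open>I\<close>, so the sum may be
  exchanged with one-sided essential limits.\<close>

lemma GG_series:
  assumes U: "\<And>j. U j \<in> GG I" and D: "\<And>j t. t \<in> I \<Longrightarrow> norm (U j t) \<le> D * (1 / 2) ^ j"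
  shows "(\<lambda>t. \<Sum>j. U j t) \<in> GG I"
proof -
  have sD: "summable (\<lambda>j. D * (1 / 2) ^ j)" by (intro summable_mult summable_geometric) simp
  have ul: "uniform_limit I (\<lambda>n t. \<Sum>j<n. U j t) (\<lambda>t. \<Sum>j. U j t) sequentially"
    by (rule Weierstrass_m_test[OF D sD])
  have m: "(\<lambda>t. \<Sum>j. U j t) \<in> borel_measurable (lebesgue_on I)"
    using GG_measurable[OF U] by (intro borel_measurable_suminf)
  have "norm (\<Sum>j. U j t) \<le> (\<Sum>j. D * (1 / 2) ^ j)" if "t \<in> I" for t
  proof -
    have s: "summable (\<lambda>j. norm (U j t))" by (rule summable_comparison_test'[OF sD]) (use D that in auto)
    show ?thesis using summable_norm[OF s] suminf_le[OF _ s sD] D[OF that] by fastforce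
  qed
  moreover have "\<exists>l. ((\<lambda>t. \<Sum>j. U j t) \<longlongrightarrow> l) (ess b t)" if t: "t \<in> I" for t b
  proof -
    have ev: "eventually (\<lambda>s. s \<in> I) (ess b t)" using AE_imp_eventually_ess[OF open_I t, of "\<lambda>s. s \<in> I"] by (simp add: AE_I)
    have "summable (\<lambda>j. slim b (U j) t)"
    proof (rule summable_comparison_test'[OF sD])
      fix j show "norm (slim b (U j) t) \<le> D * (1 / 2) ^ j"
        by (rule slim_norm_le[OF U t]) (rule eventually_mono[OF ev], rule D)
    qed
    then have lim: "(\<lambda>n. \<Sum>j<n. slim b (U j) t) \<longlonglongrightarrow> (\<Sum>j. slim b (U j) t)" by (rule summable_LIMSEQ)
    have evn: "eventually (\<lambda>n. ((\<lambda>s. \<Sum>j<n. U j s) \<longlongrightarrow> (\<Sum>j<n. slim b (U j) t)) (ess b t)) sequentially"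
      by (intro always_eventually allI tendsto_sum GG_tendsto U t)
    show ?thesis
      using swap_uniform_limit'[OF evn lim ul ev trivial_limit_sequentially] by blast
  qed
  ultimately show ?thesis using m by (intro GG_I[where C = "\<Sum>j. D * (1 / 2) ^ j"] AE_I2) auto
qed

end

section \<open>Powers of the truncated primitive on a fixed interval\<close>

context truncated
begin

text \<open>An interval around \<open>c\<close>; vanishing outside it is preserved by
  \<open>PP\<close>, so iterations need no enlargement of supports.\<close>

definition window :: "real \<Rightarrow> real \<Rightarrow> bool" where
  "window u w \<longleftrightarrow> u \<in> I \<and> w \<in> I \<and> u \<le> c \<and> c \<le> w"

lemma window_van: assumes "window u w" "van u w \<psi>" shows "van u w (PP \<psi>)"
proof -
  have "van c w (PP \<psi>)" using van_PP[OF assms(2)] assms(1) by (simp add: window_def)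
  then show ?thesis using van_mono assms(1) by (simp add: window_def)
qed

lemma PPn_van: "window u w \<Longrightarrow> van u w \<psi> \<Longrightarrow> van u w ((PP ^^ r) \<psi>)"
  by (induction r) (auto intro: window_van)

lemma PPn_GG: "window u w \<Longrightarrow> \<psi> \<in> GG I \<Longrightarrow> van u w \<psi> \<Longrightarrow> (PP ^^ r) \<psi> \<in> GG I"
  by (induction r) (auto intro: PP_uderiv(1) PPn_van)

lemma PPn_ggb: "window u w \<Longrightarrow> ggb k B \<psi> \<Longrightarrow> van u w \<psi> \<Longrightarrow> ggb (k + r) (max 1 (w - c) ^ r * B) ((PP ^^ r) \<psi>)"
proof (induction r)
  case (Suc r)
  have "ggb (Suc (k + r)) (max 1 (w - c) * (max 1 (w - c) ^ r * B)) (PP ((PP ^^ r) \<psi>))"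
    using Suc by (intro ggb_PP[OF Suc.IH PPn_van]) (auto simp: window_def)
  then show ?case by (simp add: mult.assoc del: ggb.simps)
qed simp

lemma PPn_lin:
  assumes w: "window u w" and \<phi>: "\<phi> \<in> GG I" "van u w \<phi>" and \<psi>: "\<psi> \<in> GG I" "van u w \<psi>"
  shows "(PP ^^ r) (\<lambda>t. a * \<phi> t + d * \<psi> t) = (\<lambda>t. a * (PP ^^ r) \<phi> t + d * (PP ^^ r) \<psi> t)"
proof (induction r)
  case (Suc r)
  then show ?case
    using PP_lin[OF PPn_GG[OF w \<phi>] PPn_van[OF w \<phi>(2)] PPn_GG[OF w \<psi>] PPn_van[OF w \<psi>(2)]] by simp
qed simp

lemma PPn_RR: "\<phi> \<in> RR I \<Longrightarrow> (PP ^^ r) \<phi> \<in> RR I"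
  by (induction r) (auto intro: RR_PP)

lemma PP_weighted:
  assumes "\<psi> \<in> GG I" "van u w \<psi>" "L > 0" "B \<ge> 0" "t \<in> I"
    "AE x in lebesgue_on I. norm (\<psi> x) \<le> B * exp (L * (w - x))"
  shows "norm (PP \<psi> t) \<le> B / L * exp (L * (w - t))"
proof -
  have "norm (PP \<psi> t) \<le> norm (prim \<psi> t)" by (simp add: PP_prim ind_def)
  then show ?thesis using prim_weighted[OF assms(1-5)] assms(6) by linarith
qed

text \<open>One application already yields the factor \<open>1 / L\<close>; as
  \<open>L \<ge> 1\<close>, the remaining ones do no harm.\<close>

lemma PPn_weighted:
  assumes w: "window u w" and \<psi>: "\<psi> \<in> GG I" "van u w \<psi>" and L: "L \<ge> 1" "B \<ge> 0"
    and bd: "AE x in lebesgue_on I. norm (\<psi> x) \<le> B * exp (L * (w - x))"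
  shows "0 < r \<Longrightarrow> t \<in> I \<Longrightarrow> norm ((PP ^^ r) \<psi> t) \<le> B / L * exp (L * (w - t))"
proof (induction r arbitrary: t)
  case (Suc r)
  have "AE x in lebesgue_on I. norm ((PP ^^ r) \<psi> x) \<le> B * exp (L * (w - x))"
  proof (cases "r = 0")
    case False
    have "B / L \<le> B" using L by (simp add: divide_le_eq mult_le_cancel_left1)
    then have "B / L * exp (L * (w - x)) \<le> B * exp (L * (w - x))" for x by (intro mult_right_mono) auto
    then show ?thesis using Suc.IH False order_trans by (intro AE_I2) fastforce
  qed (use bd in simp)
  then show ?case using PP_weighted[OF PPn_GG[OF w \<psi>] PPn_van[OF w \<psi>(2)]] L Suc.prems by simp
qed simp

end

section \<open>The Volterra operator: weighted bounds, regularity and uniqueness\<close>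

locale volterra_system = truncated +
  fixes m :: nat and A :: "nat \<Rightarrow> 'n::finite \<Rightarrow> 'n \<Rightarrow> real \<Rightarrow> complex"
  assumes A_GGinf: "k < m \<Longrightarrow> A k i p \<in> GGinf I"
begin

text \<open>The sum runs over the row index \<open>i\<close> of the coefficients: acting on test
  functions, this is the transpose of the action of the matrices on distributions.\<close>

definition KK :: "('n \<Rightarrow> real \<Rightarrow> complex) \<Rightarrow> 'n \<Rightarrow> real \<Rightarrow> complex" where
  "KK \<Phi> p t = (\<Sum>k<m. \<Sum>i\<in>UNIV. (PP ^^ (m - k)) (\<lambda>s. A k i p s * \<Phi> i s) t)"

definition VV :: "real \<Rightarrow> real \<Rightarrow> ('n \<Rightarrow> real \<Rightarrow> complex) \<Rightarrow> bool" where
  "VV u w \<Phi> \<longleftrightarrow> (\<forall>i. \<Phi> i \<in> GG I \<and> van u w (\<Phi> i))"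

lemma A_GG: "k < m \<Longrightarrow> A k i p \<in> GG I"
  using A_GGinf GGinf_GG by blast

lemma VV_D: "VV u w \<Phi> \<Longrightarrow> \<Phi> i \<in> GG I" "VV u w \<Phi> \<Longrightarrow> van u w (\<Phi> i)"
  by (auto simp: VV_def)

lemma VV_coef: "VV u w \<Phi> \<Longrightarrow> k < m \<Longrightarrow> (\<lambda>s. A k i p s * \<Phi> i s) \<in> GG I"
  "VV u w \<Phi> \<Longrightarrow> van u w (\<lambda>s. A k i p s * \<Phi> i s)"
  by (auto simp: VV_def intro: GG_mult A_GG van_mult)

lemma VV_lin: "VV u w \<Phi> \<Longrightarrow> VV u w \<Psi> \<Longrightarrow> VV u w (\<lambda>i t. a * \<Phi> i t + d * \<Psi> i t)"
  by (auto simp: VV_def intro!: GG_add GG_cmult van_add van_mult)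

lemma KK_fun: "KK \<Phi> p = (\<lambda>t. \<Sum>k<m. \<Sum>i\<in>UNIV. (PP ^^ (m - k)) (\<lambda>s. A k i p s * \<Phi> i s) t)"
  by (simp add: fun_eq_iff KK_def)

lemma KK_VV: assumes w: "window u w" and \<Phi>: "VV u w \<Phi>" shows "VV u w (KK \<Phi>)"
  unfolding VV_def KK_fun
  using w by (intro allI conjI GG_sum van_sum PPn_GG[OF w] PPn_van[OF w] VV_coef[OF \<Phi>]) (auto simp: window_def)

lemma KK_lin:
  assumes w: "window u w" and "VV u w \<Phi>" "VV u w \<Psi>"
  shows "KK (\<lambda>i t. a * \<Phi> i t + d * \<Psi> i t) p t = a * KK \<Phi> p t + d * KK \<Psi> p t"
proof -
  have "(PP ^^ (m - k)) (\<lambda>s. A k i p s * (a * \<Phi> i s + d * \<Psi> i s)) t =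
      a * (PP ^^ (m - k)) (\<lambda>s. A k i p s * \<Phi> i s) t + d * (PP ^^ (m - k)) (\<lambda>s. A k i p s * \<Psi> i s) t" if "k < m" for k i
  proof -
    have "(\<lambda>s. A k i p s * (a * \<Phi> i s + d * \<Psi> i s)) = (\<lambda>s. a * (A k i p s * \<Phi> i s) + d * (A k i p s * \<Psi> i s))"
      by (simp add: fun_eq_iff algebra_simps)
    then show ?thesis
      using PPn_lin[OF w VV_coef(1)[OF assms(2) that] VV_coef(2)[OF assms(2)] VV_coef(1)[OF assms(3) that] VV_coef(2)[OF assms(3)]]
      by simp
  qed
  then show ?thesis unfolding KK_def by (simp add: sum.distrib sum_distrib_left)
qed

lemma KK_RR: "(\<And>i. \<Phi> i \<in> RR I) \<Longrightarrow> KK \<Phi> p \<in> RR I"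
  unfolding KK_fun by (intro RR_sum PPn_RR RR_mult A_GGinf) auto

text \<open>Every exponent \<open>m - k\<close> is at least 1, so at least one derivative is gained;
  this drives the regularity argument.\<close>

lemma KK_ggb:
  assumes w: "window u w"
  shows "\<exists>C\<ge>0. \<forall>\<Phi> B p. (\<forall>i. van u w (\<Phi> i) \<and> ggb k B (\<Phi> i)) \<longrightarrow> ggb (Suc k) (C * B) (KK \<Phi> p)"
proof -
  have "\<forall>j i p. \<exists>G. 0 \<le> G \<and> (j < m \<longrightarrow> ggb k G (A j i p))"
    using GGinf_ggb[OF A_GGinf] by (metis order_refl)
  then obtain G where G: "\<And>j i p. 0 \<le> G j i p" "\<And>j i p. j < m \<Longrightarrow> ggb k (G j i p) (A j i p)" by metis
  define M where "M = max 1 (w - c)"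
  have M: "1 \<le> M" by (simp add: M_def)
  define S where "S = (\<lambda>p. \<Sum>j<m. \<Sum>i\<in>UNIV. M ^ (m - j) * (2 ^ k * G j i p))"
  have S: "0 \<le> S p" for p unfolding S_def using G(1) M by (intro sum_nonneg) auto
  have "ggb (Suc k) (sum S UNIV * B) (KK \<Phi> p)" if \<Phi>: "\<forall>i. van u w (\<Phi> i) \<and> ggb k B (\<Phi> i)" for \<Phi> B p
  proof -
    have B: "0 \<le> B" using \<Phi> ggb_nonneg by blast
    have "ggb (Suc k) (M ^ (m - j) * (2 ^ k * (G j i p * B))) ((PP ^^ (m - j)) (\<lambda>s. A j i p s * \<Phi> i s))" if j: "j < m" for j i
    proof (rule ggb_le[OF PPn_ggb[OF w, of k, folded M_def]])
      show "ggb k (2 ^ k * (G j i p * B)) (\<lambda>s. A j i p s * \<Phi> i s)"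
        using ggb_mult[OF G(1) B G(2)[OF j]] \<Phi> by blast
      show "van u w (\<lambda>s. A j i p s * \<Phi> i s)" using \<Phi> van_mult by blast
    qed (use j in simp)
    then have "ggb (Suc k) (\<Sum>j<m. \<Sum>i\<in>UNIV. M ^ (m - j) * (2 ^ k * (G j i p * B))) (KK \<Phi> p)"
      unfolding KK_fun by (intro ggb_sum) auto
    moreover have "(\<Sum>j<m. \<Sum>i\<in>UNIV. M ^ (m - j) * (2 ^ k * (G j i p * B))) = S p * B"
      by (simp add: S_def sum_distrib_right mult.assoc)
    moreover have "S p * B \<le> sum S UNIV * B"
      using S B by (intro mult_right_mono member_le_sum) auto
    ultimately show ?thesis using ggb_mono by metis
  qed
  moreover have "0 \<le> sum S UNIV" using S by (intro sum_nonneg) auto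
  ultimately show ?thesis by blast
qed

lemma KK_weighted:
  "\<exists>L\<ge>1. \<forall>u w \<Phi> B p. window u w \<longrightarrow> VV u w \<Phi> \<longrightarrow> 0 \<le> B \<longrightarrow>
     (\<forall>i. AE x in lebesgue_on I. norm (\<Phi> i x) \<le> B * exp (L * (w - x))) \<longrightarrow>
     (\<forall>t\<in>I. norm (KK \<Phi> p t) \<le> B / 2 * exp (L * (w - t)))"
proof -
  have "\<forall>j i p. \<exists>G. 0 \<le> G \<and> (j < m \<longrightarrow> (AE x in lebesgue_on I. norm (A j i p x) \<le> G))"
    using GG_bounded[OF A_GG] by (metis order_refl)
  then obtain G where G: "\<And>j i p. 0 \<le> G j i p" "\<And>j i p. j < m \<Longrightarrow> AE x in lebesgue_on I. norm (A j i p x) \<le> G j i p" by metis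
  define S where "S = (\<lambda>p. \<Sum>j<m. \<Sum>i\<in>UNIV. G j i p)"
  have S: "0 \<le> S p" for p unfolding S_def using G(1) by (intro sum_nonneg) auto
  \<comment> \<open>With this rate the factor \<open>S p / L\<close> is at most one half for every
    component \<open>p\<close>, and the choice depends on the coefficients only.\<close>
  define L where "L = 2 * sum S UNIV + 1"
  have L: "L \<ge> 1" using S by (auto simp: L_def intro: sum_nonneg)
  have SL: "S p / L \<le> 1 / 2" for p
    using member_le_sum[of p UNIV S] S L by (simp add: L_def field_simps)
  have "norm (KK \<Phi> p t) \<le> B / 2 * exp (L * (w - t))"
    if w: "window u w" and \<Phi>: "VV u w \<Phi>" and B: "0 \<le> B" and t: "t \<in> I"
      and bd: "\<forall>i. AE x in lebesgue_on I. norm (\<Phi> i x) \<le> B * exp (L * (w - x))" for u w \<Phi> B p t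
  proof -
    have "norm ((PP ^^ (m - j)) (\<lambda>s. A j i p s * \<Phi> i s) t) \<le> (G j i p * B) / L * exp (L * (w - t))" if j: "j < m" for j i
    proof (rule PPn_weighted[OF w VV_coef(1)[OF \<Phi> j] VV_coef(2)[OF \<Phi>] L])
      show "AE x in lebesgue_on I. norm (A j i p x * \<Phi> i x) \<le> G j i p * B * exp (L * (w - x))"
        using G(2)[OF j, of i p] bd[rule_format, of i]
        by eventually_elim (use G(1) in \<open>simp add: norm_mult mult.assoc mult_mono\<close>)
    qed (use G(1) B j t in auto)
    then have "norm (KK \<Phi> p t) \<le> (\<Sum>j<m. \<Sum>i\<in>UNIV. (G j i p * B) / L * exp (L * (w - t)))"
      unfolding KK_def by (intro order_trans[OF norm_sum] sum_mono) auto
    also have "\<dots> = (S p / L) * (B * exp (L * (w - t)))"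
      by (simp add: S_def sum_distrib_right sum_divide_distrib mult.assoc)
    also have "\<dots> \<le> 1 / 2 * (B * exp (L * (w - t)))"
      using SL B by (intro mult_right_mono) auto
    finally show ?thesis by simp
  qed
  then show ?thesis using L by blast
qed

text \<open>A single rate at which the Volterra operator contracts by one half, for all windows
  simultaneously.\<close>

definition LL :: real where
  "LL = (SOME L. L \<ge> 1 \<and> (\<forall>u w \<Phi> B p. window u w \<longrightarrow> VV u w \<Phi> \<longrightarrow> 0 \<le> B \<longrightarrow>
     (\<forall>i. AE x in lebesgue_on I. norm (\<Phi> i x) \<le> B * exp (L * (w - x))) \<longrightarrow>
     (\<forall>t\<in>I. norm (KK \<Phi> p t) \<le> B / 2 * exp (L * (w - t)))))"

lemma LL: "LL \<ge> 1" "window u w \<Longrightarrow> VV u w \<Phi> \<Longrightarrow> 0 \<le> B \<Longrightarrow>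
     (\<And>i. AE x in lebesgue_on I. norm (\<Phi> i x) \<le> B * exp (LL * (w - x))) \<Longrightarrow> t \<in> I \<Longrightarrow>
     norm (KK \<Phi> p t) \<le> B / 2 * exp (LL * (w - t))"
  using someI_ex[OF KK_weighted] unfolding LL_def[symmetric] by blast+

lemma weight_of_bound:
  assumes "van u w g" "AE x in lebesgue_on I. norm (g x) \<le> B" "0 \<le> B"
  shows "AE x in lebesgue_on I. norm (g x) \<le> B * exp (LL * (w - x))"
  using van_AE[OF assms(1)] assms(2)
proof eventually_elim
  case (elim x)
  show ?case
  proof (cases "x \<le> w")
    case True
    then have "1 \<le> exp (LL * (w - x))" using LL(1) by simp
    then have "B * 1 \<le> B * exp (LL * (w - x))" using assms(3) by (intro mult_left_mono)
    then show ?thesis using elim by simp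
  next
    case False
    then show ?thesis using elim assms(3) by simp
  qed
qed

text \<open>Insert an estimate for \<open>\<Phi>\<close> into the equation and iterate: the bound
  \<open>D\<close> is replaced by \<open>B + D / 2\<close>, whose fixed point is
  \<open>2 * B\<close>. Any crude bound serves as a start, and its share halves at each
  round.\<close>

lemma volterra_apriori:
  assumes w: "window u w" and \<Phi>: "VV u w \<Phi>" and B: "0 \<le> B"
    and eq: "\<And>p. ae_eq I (\<Phi> p) (\<lambda>t. \<Psi> p t + KK \<Phi> p t)"
    and bd: "\<And>p. AE x in lebesgue_on I. norm (\<Psi> p x) \<le> B * exp (LL * (w - x))"
  shows "AE x in lebesgue_on I. norm (\<Phi> p x) \<le> 2 * B * exp (LL * (w - x))"
proof -
  have "\<forall>p. \<exists>D. 0 \<le> D \<and> (AE x in lebesgue_on I. norm (\<Phi> p x) \<le> D)"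
    using GG_bounded[OF VV_D(1)[OF \<Phi>]] by metis
  then obtain D where D: "\<And>p. 0 \<le> D p" "\<And>p. AE x in lebesgue_on I. norm (\<Phi> p x) \<le> D p" by metis
  define M where "M = sum D UNIV"
  have M: "0 \<le> M" "D p \<le> M" for p using D(1) by (auto simp: M_def intro: sum_nonneg member_le_sum)
  have it: "AE x in lebesgue_on I. norm (\<Phi> p x) \<le> (2 * B + M * (1 / 2) ^ n) * exp (LL * (w - x))" for n p
  proof (induction n arbitrary: p)
    case 0
    have "AE x in lebesgue_on I. norm (\<Phi> p x) \<le> 2 * B + M"
      by (rule eventually_mono[OF D(2)[of p]]) (use M(2)[of p] B in linarith)
    then show ?case using weight_of_bound[OF VV_D(2)[OF \<Phi>]] B M(1) by simp
  next
    case (Suc n)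
    have K: "norm (KK \<Phi> p x) \<le> (2 * B + M * (1 / 2) ^ n) / 2 * exp (LL * (w - x))" if "x \<in> I" for x
      by (rule LL(2)[OF w \<Phi> _ Suc that]) (use B M in simp)
    have "AE x in lebesgue_on I. norm (KK \<Phi> p x) \<le> (2 * B + M * (1 / 2) ^ n) / 2 * exp (LL * (w - x))"
      using K by (intro AE_I2) auto
    then show ?case using eq[of p] bd[of p] unfolding ae_eq_def
    proof eventually_elim
      case (elim x)
      have "norm (\<Phi> p x) \<le> norm (\<Psi> p x) + norm (KK \<Phi> p x)" using elim norm_triangle_ineq by simp
      then show ?case using elim by (simp add: algebra_simps add_divide_distrib)
    qed
  qed
  have "AE x in lebesgue_on I. \<forall>n. norm (\<Phi> p x) \<le> (2 * B + M * (1 / 2) ^ n) * exp (LL * (w - x))"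
    unfolding AE_all_countable using it by blast
  then show ?thesis
  proof (rule eventually_mono)
    fix x assume *: "\<forall>n. norm (\<Phi> p x) \<le> (2 * B + M * (1 / 2) ^ n) * exp (LL * (w - x))"
    have "(\<lambda>n. (2 * B + M * (1 / 2) ^ n) * exp (LL * (w - x))) \<longlonglongrightarrow> (2 * B + M * 0) * exp (LL * (w - x))"
      by (intro tendsto_intros LIMSEQ_realpow_zero) auto
    then have "norm (\<Phi> p x) \<le> (2 * B + M * 0) * exp (LL * (w - x))"
      by (rule LIMSEQ_le_const) (use * in blast)
    then show "norm (\<Phi> p x) \<le> 2 * B * exp (LL * (w - x))" by simp
  qed
qed

lemma volterra_unique:
  assumes w: "window u w" and \<Phi>: "VV u w \<Phi>" "VV u w \<Phi>'"
    and eq: "\<And>p. ae_eq I (\<Phi> p) (\<lambda>t. \<Psi> p t + KK \<Phi> p t)" "\<And>p. ae_eq I (\<Phi>' p) (\<lambda>t. \<Psi> p t + KK \<Phi>' p t)"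
  shows "ae_eq I (\<Phi> p) (\<Phi>' p)"
proof -
  define X where "X = (\<lambda>p t. 1 * \<Phi> p t + (-1) * \<Phi>' p t)"
  have X: "VV u w X" unfolding X_def using VV_lin[OF \<Phi>] .
  have "AE x in lebesgue_on I. norm (X p x) \<le> 2 * 0 * exp (LL * (w - x))"
  proof (rule volterra_apriori[OF w X])
    fix p
    have K: "KK X p t = KK \<Phi> p t - KK \<Phi>' p t" for t unfolding X_def KK_lin[OF w \<Phi>] by simp
    show "ae_eq I (X p) (\<lambda>t. 0 + KK X p t)"
      using eq(1)[of p] eq(2)[of p] unfolding ae_eq_def K by eventually_elim (simp add: X_def)
  qed auto
  then show ?thesis unfolding ae_eq_def by (rule eventually_mono) (simp add: X_def)
qed

text \<open>Bootstrapping: the weighted estimate settles order 0, and since \<open>KK\<close> gains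
  a derivative, the equation lifts a bound on \<open>\<Phi>\<close> from order \<open>k\<close> to
  order \<open>Suc k\<close>.\<close>

lemma volterra_ggb:
  assumes w: "window u w"
  shows "\<exists>C\<ge>0. \<forall>\<Phi> \<Psi> B. VV u w \<Phi> \<longrightarrow> (\<forall>p. ae_eq I (\<Phi> p) (\<lambda>t. \<Psi> p t + KK \<Phi> p t)) \<longrightarrow>
     (\<forall>p. van u w (\<Psi> p) \<and> ggb k B (\<Psi> p)) \<longrightarrow> (\<forall>p. ggb k (C * B) (\<Phi> p))"
proof (induction k)
  case 0
  \<comment> \<open>The exponential is the largest value of the weight on the window, attained at
    its left end.\<close>
  have "ggb 0 (2 * exp (LL * (w - u)) * B) (\<Phi> p)"
    if \<Phi>: "VV u w \<Phi>" "\<forall>p. ae_eq I (\<Phi> p) (\<lambda>t. \<Psi> p t + KK \<Phi> p t)" "\<forall>p. van u w (\<Psi> p) \<and> ggb 0 B (\<Psi> p)" for \<Phi> \<Psi> B p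
  proof -
    have B: "0 \<le> B" using \<Phi>(3) ggb_nonneg by blast
    have "AE x in lebesgue_on I. norm (\<Phi> p x) \<le> 2 * B * exp (LL * (w - x))"
      using weight_of_bound[OF _ ggb_AE B] \<Phi> by (intro volterra_apriori[OF w \<Phi>(1) B, of \<Psi>]) blast+
    then have "AE x in lebesgue_on I. norm (\<Phi> p x) \<le> 2 * exp (LL * (w - u)) * B"
      using van_AE[OF VV_D(2)[OF \<Phi>(1)], of p]
    proof eventually_elim
      case (elim x)
      show ?case
      proof (cases "u \<le> x")
        case True
        then have "2 * B * exp (LL * (w - x)) \<le> 2 * B * exp (LL * (w - u))"
          using LL(1) B by (intro mult_left_mono) auto
        then show ?thesis using elim by (simp add: mult_ac)
      next
        case False then show ?thesis using elim B by simp
      qed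
    qed
    then show ?thesis using VV_D(1)[OF \<Phi>(1)] by simp
  qed
  then show ?case by (intro exI[of _ "2 * exp (LL * (w - u))"]) auto
next
  case (Suc k)
  obtain C where C: "C \<ge> 0" "\<And>\<Phi> \<Psi> B p. VV u w \<Phi> \<Longrightarrow> (\<forall>p. ae_eq I (\<Phi> p) (\<lambda>t. \<Psi> p t + KK \<Phi> p t)) \<Longrightarrow>
     (\<forall>p. van u w (\<Psi> p) \<and> ggb k B (\<Psi> p)) \<Longrightarrow> ggb k (C * B) (\<Phi> p)" using Suc by blast
  obtain D where D: "D \<ge> 0" "\<And>\<Phi> B p. (\<forall>i. van u w (\<Phi> i) \<and> ggb k B (\<Phi> i)) \<Longrightarrow> ggb (Suc k) (D * B) (KK \<Phi> p)"
    using KK_ggb[OF w, of k] by blast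
  have "ggb (Suc k) ((1 + D * C) * B) (\<Phi> p)"
    if \<Phi>: "VV u w \<Phi>" "\<forall>p. ae_eq I (\<Phi> p) (\<lambda>t. \<Psi> p t + KK \<Phi> p t)" "\<forall>p. van u w (\<Psi> p) \<and> ggb (Suc k) B (\<Psi> p)" for \<Phi> \<Psi> B p
  proof -
    have "\<forall>p. van u w (\<Psi> p) \<and> ggb k B (\<Psi> p)" using \<Phi>(3) ggb_SucD by blast
    then have "\<forall>p. van u w (\<Phi> p) \<and> ggb k (C * B) (\<Phi> p)" using C(2)[OF \<Phi>(1,2)] VV_D(2)[OF \<Phi>(1)] by blast
    then have "ggb (Suc k) (D * (C * B)) (KK \<Phi> p)" by (rule D(2))
    then have "ggb (Suc k) (B + D * (C * B)) (\<lambda>t. \<Psi> p t + KK \<Phi> p t)" using \<Phi>(3) by (intro ggb_add) blast+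
    then have "ggb (Suc k) (B + D * (C * B)) (\<Phi> p)" using ggb_cong ae_eq_sym \<Phi>(2) by blast
    then show ?thesis by (simp add: algebra_simps del: ggb.simps)
  qed
  then show ?case using C(1) D(1) by (intro exI[of _ "1 + D * C"]) (simp del: ggb.simps)
qed

end

section \<open>Neumann series, the resolvent and its transpose\<close>

context volterra_system
begin

lemma KK_before: "t < c \<Longrightarrow> KK \<Phi> p t = 0"
proof -
  assume t: "t < c"
  have "(PP ^^ (m - k)) \<psi> t = 0" if k: "k < m" for k \<psi>
  proof -
    obtain r where "m - k = Suc r" using k by (metis Suc_diff_Suc)
    then show ?thesis using t by (simp add: PP_def ind_def)
  qed
  then show ?thesis by (simp add: KK_def)
qed

lemma VV_zero: "window u w \<Longrightarrow> VV u w (\<lambda>_ _. 0)"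
  by (simp add: VV_def van_def window_def)

lemma VV_sum: assumes "window u w" "\<And>j. j \<in> S \<Longrightarrow> VV u w (f j)" shows "VV u w (\<lambda>i t. \<Sum>j\<in>S. f j i t)"
  using assms unfolding VV_def window_def by (auto intro!: GG_sum van_sum)

lemma KK_sum:
  assumes w: "window u w" and S: "finite S" "\<And>j. j \<in> S \<Longrightarrow> VV u w (f j)"
  shows "KK (\<lambda>i t. \<Sum>j\<in>S. f j i t) p t = (\<Sum>j\<in>S. KK (f j) p t)"
  using S
proof (induction S rule: finite_induct)
  case empty
  have "KK (\<lambda>_ _. 0) p t = 0" using KK_lin[OF w VV_zero[OF w] VV_zero[OF w], of 0 0 p t] by simp
  then show ?case by simp
next
  case (insert x S)
  have "KK (\<lambda>i t. 1 * f x i t + 1 * (\<Sum>j\<in>S. f j i t)) p t = 1 * KK (f x) p t + 1 * KK (\<lambda>i t. \<Sum>j\<in>S. f j i t) p t"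
    using insert by (intro KK_lin[OF w] VV_sum[OF w]) auto
  then show ?case using insert by simp
qed

text \<open>The Neumann series converges geometrically in the weighted norm; its sum has one-sided
  limits by uniform convergence, and the higher derivatives come afterwards from
  \<open>volterra_ggb\<close>.\<close>

lemma volterra_exists:
  assumes w: "window u w" and \<Psi>: "\<And>p. \<Psi> p \<in> GGinf I" "\<And>p. van u w (\<Psi> p)"
  shows "\<exists>\<Phi>. VV u w \<Phi> \<and> (\<forall>p. \<Phi> p \<in> GGinf I) \<and> (\<forall>p. ae_eq I (\<Phi> p) (\<lambda>t. \<Psi> p t + KK \<Phi> p t))"
proof -
  have \<Psi>V: "VV u w \<Psi>" using \<Psi> GGinf_GG by (auto simp: VV_def)
  have "\<forall>p. \<exists>D. 0 \<le> D \<and> (AE x in lebesgue_on I. norm (\<Psi> p x) \<le> D)"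
    using GG_bounded[OF VV_D(1)[OF \<Psi>V]] by metis
  then obtain D where D: "\<And>p. 0 \<le> D p" "\<And>p. AE x in lebesgue_on I. norm (\<Psi> p x) \<le> D p" by metis
  define B where "B = sum D UNIV"
  have B: "0 \<le> B" using D(1) by (auto simp: B_def intro: sum_nonneg)
  have B\<Psi>: "AE x in lebesgue_on I. norm (\<Psi> p x) \<le> B * exp (LL * (w - x))" for p
  proof (rule weight_of_bound[OF \<Psi>(2) _ B])
    have "D p \<le> B" using D(1) by (auto simp: B_def intro: member_le_sum)
    then show "AE x in lebesgue_on I. norm (\<Psi> p x) \<le> B" using D(2)[of p] by (auto elim!: eventually_mono)
  qed
  \<comment> \<open>The term \<open>\<Psi>\<close> is left out: from \<open>KK \<Psi>\<close> on,
    the estimates hold at every point of \<open>I\<close>, as \<open>GG_series\<close> requires,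
    while \<open>\<Psi>\<close> is bounded only almost everywhere.\<close>
  define U where "U = (\<lambda>n. (KK ^^ Suc n) \<Psi>)"
  have U0: "U 0 = KK \<Psi>" and US: "U (Suc n) = KK (U n)" for n by (simp_all add: U_def)
  have UV: "VV u w (U n)" for n
    by (induction n) (auto simp: U0 US intro: KK_VV[OF w] \<Psi>V)
  have Ub: "norm (U n p t) \<le> B * (1 / 2) ^ Suc n * exp (LL * (w - t))" if "t \<in> I" for n p t
    using that
  proof (induction n arbitrary: p t)
    case 0
    then show ?case using LL(2)[OF w \<Psi>V B B\<Psi> 0, of p] by (simp add: U0)
  next
    case (Suc n)
    have "AE x in lebesgue_on I. norm (U n i x) \<le> B * (1 / 2) ^ Suc n * exp (LL * (w - x))" for i
      using Suc.IH by (intro AE_I2) auto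
    from LL(2)[OF w UV _ this Suc.prems, of p] B show ?case by (simp add: US)
  qed
  \<comment> \<open>All terms vanish to the left of \<open>c\<close>, so the weight at
    \<open>c\<close> is the largest that matters.\<close>
  define E where "E = B * exp (LL * (w - c))"
  have UE: "norm (U n p t) \<le> E * (1 / 2) ^ n" if t: "t \<in> I" for n p t
  proof (cases "t < c")
    case True
    then have "U n p t = 0" by (cases n) (auto simp: U0 US KK_before)
    then show ?thesis using B by (simp add: E_def)
  next
    case False
    have "norm (U n p t) \<le> B * (1 / 2) ^ Suc n * exp (LL * (w - t))" by (rule Ub[OF t])
    also have "\<dots> \<le> B * (1 / 2) ^ n * exp (LL * (w - c))"
      using False B LL(1) by (intro mult_mono) auto
    finally show ?thesis by (simp add: E_def mult_ac)
  qed
  define V where "V = (\<lambda>p t. \<Sum>n. U n p t)"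
  have sm: "summable (\<lambda>n. U n p t)" if "t \<in> I" for p t
    by (rule summable_comparison_test'[of "\<lambda>n. E * (1 / 2) ^ n"]) (auto intro: summable_mult summable_geometric UE that)
  have VVV: "VV u w V"
    unfolding VV_def
  proof
    fix p
    have "AE t in lebesgue_on I. \<forall>n. t \<notin> {u..w} \<longrightarrow> U n p t = 0"
      unfolding AE_all_countable using van_AE[OF VV_D(2)[OF UV]] by blast
    then have "AE t in lebesgue_on I. t \<notin> {u..w} \<longrightarrow> V p t = 0"
      by (rule eventually_mono) (auto simp: V_def)
    then have "van u w (V p)" using w by (simp add: van_def window_def)
    moreover have "V p \<in> GG I" unfolding V_def by (rule GG_series[OF VV_D(1)[OF UV] UE])
    ultimately show "V p \<in> GG I \<and> van u w (V p)" by blast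
  qed
  have KV: "KK V p t = V p t - KK \<Psi> p t" if t: "t \<in> I" for p t
  proof -
    \<comment> \<open>Linearity carries \<open>KK\<close> through finite sums only. The tails are
      small in the weighted norm, hence so are their images, and letting \<open>N\<close> grow
      carries \<open>KK\<close> through the series.\<close>
    define T where "T = (\<lambda>N i x. 1 * V i x + (-1) * (\<Sum>j<N. U j i x))"
    have TV: "VV u w (T N)" for N unfolding T_def by (intro VV_lin VVV VV_sum[OF w] UV)
    have Tb: "norm (T N i x) \<le> B * (1 / 2) ^ N * exp (LL * (w - x))" if x: "x \<in> I" for N i x
    proof -
      have "T N i x = (\<Sum>n. U (n + N) i x)"
        using suminf_split_initial_segment[OF sm[OF x], of i N] by (simp add: T_def V_def)
      also have "norm \<dots> \<le> (\<Sum>n. (B * exp (LL * (w - x)) * (1 / 2) ^ N * (1 / 2)) * (1 / 2) ^ n)"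
      proof -
        have b: "norm (U (n + N) i x) \<le> (B * exp (LL * (w - x)) * (1 / 2) ^ N * (1 / 2)) * (1 / 2) ^ n" for n
          using Ub[OF x, of "n + N" i] by (simp add: power_add mult_ac)
        have s: "summable (\<lambda>n. (B * exp (LL * (w - x)) * (1 / 2) ^ N * (1 / 2)) * (1 / 2) ^ n)"
          by (intro summable_mult summable_geometric) simp
        have sn: "summable (\<lambda>n. norm (U (n + N) i x))"
          by (rule summable_comparison_test'[OF s]) (use b in auto)
        show ?thesis using summable_norm[OF sn] suminf_le[OF b sn s] by linarith
      qed
      also have "\<dots> = (B * exp (LL * (w - x)) * (1 / 2) ^ N * (1 / 2)) * (\<Sum>n. (1 / 2) ^ n)"
        by (rule suminf_mult) (simp add: summable_geometric)
      also have "\<dots> = B * (1 / 2) ^ N * exp (LL * (w - x))" by (simp add: suminf_geometric)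
      finally show ?thesis .
    qed
    have KT: "KK (T N) p t = KK V p t - (\<Sum>j<N. U (Suc j) p t)" for N
      unfolding T_def KK_lin[OF w VVV VV_sum[OF w UV]] KK_sum[OF w finite_lessThan UV] by (simp add: US)
    have bd: "norm (KK V p t - (\<Sum>j<N. U (Suc j) p t)) \<le> B * (1 / 2) ^ N / 2 * exp (LL * (w - t))" for N
      unfolding KT[symmetric] using Tb B by (intro LL(2)[OF w TV _ _ t] AE_I2) auto
    have "(\<lambda>N. B * (1 / 2) ^ N / 2 * exp (LL * (w - t))) \<longlonglongrightarrow> B * 0 / 2 * exp (LL * (w - t))"
      by (intro tendsto_intros LIMSEQ_realpow_zero) auto
    then have "(\<lambda>N. KK V p t - (\<Sum>j<N. U (Suc j) p t)) \<longlonglongrightarrow> 0"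
      by (intro Lim_null_comparison[OF always_eventually[OF allI[OF bd]]]) simp
    moreover have "(\<lambda>N. KK V p t - (\<Sum>j<N. U (Suc j) p t)) \<longlonglongrightarrow> KK V p t - (V p t - U 0 p t)"
    proof -
      have "(\<lambda>j. U (Suc j) p t) sums (V p t - U 0 p t)"
        using summable_sums[OF sm[OF t, of p]] sums_Suc_iff[of "\<lambda>j. U j p t" "V p t - U 0 p t"] by (simp add: V_def)
      then show ?thesis unfolding sums_def by (intro tendsto_intros)
    qed
    ultimately have "KK V p t - (V p t - U 0 p t) = 0" using LIMSEQ_unique by blast
    then show ?thesis by (simp add: U0 algebra_simps)
  qed
  define \<Phi> where "\<Phi> = (\<lambda>p t. 1 * \<Psi> p t + 1 * V p t)"
  have \<Phi>V: "VV u w \<Phi>" unfolding \<Phi>_def by (rule VV_lin[OF \<Psi>V VVV])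
  have eq: "ae_eq I (\<Phi> p) (\<lambda>t. \<Psi> p t + KK \<Phi> p t)" for p
  proof (rule ae_eqI)
    fix t assume t: "t \<in> I"
    have "KK \<Phi> p t = KK \<Psi> p t + KK V p t" unfolding \<Phi>_def KK_lin[OF w \<Psi>V VVV] by simp
    then show "\<Phi> p t = \<Psi> p t + KK \<Phi> p t" using KV[OF t, of p] by (simp add: \<Phi>_def)
  qed
  have "\<exists>C. ggb k C (\<Phi> p)" for k p
  proof -
    have "\<forall>p. \<exists>C. 0 \<le> C \<and> ggb k C (\<Psi> p)" using GGinf_ggb[OF \<Psi>(1)] by metis
    then obtain C where C: "\<And>p. 0 \<le> C p" "\<And>p. ggb k (C p) (\<Psi> p)" by metis
    have "C p \<le> sum C UNIV" for p using C(1) by (intro member_le_sum) auto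
    then have "\<forall>p. van u w (\<Psi> p) \<and> ggb k (sum C UNIV) (\<Psi> p)" using \<Psi>(2) ggb_mono[OF C(2)] by blast
    then show ?thesis using volterra_ggb[OF w, of k] \<Phi>V eq by blast
  qed
  then have "\<Phi> p \<in> GGinf I" for p by (simp add: GGinf_iff)
  then show ?thesis using \<Phi>V eq by blast
qed

lemma window_set: "finite F \<Longrightarrow> F \<subseteq> RR I \<Longrightarrow> \<exists>u w. window u w \<and> (\<forall>f\<in>F. van u w f)"
proof (induction F rule: finite_induct)
  case empty
  show ?case using c_I by (auto simp: window_def)
next
  case (insert f F)
  obtain u w where uw: "window u w" "\<forall>f\<in>F. van u w f" using insert by auto
  obtain x y where xy: "van x y f" using RR_van insert.prems by blast
  have i: "min u x \<in> I" "max w y \<in> I" using uw(1) xy by (auto simp: window_def van_def min_def max_def)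
  have "window (min u x) (max w y)" using uw(1) i by (auto simp: window_def)
  moreover have "van (min u x) (max w y) g" if "g \<in> insert f F" for g
    using that van_mono[OF xy i] van_mono[OF uw(2)[rule_format] i, of g] by auto
  ultimately show ?case by blast
qed

text \<open>The inverse of \<open>1 - KK\<close> on vectors of test functions, as a choice among
  solutions that agree modulo null sets.\<close>

definition res :: "('n \<Rightarrow> real \<Rightarrow> complex) \<Rightarrow> 'n \<Rightarrow> real \<Rightarrow> complex" where
  "res \<Psi> = (SOME \<Phi>. (\<forall>p. \<Phi> p \<in> RR I) \<and> (\<forall>p. ae_eq I (\<Phi> p) (\<lambda>t. \<Psi> p t + KK \<Phi> p t)))"

lemma res:
  assumes \<Psi>: "\<And>p. \<Psi> p \<in> RR I"
  shows "res \<Psi> p \<in> RR I" "ae_eq I (res \<Psi> p) (\<lambda>t. \<Psi> p t + KK (res \<Psi>) p t)"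
proof -
  obtain u w where w: "window u w" "\<And>p. van u w (\<Psi> p)" using window_set[of "range \<Psi>"] \<Psi> by auto
  obtain \<Phi> where \<Phi>: "VV u w \<Phi>" "\<forall>p. \<Phi> p \<in> GGinf I" "\<forall>p. ae_eq I (\<Phi> p) (\<lambda>t. \<Psi> p t + KK \<Phi> p t)"
    using volterra_exists[of u w \<Psi>, OF w(1) RR_GGinf[OF \<Psi>] w(2)] by blast
  have "\<forall>p. \<Phi> p \<in> RR I" using \<Phi> RR_I VV_D(2) by blast
  then have ex: "\<exists>\<Phi>. (\<forall>p. \<Phi> p \<in> RR I) \<and> (\<forall>p. ae_eq I (\<Phi> p) (\<lambda>t. \<Psi> p t + KK \<Phi> p t))" using \<Phi>(3) by blast
  show "res \<Psi> p \<in> RR I" "ae_eq I (res \<Psi> p) (\<lambda>t. \<Psi> p t + KK (res \<Psi>) p t)"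
    using someI_ex[OF ex] unfolding res_def[symmetric] by blast+
qed

lemma res_unique:
  assumes \<Psi>: "\<And>p. \<Psi> p \<in> RR I" and \<Phi>: "\<And>p. \<Phi> p \<in> RR I" "\<And>p. ae_eq I (\<Phi> p) (\<lambda>t. \<Psi> p t + KK \<Phi> p t)"
  shows "ae_eq I (\<Phi> p) (res \<Psi> p)"
proof -
  have "finite (range \<Phi> \<union> range (res \<Psi>))" "range \<Phi> \<union> range (res \<Psi>) \<subseteq> RR I" using \<Phi> res(1)[of \<Psi>, OF \<Psi>] by auto
  then obtain u w where w: "window u w" "\<forall>f\<in>range \<Phi> \<union> range (res \<Psi>). van u w f" using window_set by meson
  have "VV u w \<Phi>" "VV u w (res \<Psi>)" using w(2) RR_GG \<Phi>(1) res(1)[of \<Psi>, OF \<Psi>] unfolding VV_def by auto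
  then show ?thesis by (rule volterra_unique[OF w(1) _ _ \<Phi>(2) res(2)[of \<Psi>, OF \<Psi>]])
qed

definition single :: "'n \<Rightarrow> (real \<Rightarrow> complex) \<Rightarrow> 'n \<Rightarrow> real \<Rightarrow> complex" where
  "single i \<psi> = (\<lambda>j. if j = i then \<psi> else (\<lambda>_. 0))"

lemma single_RR: "\<psi> \<in> RR I \<Longrightarrow> single i \<psi> p \<in> RR I"
  by (simp add: single_def)

text \<open>The choice behind \<open>res\<close> says nothing about supports; uniqueness ties it to
  the solution built on the given window, from which support and bounds are inherited.\<close>

lemma res_window:
  assumes w: "window x w" and \<phi>: "\<phi> \<in> GGinf I" "van x w \<phi>"
  shows "\<exists>\<Phi>. VV x w \<Phi> \<and> (\<forall>p. ae_eq I (\<Phi> p) (\<lambda>t. single i \<phi> p t + KK \<Phi> p t)) \<and>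
    (\<forall>p. ae_eq I (\<Phi> p) (res (single i \<phi>) p))"
proof -
  have s: "single i \<phi> q \<in> GGinf I" "van x w (single i \<phi> q)" for q
    using \<phi> w by (auto simp: single_def van_def window_def)
  obtain \<Phi> where \<Phi>: "VV x w \<Phi>" "\<forall>p. \<Phi> p \<in> GGinf I" "\<forall>p. ae_eq I (\<Phi> p) (\<lambda>t. single i \<phi> p t + KK \<Phi> p t)"
    using volterra_exists[of x w "single i \<phi>", OF w s] by blast
  have "\<Phi> q \<in> RR I" for q using RR_I VV_D(2)[OF \<Phi>(1)] \<Phi>(2) by blast
  then have "ae_eq I (\<Phi> p) (res (single i \<phi>) p)" for p
    using res_unique[of "single i \<phi>" \<Phi> p, OF single_RR[OF RR_I[OF \<phi>]]] \<Phi>(3) by blast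
  then show ?thesis using \<Phi> by blast
qed

text \<open>Linearity follows from uniqueness of the Volterra solution, boundedness from
  \<open>volterra_ggb\<close>.\<close>

lemma RR_op_res: "RR_op (\<lambda>\<psi>. res (single i \<psi>) p)"
  unfolding RR_op_def
proof (intro conjI ballI allI impI)
  fix \<phi> assume "\<phi> \<in> RR I" then show "res (single i \<phi>) p \<in> RR I" using res(1) single_RR by blast
next
  fix \<phi> \<psi> a d assume \<phi>: "\<phi> \<in> RR I" and \<psi>: "\<psi> \<in> RR I"
  let ?f = "res (single i \<phi>)" and ?g = "res (single i \<psi>)"
  define \<Phi> where "\<Phi> = (\<lambda>p t. a * ?f p t + d * ?g p t)"
  note f = res[of "single i \<phi>", OF single_RR[OF \<phi>]] and g = res[of "single i \<psi>", OF single_RR[OF \<psi>]]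
  have "finite (range ?f \<union> range ?g)" "range ?f \<union> range ?g \<subseteq> RR I" using f g by auto
  then obtain u w where w: "window u w" "\<forall>h\<in>range ?f \<union> range ?g. van u w h" using window_set by meson
  have V: "VV u w ?f" "VV u w ?g" using w(2) RR_GG f(1) g(1) unfolding VV_def by auto
  have "ae_eq I (\<Phi> p) (res (single i (\<lambda>t. a * \<phi> t + d * \<psi> t)) p)"
  proof (rule res_unique)
    show "single i (\<lambda>t. a * \<phi> t + d * \<psi> t) q \<in> RR I" for q by (rule single_RR[OF RR_lin[OF \<phi> \<psi>]])
    show "\<Phi> q \<in> RR I" for q unfolding \<Phi>_def by (rule RR_lin[OF f(1) g(1)])
    fix q
    have K: "KK \<Phi> q t = a * KK ?f q t + d * KK ?g q t" for t unfolding \<Phi>_def by (rule KK_lin[OF w(1) V])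
    show "ae_eq I (\<Phi> q) (\<lambda>t. single i (\<lambda>t. a * \<phi> t + d * \<psi> t) q t + KK \<Phi> q t)"
      using f(2)[of q] g(2)[of q] unfolding ae_eq_def K
      by eventually_elim (simp add: \<Phi>_def single_def algebra_simps)
  qed
  then show "ae_eq I (res (single i (\<lambda>t. a * \<phi> t + d * \<psi> t)) p) (\<lambda>t. a * ?f p t + d * ?g p t)"
    unfolding \<Phi>_def by (rule ae_eq_sym)
next
  fix u v assume uv: "u \<in> I" "v \<in> I" "u \<le> v"
  define x where "x = min u c"
  define w where "w = max v c"
  have i: "x \<in> I" "w \<in> I" "x \<le> w" and win: "window x w"
    using uv c_I by (auto simp: x_def w_def min_def max_def window_def)
  have "\<exists>C\<ge>0. \<forall>\<phi> B. \<phi> \<in> GGinf I \<longrightarrow> van u v \<phi> \<longrightarrow> ggb k B \<phi> \<longrightarrow>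
      van x w (res (single i \<phi>) p) \<and> ggb k (C * B) (res (single i \<phi>) p)" for k
  proof -
    obtain C where C: "C \<ge> 0" "\<And>\<Phi> \<Psi> B. VV x w \<Phi> \<Longrightarrow> (\<forall>p. ae_eq I (\<Phi> p) (\<lambda>t. \<Psi> p t + KK \<Phi> p t)) \<Longrightarrow>
      (\<forall>p. van x w (\<Psi> p) \<and> ggb k B (\<Psi> p)) \<Longrightarrow> (\<forall>p. ggb k (C * B) (\<Phi> p))" using volterra_ggb[OF win, of k] by blast
    have "van x w (res (single i \<phi>) p) \<and> ggb k (C * B) (res (single i \<phi>) p)"
      if \<phi>: "\<phi> \<in> GGinf I" "van u v \<phi>" "ggb k B \<phi>" for \<phi> B
    proof -
      have v: "van x w \<phi>" using van_mono[OF \<phi>(2) i(1,2)] by (simp add: x_def w_def)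
      have s: "\<forall>q. van x w (single i \<phi> q) \<and> ggb k B (single i \<phi> q)"
        using \<phi> v i ggb_const[of 0 B k] ggb_nonneg[OF \<phi>(3)] by (auto simp: single_def van_def)
      obtain \<Phi> where \<Phi>: "VV x w \<Phi>" "\<forall>p. ae_eq I (\<Phi> p) (\<lambda>t. single i \<phi> p t + KK \<Phi> p t)"
        "\<forall>p. ae_eq I (\<Phi> p) (res (single i \<phi>) p)"
        using res_window[OF win \<phi>(1) v] by blast
      have "ggb k (C * B) (\<Phi> p)" using C(2)[OF \<Phi>(1,2) s] by blast
      moreover have "ae_eq I (\<Phi> p) (res (single i \<phi>) p)" using \<Phi>(3) by blast
      ultimately show ?thesis using ggb_cong van_cong VV_D(2)[OF \<Phi>(1)] by blast
    qed
    then show ?thesis using C(1) by blast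
  qed
  then have "op_bd (\<lambda>\<psi>. res (single i \<psi>) p) u v x w" unfolding op_bd_def by blast
  then show "\<exists>u'\<in>I. \<exists>v'\<in>I. u' \<le> v' \<and> op_bd (\<lambda>\<psi>. res (single i \<psi>) p) u v u' v'" using i by blast
qed

text \<open>The transposed equation: a row of functionals satisfies
  \<open>W \<circ> (1 - KK) = H\<close> exactly when \<open>W = H \<circ> res\<close>. One direction
  evaluates at \<open>res (single i \<psi>)\<close>; the other uses that \<open>res\<close> also
  undoes \<open>1 - KK\<close> from the other side.\<close>

lemma volterra_dual:
  assumes H: "\<And>p. H p \<in> RR_dual I" and W: "\<And>p. W p \<in> RR_dual I"
  shows "(\<forall>i. \<forall>\<phi>\<in>RR I. W i \<phi> - (\<Sum>k<m. \<Sum>p\<in>UNIV. W p ((PP ^^ (m - k)) (\<lambda>s. A k i p s * \<phi> s))) = H i \<phi>)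
     \<longleftrightarrow> (\<forall>i. \<forall>\<psi>\<in>RR I. W i \<psi> = (\<Sum>p\<in>UNIV. H p (res (single i \<psi>) p)))" (is "?L \<longleftrightarrow> ?R")
proof -
  have KKW: "(\<Sum>p\<in>UNIV. W p (KK \<Phi> p)) = (\<Sum>i\<in>UNIV. \<Sum>k<m. \<Sum>p\<in>UNIV. W p ((PP ^^ (m - k)) (\<lambda>s. A k i p s * \<Phi> i s)))"
    if \<Phi>: "\<And>i. \<Phi> i \<in> RR I" for \<Phi>
  proof -
    have rr: "(PP ^^ (m - k)) (\<lambda>s. A k i p s * \<Phi> i s) \<in> RR I" if "k < m" for k i p
      by (intro PPn_RR RR_mult A_GGinf \<Phi> that)
    have "W p (KK \<Phi> p) = (\<Sum>k<m. \<Sum>i\<in>UNIV. W p ((PP ^^ (m - k)) (\<lambda>s. A k i p s * \<Phi> i s)))" for p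
    proof -
      have "W p (KK \<Phi> p) = (\<Sum>k<m. W p (\<lambda>t. \<Sum>i\<in>UNIV. (PP ^^ (m - k)) (\<lambda>s. A k i p s * \<Phi> i s) t))"
        unfolding KK_fun by (rule RR_dual_sum[OF W]) (auto intro: RR_sum rr)
      also have "\<dots> = (\<Sum>k<m. \<Sum>i\<in>UNIV. W p ((PP ^^ (m - k)) (\<lambda>s. A k i p s * \<Phi> i s)))"
        by (intro sum.cong refl RR_dual_sum[OF W]) (auto intro: rr)
      finally show ?thesis .
    qed
    then have "(\<Sum>p\<in>UNIV. W p (KK \<Phi> p)) = (\<Sum>p\<in>UNIV. \<Sum>k<m. \<Sum>i\<in>UNIV. W p ((PP ^^ (m - k)) (\<lambda>s. A k i p s * \<Phi> i s)))" by simp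
    also have "\<dots> = (\<Sum>k<m. \<Sum>i\<in>UNIV. \<Sum>p\<in>UNIV. W p ((PP ^^ (m - k)) (\<lambda>s. A k i p s * \<Phi> i s)))"
      by (subst sum.swap) (intro sum.cong refl sum.swap)
    also have "\<dots> = (\<Sum>i\<in>UNIV. \<Sum>k<m. \<Sum>p\<in>UNIV. W p ((PP ^^ (m - k)) (\<lambda>s. A k i p s * \<Phi> i s)))"
      by (rule sum.swap)
    finally show ?thesis .
  qed
  have sg: "(\<Sum>p\<in>UNIV. G p (single i \<psi> p)) = G i \<psi>" if "\<And>p. G p \<in> RR_dual I" for G i \<psi>
  proof -
    have "(\<Sum>p\<in>UNIV. G p (single i \<psi> p)) = (\<Sum>p\<in>UNIV. if p = i then G i \<psi> else 0)"
      using RR_dual_zero[OF that] by (intro sum.cong) (auto simp: single_def)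
    then show ?thesis by simp
  qed
  show ?thesis
  proof
    assume L: ?L
    show ?R
    proof (intro allI ballI)
      fix i \<psi> assume \<psi>: "\<psi> \<in> RR I"
      let ?f = "res (single i \<psi>)"
      note f = res[of "single i \<psi>", OF single_RR[OF \<psi>]]
      have "(\<Sum>p\<in>UNIV. H p (?f p)) = (\<Sum>j\<in>UNIV. W j (?f j)) - (\<Sum>p\<in>UNIV. W p (KK ?f p))"
        unfolding KKW[of ?f, OF f(1)] sum_subtractf[symmetric] using L f(1) by (intro sum.cong) auto
      also have "\<dots> = (\<Sum>p\<in>UNIV. W p (single i \<psi> p))"
        unfolding sum_subtractf[symmetric]
      proof (rule sum.cong[OF refl])
        fix p
        have KR: "KK ?f p \<in> RR I" using KK_RR f(1) by blast
        have "W p (?f p) = W p (\<lambda>t. single i \<psi> p t + KK ?f p t)" by (rule RR_dual_cong[OF W f])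
        also have "\<dots> = W p (single i \<psi> p) + W p (KK ?f p)" by (rule RR_dual_add[OF W single_RR[OF \<psi>] KR])
        finally show "W p (?f p) - W p (KK ?f p) = W p (single i \<psi> p)" by simp
      qed
      finally show "W i \<psi> = (\<Sum>p\<in>UNIV. H p (?f p))" using sg[of W i \<psi>, OF W] by simp
    qed
  next
    assume R: ?R
    \<comment> \<open>The hypothesis speaks of vectors with one nonzero component; additivity of the
      resolvent, again by uniqueness, extends it to arbitrary vectors.\<close>
    have WR: "(\<Sum>i\<in>UNIV. W i (\<Psi> i)) = (\<Sum>p\<in>UNIV. H p (res \<Psi> p))" if \<Psi>: "\<And>i. \<Psi> i \<in> RR I" for \<Psi>
    proof -
      note r = res[of "single i (\<Psi> i)" for i, OF single_RR[OF \<Psi>]]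
      define \<Phi> where "\<Phi> = (\<lambda>p t. \<Sum>i\<in>UNIV. res (single i (\<Psi> i)) p t)"
      have \<Phi>R: "\<Phi> p \<in> RR I" for p unfolding \<Phi>_def by (intro RR_sum r)
      define F where "F = (\<Union>i. range (res (single i (\<Psi> i))))"
      have "finite F" "F \<subseteq> RR I" using r by (auto simp: F_def)
      then obtain u w where w: "window u w" "\<forall>h\<in>F. van u w h" using window_set by meson
      have V: "VV u w (res (single i (\<Psi> i)))" for i using w(2) RR_GG r(1) unfolding VV_def F_def by blast
      have "ae_eq I (\<Phi> p) (res \<Psi> p)" for p
      proof (rule res_unique[OF \<Psi> \<Phi>R])
        fix p
        have K: "KK \<Phi> p t = (\<Sum>i\<in>UNIV. KK (res (single i (\<Psi> i))) p t)" for t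
          unfolding \<Phi>_def by (rule KK_sum[OF w(1) finite V])
        have "AE t in lebesgue_on I. \<forall>i\<in>UNIV. res (single i (\<Psi> i)) p t = single i (\<Psi> i) p t + KK (res (single i (\<Psi> i))) p t"
          using r(2) unfolding ae_eq_def by (intro AE_finite_allI) auto
        then show "ae_eq I (\<Phi> p) (\<lambda>t. \<Psi> p t + KK \<Phi> p t)"
          unfolding ae_eq_def K
        proof eventually_elim
          case (elim t)
          have "(\<Sum>i\<in>UNIV. single i (\<Psi> i) p t) = (\<Sum>i\<in>UNIV. if i = p then \<Psi> p t else 0)"
            by (intro sum.cong) (auto simp: single_def)
          then show ?case using elim by (simp add: \<Phi>_def sum.distrib)
        qed
      qed
      then have "H p (res \<Psi> p) = H p (\<Phi> p)" for p using RR_dual_cong[OF H \<Phi>R] by metis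
      also have "H p (\<Phi> p) = (\<Sum>i\<in>UNIV. H p (res (single i (\<Psi> i)) p))" for p
        unfolding \<Phi>_def by (rule RR_dual_sum[OF H r(1)])
      finally have "(\<Sum>p\<in>UNIV. H p (res \<Psi> p)) = (\<Sum>p\<in>UNIV. \<Sum>i\<in>UNIV. H p (res (single i (\<Psi> i)) p))" by simp
      also have "\<dots> = (\<Sum>i\<in>UNIV. W i (\<Psi> i))" by (subst sum.swap) (use R \<Psi> in simp)
      finally show ?thesis by simp
    qed
    show ?L
    proof (intro allI ballI)
      fix i \<phi> assume \<phi>: "\<phi> \<in> RR I"
      let ?s = "single i \<phi>"
      note s = single_RR[OF \<phi>, of i]
      \<comment> \<open>\<open>\<Psi>\<close> is the image of the unit vector under
        \<open>1 - KK\<close>, so its resolvent is that unit vector.\<close>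
      define \<Psi> where "\<Psi> = (\<lambda>p t. 1 * ?s p t + (-1) * KK ?s p t)"
      have K: "KK ?s p \<in> RR I" for p using KK_RR s by blast
      have \<Psi>: "\<Psi> p \<in> RR I" for p unfolding \<Psi>_def by (rule RR_lin[OF s K])
      have "ae_eq I (?s p) (res \<Psi> p)" for p
        by (rule res_unique[OF \<Psi> s], rule ae_eqI) (simp add: \<Psi>_def)
      then have "(\<Sum>p\<in>UNIV. H p (res \<Psi> p)) = (\<Sum>p\<in>UNIV. H p (?s p))" using RR_dual_cong[OF H s] by metis
      then have "H i \<phi> = (\<Sum>p\<in>UNIV. W p (\<Psi> p))" using sg[of H i \<phi>, OF H] WR[of \<Psi>, OF \<Psi>] by simp
      also have "\<dots> = (\<Sum>p\<in>UNIV. W p (?s p)) - (\<Sum>p\<in>UNIV. W p (KK ?s p))"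
        unfolding \<Psi>_def RR_dual_lin[OF W s K] by (simp add: sum_subtractf)
      also have "(\<Sum>p\<in>UNIV. W p (?s p)) = W i \<phi>" by (rule sg[OF W])
      also have "(\<Sum>p\<in>UNIV. W p (KK ?s p)) = (\<Sum>k<m. \<Sum>p\<in>UNIV. W p ((PP ^^ (m - k)) (\<lambda>s. A k i p s * \<phi> s)))"
      proof -
        have z: "(PP ^^ (m - k)) (\<lambda>s. A k j p s * ?s j s) = (\<lambda>_. 0)" if "j \<noteq> i" for k j p
        proof -
          have "PP (\<lambda>_. 0) = (\<lambda>_. 0)" by (simp add: fun_eq_iff PP_def prim_def)
          then have "(PP ^^ r) (\<lambda>_. 0) = (\<lambda>_. 0)" for r by (induction r) auto
          then show ?thesis using that by (simp add: single_def)
        qed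
        have "(\<Sum>k<m. \<Sum>p\<in>UNIV. W p ((PP ^^ (m - k)) (\<lambda>s. A k j p s * ?s j s))) =
          (if j = i then \<Sum>k<m. \<Sum>p\<in>UNIV. W p ((PP ^^ (m - k)) (\<lambda>s. A k i p s * \<phi> s)) else 0)" for j
          using z RR_dual_zero[OF W] by (auto simp: single_def)
        then show ?thesis unfolding KKW[of ?s, OF s] by simp
      qed
      finally show "W i \<phi> - (\<Sum>k<m. \<Sum>p\<in>UNIV. W p ((PP ^^ (m - k)) (\<lambda>s. A k i p s * \<phi> s))) = H i \<phi>" by simp
    qed
  qed
qed

end

section \<open>The Cauchy problem\<close>

lemma fun_sum_apply: "(\<Sum>i\<in>S. f i) x = (\<Sum>i\<in>S. (f i x :: 'b::comm_monoid_add))"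
  by (induction S rule: infinite_finite_induct) auto

section \<open>Functionals vanishing before the initial time and the explicit solution\<close>

locale cauchy_problem = volterra_system +
  fixes t0 :: real assumes t0: "t0 \<in> I" "c < t0"
begin

definition zdual :: "((real \<Rightarrow> complex) \<Rightarrow> complex) set" where
  "zdual = {f \<in> RR_dual I. zb t0 f}"

text \<open>Operators whose transposes preserve vanishing before \<open>t0\<close>: a support may
  spread to the right, but if it ended before \<open>t0\<close> it must still do so. For
  \<open>PP\<close> and the resolvent this relies on \<open>c < t0\<close>.\<close>

definition zop :: "((real \<Rightarrow> complex) \<Rightarrow> (real \<Rightarrow> complex)) \<Rightarrow> bool" where
  "zop T \<longleftrightarrow> RR_op T \<and> (\<forall>\<phi>\<in>RR I. \<forall>u v. van u v \<phi> \<longrightarrow> v < t0 \<longrightarrow> (\<exists>u' v'. v' < t0 \<and> van u' v' (T \<phi>)))"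

lemma zb_I:
  assumes "\<And>\<phi> u v. \<phi> \<in> RR I \<Longrightarrow> van u v \<phi> \<Longrightarrow> v < t0 \<Longrightarrow> f \<phi> = 0" shows "zb t0 f"
  unfolding zb_def
proof (intro ballI impI)
  fix \<phi> assume \<phi>: "\<phi> \<in> RR I" "gsupp I \<phi> \<subseteq> I \<inter> {..<t0}"
  have "open (I \<inter> {..<t0})" "I \<inter> {..<t0} \<noteq> {}" using open_I c_I t0 by (auto intro: open_Int)
  then obtain u v where v: "v \<in> I \<inter> {..<t0}" "van u v \<phi>"
    using RR_van_in[OF \<phi>(1) _ _ Int_lower1 \<phi>(2)] by blast
  then show "f \<phi> = 0" using assms[OF \<phi>(1) v(2)] by simp
qed

lemma zdual_dual: "f \<in> zdual \<Longrightarrow> f \<in> RR_dual I"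
  and zdual_zb: "f \<in> zdual \<Longrightarrow> zb t0 f"
  by (auto simp: zdual_def)

lemma zdual_outside: "f \<in> zdual \<Longrightarrow> \<phi> \<notin> RR I \<Longrightarrow> f \<phi> = 0"
  using zdual_dual RR_dual_outside by blast

lemma zdual_add: "f \<in> zdual \<Longrightarrow> g \<in> zdual \<Longrightarrow> (\<lambda>\<phi>. f \<phi> + g \<phi>) \<in> zdual"
  by (auto simp: zdual_def zb_def intro: RR_dual_fun_add)

lemma zdual_diff: "f \<in> zdual \<Longrightarrow> g \<in> zdual \<Longrightarrow> (\<lambda>\<phi>. f \<phi> - g \<phi>) \<in> zdual"
  by (auto simp: zdual_def zb_def intro: RR_dual_fun_diff)

lemma zdual_cmult: "f \<in> zdual \<Longrightarrow> (\<lambda>\<phi>. l * f \<phi>) \<in> zdual"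
  by (auto simp: zdual_def zb_def intro: RR_dual_fun_cmult)

lemma zdual_zero: "(\<lambda>_. 0) \<in> zdual"
  by (auto simp: zdual_def zb_def intro: RR_dual_zero_fun)

lemma zdual_sum: "(\<And>i. i \<in> S \<Longrightarrow> f i \<in> zdual) \<Longrightarrow> (\<lambda>\<phi>. \<Sum>i\<in>S. f i \<phi>) \<in> zdual"
  by (induction S rule: infinite_finite_induct) (auto intro: zdual_add zdual_zero)

lemma zdual_pull: assumes "zop T" "f \<in> zdual" shows "pull T f \<in> zdual"
  unfolding zdual_def
proof (intro CollectI conjI)
  have T: "RR_op T" using assms(1) by (simp add: zop_def)
  show "pull T f \<in> RR_dual I" by (rule pull_RR_dual[OF T zdual_dual[OF assms(2)]])
  show "zb t0 (pull T f)"
  proof (rule zb_I)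
    fix \<phi> u v assume \<phi>: "\<phi> \<in> RR I" "van u v \<phi>" "v < t0"
    then obtain u' v' where "v' < t0" "van u' v' (T \<phi>)" using assms(1) unfolding zop_def by blast
    then show "pull T f \<phi> = 0" using zb_van[OF zdual_zb[OF assms(2)] RR_op_RR[OF T \<phi>(1)]] by (simp add: pull_def)
  qed
qed

lemma zop_PP: "zop PP"
  unfolding zop_def
proof (intro conjI ballI allI impI RR_op_PP)
  fix \<phi> u v assume v: "van u v \<phi>" "v < t0"
  have "max c v \<in> I" using v(1) c_I by (simp add: van_def max_def)
  then have "van c (max c v) (PP \<phi>)" using van_PP[OF v(1)] by simp
  then show "\<exists>u' v'. v' < t0 \<and> van u' v' (PP \<phi>)" using v(2) t0 by (intro exI[of _ c] exI[of _ "max c v"]) simp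
qed

lemma zop_mult: "g \<in> GGinf I \<Longrightarrow> zop (\<lambda>\<phi> t. g t * \<phi> t)"
  unfolding zop_def using RR_op_mult van_mult by blast

lemma zop_res: "zop (\<lambda>\<psi>. res (single i \<psi>) p)"
  unfolding zop_def
proof (intro conjI ballI allI impI RR_op_res)
  fix \<phi> u v assume \<phi>: "\<phi> \<in> RR I" "van u v \<phi>" "v < t0"
  define x where "x = min u c"
  define w where "w = max v c"
  have i: "x \<in> I" "w \<in> I" and win: "window x w"
    using \<phi>(2) c_I by (auto simp: van_def x_def w_def min_def max_def window_def)
  have v: "van x w \<phi>" using van_mono[OF \<phi>(2) i] by (simp add: x_def w_def)
  obtain \<Phi> where \<Phi>: "VV x w \<Phi>" "\<forall>p. ae_eq I (\<Phi> p) (res (single i \<phi>) p)"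
    using res_window[OF win RR_GGinf[OF \<phi>(1)] v] by blast
  then have "van x w (res (single i \<phi>) p)" using van_cong[OF VV_D(2)[OF \<Phi>(1)]] \<Phi>(2) by blast
  then show "\<exists>u' v'. v' < t0 \<and> van u' v' (res (single i \<phi>) p)" using \<phi>(3) t0 by (intro exI[of _ x] exI[of _ w]) (simp add: w_def)
qed

abbreviation pulls :: "nat \<Rightarrow> ((real \<Rightarrow> complex) \<Rightarrow> complex) \<Rightarrow> ((real \<Rightarrow> complex) \<Rightarrow> complex)" where
  "pulls r f \<equiv> (pull PP ^^ r) f"

lemma zdual_pulls: "f \<in> zdual \<Longrightarrow> pulls r f \<in> zdual"
  by (induction r) (auto intro: zdual_pull zop_PP)

lemma pulls_apply: "\<phi> \<in> RR I \<Longrightarrow> pulls r f \<phi> = f ((PP ^^ r) \<phi>)"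
proof (induction r arbitrary: \<phi>)
  case (Suc r)
  have "pulls (Suc r) f \<phi> = pulls r f (PP \<phi>)" using Suc.prems by (simp add: pull_def[of PP "pulls r f"])
  also have "\<dots> = f ((PP ^^ r) (PP \<phi>))" by (rule Suc.IH[OF RR_PP[OF Suc.prems]])
  also have "(PP ^^ r) (PP \<phi>) = (PP ^^ Suc r) \<phi>" by (simp add: funpow_swap1)
  finally show ?case .
qed simp

lemma pull_add: "pull T (\<lambda>\<phi>. f \<phi> + g \<phi>) = (\<lambda>\<phi>. pull T f \<phi> + pull T g \<phi>)"
  and pull_diff: "pull T (\<lambda>\<phi>. f \<phi> - g \<phi>) = (\<lambda>\<phi>. pull T f \<phi> - pull T g \<phi>)"
  and pull_cmult: "pull T (\<lambda>\<phi>. l * f \<phi>) = (\<lambda>\<phi>. l * pull T f \<phi>)"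
  and pull_sum: "pull T (\<lambda>\<phi>. \<Sum>i\<in>S. h i \<phi>) = (\<lambda>\<phi>. \<Sum>i\<in>S. pull T (h i) \<phi>)"
  by (auto simp: pull_def fun_eq_iff)

lemma pull_pulls: "k < j \<Longrightarrow> pull PP (pulls (j - Suc k) f) = pulls (j - k) f"
  by (simp add: Suc_diff_Suc[symmetric] del: Suc_diff_Suc)

lemma delta_slim: "\<phi> \<in> RR I \<Longrightarrow> delta I t0 r \<alpha> \<phi> =
    (-1) ^ r * (\<alpha> * slim True (uderivs I r \<phi>) t0 + (1 - \<alpha>) * slim False (uderivs I r \<phi>) t0)"
  by (simp add: delta_def slim_True slim_False)

lemma delta_zdual: "delta I t0 r \<alpha> \<in> zdual"
  unfolding zdual_def
proof (intro CollectI conjI RR_dual_I)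
  fix \<phi> \<psi> and x d :: complex assume \<phi>: "\<phi> \<in> RR I" and \<psi>: "\<psi> \<in> RR I"
  note G = RR_GGinf[OF \<phi>] RR_GGinf[OF \<psi>]
  have ae: "ae_eq I (uderivs I r (\<lambda>t. x * \<phi> t + d * \<psi> t)) (\<lambda>t. x * uderivs I r \<phi> t + d * uderivs I r \<psi> t)"
    using uderivs_add[OF GGinf_cmult[OF G(1), of x] GGinf_cmult[OF G(2), of d], of r]
      uderivs_cmult[OF G(1), of r x] uderivs_cmult[OF G(2), of r d]
    unfolding ae_eq_def by eventually_elim simp
  have sl: "slim b (uderivs I r (\<lambda>t. x * \<phi> t + d * \<psi> t)) t0 = x * slim b (uderivs I r \<phi>) t0 + d * slim b (uderivs I r \<psi>) t0" for b
    unfolding slim_cong(1)[OF open_I t0(1) ae] using t0 G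
    by (simp add: slim_add slim_cmult GG_cmult GGinf_GG uderivs_GGinf)
  show "delta I t0 r \<alpha> (\<lambda>t. x * \<phi> t + d * \<psi> t) = x * delta I t0 r \<alpha> \<phi> + d * delta I t0 r \<alpha> \<psi>"
    unfolding delta_slim[OF RR_lin[OF \<phi> \<psi>]] delta_slim[OF \<phi>] delta_slim[OF \<psi>] sl by (simp add: algebra_simps)
next
  show "dbound (delta I t0 r \<alpha>)"
    unfolding dbound_def
  proof (intro ballI impI exI[of _ r] exI[of _ "norm \<alpha> + norm (1 - \<alpha>)"] conjI allI)
    fix u v \<phi> B assume \<phi>: "\<phi> \<in> GGinf I" "van u v \<phi>" "ggb r B \<phi>"
    have "AE t in lebesgue_on I. norm (uderivs I r \<phi> t) \<le> B" using \<phi>(3) ggb_iff[OF \<phi>(1)] by blast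
    then have b: "norm (slim b (uderivs I r \<phi>) t0) \<le> B" for b
      using AE_imp_eventually_ess[OF open_I t0(1)] \<phi>(1) t0(1)
      by (intro slim_norm_le GGinf_GG uderivs_GGinf) auto
    have "norm (delta I t0 r \<alpha> \<phi>) \<le> norm \<alpha> * norm (slim True (uderivs I r \<phi>) t0) + norm (1 - \<alpha>) * norm (slim False (uderivs I r \<phi>) t0)"
      unfolding delta_slim[OF RR_I[OF \<phi>(1,2)]] norm_mult norm_power by (simp add: norm_mult[symmetric] norm_triangle_ineq)
    also have "\<dots> \<le> norm \<alpha> * B + norm (1 - \<alpha>) * B" using b by (intro add_mono mult_left_mono) auto
    finally show "norm (delta I t0 r \<alpha> \<phi>) \<le> (norm \<alpha> + norm (1 - \<alpha>)) * B" by (simp add: distrib_right)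
  qed simp
next
  show "zb t0 (delta I t0 r \<alpha>)"
  proof (rule zb_I)
    fix \<phi> u v assume \<phi>: "\<phi> \<in> RR I" "van u v \<phi>" "v < t0"
    have "van u v (uderivs I r \<phi>)"
    proof (induction r)
      case (Suc r)
      then show ?case
        using van_uderiv uderivs_has[OF RR_GGinf[OF \<phi>(1)]] GGinf_GG uderivs_GGinf[OF RR_GGinf[OF \<phi>(1)]] by blast
    qed (use \<phi> in simp)
    then have "slim b (uderivs I r \<phi>) t0 = 0" for b using van_slim t0(1) \<phi>(3) by force
    then show "delta I t0 r \<alpha> \<phi> = 0" by (simp add: delta_slim[OF \<phi>(1)])
  qed
qed (simp add: delta_def)

text \<open>The Heaviside distribution with jump at \<open>t0\<close>, that is, integration of the
  test function over the part of \<open>I\<close> beyond \<open>t0\<close>.\<close>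

definition heav :: "(real \<Rightarrow> complex) \<Rightarrow> complex" where
  "heav = pull PP (delta I t0 0 0)"

lemma heav_zdual: "heav \<in> zdual"
  unfolding heav_def by (rule zdual_pull[OF zop_PP delta_zdual])

text \<open>Since \<open>c < t0\<close>, the function \<open>PP \<phi>\<close> is continuous at
  \<open>t0\<close> and the weights \<open>\<alpha>\<close> and \<open>1 - \<alpha>\<close>
  recombine to 1. Here the dependence on \<open>\<alpha>\<close> disappears.\<close>

lemma pull_delta_0: "pull PP (delta I t0 0 \<alpha>) = heav"
proof -
  have "delta I t0 0 \<alpha> (PP \<phi>) = prim \<phi> t0" if \<phi>: "\<phi> \<in> RR I" for \<phi> \<alpha>
  proof -
    obtain u v where v: "van u v \<phi>" using RR_van[OF \<phi>] .
    have "slim b (PP \<phi>) t0 = prim \<phi> t0" for b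
      unfolding slim_PP[OF RR_GG[OF \<phi>] v t0(1)] slim_ind using t0(2) by simp
    then show ?thesis using RR_PP[OF \<phi>] by (simp add: delta_slim algebra_simps)
  qed
  then show ?thesis by (simp add: heav_def fun_eq_iff pull_def)
qed

text \<open>One derivative of \<open>PP \<phi>\<close> gives back \<open>- \<phi>\<close> near
  \<open>t0\<close>, and the sign is absorbed by the power of -1 in \<open>delta\<close>.\<close>

lemma pull_delta_Suc: "pull PP (delta I t0 (Suc r) \<alpha>) = delta I t0 r \<alpha>"
proof -
  have "delta I t0 (Suc r) \<alpha> (PP \<phi>) = delta I t0 r \<alpha> \<phi>" if \<phi>: "\<phi> \<in> RR I" for \<phi>
  proof -
    obtain u v where v: "van u v \<phi>" using RR_van[OF \<phi>] .
    note G = RR_GGinf[OF \<phi>]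
    have cut: "ae_eq I (uderivs I r (\<lambda>t. ind c t * \<phi> t)) (\<lambda>t. ind c t * uderivs I r \<phi> t)"
    proof (induction r)
      case (Suc r)
      have g: "(\<lambda>t. ind c t * \<phi> t) \<in> GGinf I" by (rule GGinf_mult[OF GGinf_ind G])
      have "has_uderiv I (\<lambda>t. ind c t * uderivs I r \<phi> t) (\<lambda>t. 0 * uderivs I r \<phi> t + ind c t * uderivs I (Suc r) \<phi> t)"
        by (intro has_uderiv_mult has_uderiv_ind uderivs_has G GG_ind GGinf_GG uderivs_GGinf)
      then show ?case
        using has_uderiv_unique[OF has_uderiv_cong[OF uderivs_has[OF g] Suc ae_eq_refl]] by simp
    qed simp
    have "ae_eq I (uderivs I (Suc r) (PP \<phi>)) (uderivs I r (\<lambda>t. (-1) * (ind c t * \<phi> t)))"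
      using uderivs_step[OF RR_GGinf[OF RR_PP[OF \<phi>]] PP_uderiv(2)[OF RR_GG[OF \<phi>] v]] by simp
    moreover note uderivs_cmult[OF GGinf_mult[OF GGinf_ind G], of r "-1" c] cut
    ultimately have ae: "ae_eq I (uderivs I (Suc r) (PP \<phi>)) (\<lambda>t. (-1) * (ind c t * uderivs I r \<phi> t))"
      unfolding ae_eq_def by eventually_elim simp
    have "slim b (uderivs I (Suc r) (PP \<phi>)) t0 = - slim b (uderivs I r \<phi>) t0" for b
      unfolding slim_cong(1)[OF open_I t0(1) ae]
        slim_cmult[OF GG_mult[OF GG_ind GGinf_GG[OF uderivs_GGinf[OF G]]] t0(1)]
        slim_mult[OF GG_ind GGinf_GG[OF uderivs_GGinf[OF G]] t0(1)] slim_ind using t0(2) by simp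
    then show ?thesis using \<phi> RR_PP[OF \<phi>] by (simp add: delta_slim algebra_simps)
  qed
  then show ?thesis by (auto simp: fun_eq_iff pull_def delta_def)
qed

text \<open>All terms drop by one order, except the last, which is a delta of order 0 and turns into
  \<open>heav\<close>.\<close>

lemma delta_sum_pull:
  "pull PP (\<lambda>\<phi>. \<Sum>j<Suc k. x j * delta I t0 (Suc k - j - 1) \<alpha> \<phi>) =
     (\<lambda>\<phi>. (\<Sum>j<k. x j * delta I t0 (k - j - 1) \<alpha> \<phi>) + x k * heav \<phi>)"
proof -
  have "pull PP (delta I t0 (k - j) \<alpha>) = delta I t0 (k - j - 1) \<alpha>" if "j < k" for j
  proof -
    have e: "k - j = Suc (k - j - 1)" using that by arith
    show ?thesis by (subst e) (rule pull_delta_Suc)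
  qed
  then show ?thesis unfolding pull_sum pull_cmult by (simp add: pull_delta_0 cong: sum.cong_simp)
qed

text \<open>For the functions \<open>V k = Y k - (\<Sum>j<k. X j * delta (k - j - 1) \<alpha>)\<close> the parameter \<open>\<alpha>\<close>
  disappears: the chain condition becomes \<open>V k = V (k + 1) \<circ> PP + X k * heav\<close>.\<close>

lemma chain_closed_form:
  assumes "\<And>k. k < m \<Longrightarrow> V k = (\<lambda>\<phi>. pull PP (V (Suc k)) \<phi> + x k * heav \<phi>)"
  shows "k \<le> m \<Longrightarrow> V k = (\<lambda>\<phi>. pulls (m - k) (V m) \<phi> + (\<Sum>j\<in>{k..<m}. x j * pulls (j - k) heav \<phi>))"
proof (induction "m - k" arbitrary: k)
  case 0 then show ?case by simp
next
  case (Suc d)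
  then have k: "k < m" by simp
  have IH: "V (Suc k) = (\<lambda>\<phi>. pulls (m - Suc k) (V m) \<phi> + (\<Sum>j\<in>{Suc k..<m}. x j * pulls (j - Suc k) heav \<phi>))"
    using Suc k by (intro Suc.hyps(1)) auto
  have split: "{k..<m} = insert k {Suc k..<m}" using k by auto
  show ?case
    unfolding assms[OF k] IH pull_add pull_sum pull_cmult
    by (simp add: split fun_eq_iff pull_pulls k cong: sum.cong_simp)
qed

text \<open>\<open>derivs_imp_pull\<close> at each level; it also supplies membership in the dual
  for the next level, so only the start of the chain needs it as a hypothesis.\<close>

lemma chain_pull:
  assumes Y0: "Y 0 \<in> RR_dual I" and ch: "\<And>k. k < m \<Longrightarrow> Y (Suc k) \<in> derivs I (Y k)"
    and z: "\<And>k. k \<le> m \<Longrightarrow> zb t0 (Y k)"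
  shows "k \<le> m \<Longrightarrow> Y k \<in> zdual" "k < m \<Longrightarrow> Y k = pull PP (Y (Suc k))"
proof -
  have d: "Y k \<in> RR_dual I" if "k \<le> m" for k
    using that
  proof (induction k)
    case (Suc k)
    then show ?case using derivs_imp_pull(1)[OF _ z ch z t0(2,1)] by simp
  qed (rule Y0)
  show "k \<le> m \<Longrightarrow> Y k \<in> zdual" using d z by (simp add: zdual_def)
  show "k < m \<Longrightarrow> Y k = pull PP (Y (Suc k))" using derivs_imp_pull(2)[OF d z ch z t0(2,1)] by simp
qed

text \<open>Inserting the closed form of the chain into the lower-order terms splits off a part
  built from the initial values alone, which joins the inhomogeneity.\<close>

definition rhs :: "('a \<Rightarrow> (real \<Rightarrow> complex) \<Rightarrow> complex) \<Rightarrow> (nat \<Rightarrow> 'a \<Rightarrow> complex) \<Rightarrow> 'a \<Rightarrow> (real \<Rightarrow> complex) \<Rightarrow> complex" where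
  "rhs f x i \<phi> = f i \<phi> + (\<Sum>k<m. \<Sum>p\<in>UNIV. \<Sum>j\<in>{k..<m}. x j p * pull (\<lambda>\<phi> s. A k i p s * \<phi> s) (pulls (j - k) heav) \<phi>)"

definition top_deriv :: "('a \<Rightarrow> (real \<Rightarrow> complex) \<Rightarrow> complex) \<Rightarrow> (nat \<Rightarrow> 'a \<Rightarrow> complex) \<Rightarrow> 'a \<Rightarrow> (real \<Rightarrow> complex) \<Rightarrow> complex" where
  "top_deriv f x i \<phi> = (\<Sum>p\<in>UNIV. pull (\<lambda>\<psi>. res (single i \<psi>) p) (rhs f x p) \<phi>)"

text \<open>Taylor's formula with integral remainder: \<open>pulls r heav\<close> represents
  \<open>(t - t0) ^ r / fact r\<close> beyond \<open>t0\<close>, and the first summand integrates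
  the highest derivative \<open>m - k\<close> times.\<close>

definition VS :: "('a \<Rightarrow> (real \<Rightarrow> complex) \<Rightarrow> complex) \<Rightarrow> (nat \<Rightarrow> 'a \<Rightarrow> complex) \<Rightarrow> nat \<Rightarrow> 'a \<Rightarrow> (real \<Rightarrow> complex) \<Rightarrow> complex" where
  "VS f x k i \<phi> = pulls (m - k) (top_deriv f x i) \<phi> + (\<Sum>j\<in>{k..<m}. x j i * pulls (j - k) heav \<phi>)"

lemma rhs_zdual: "(\<And>i. f i \<in> zdual) \<Longrightarrow> rhs f x i \<in> zdual"
  unfolding rhs_def[abs_def]
  by (intro zdual_add zdual_sum zdual_cmult zdual_pull zdual_pulls heav_zdual zop_mult A_GGinf) auto

lemma top_deriv_zdual: "(\<And>i. f i \<in> zdual) \<Longrightarrow> top_deriv f x i \<in> zdual"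
  unfolding top_deriv_def[abs_def] by (intro zdual_sum zdual_pull zop_res rhs_zdual)

lemma VS_zdual: "(\<And>i. f i \<in> zdual) \<Longrightarrow> VS f x k i \<in> zdual"
  unfolding VS_def[abs_def] by (intro zdual_add zdual_sum zdual_cmult zdual_pulls heav_zdual top_deriv_zdual)

lemma VS_m: "VS f x m i = top_deriv f x i"
  by (simp add: VS_def[abs_def])

lemma VS_step: assumes "k < m" shows "VS f x k i = (\<lambda>\<phi>. pull PP (VS f x (Suc k) i) \<phi> + x k i * heav \<phi>)"
proof -
  have split: "{k..<m} = insert k {Suc k..<m}" using assms by auto
  show ?thesis unfolding VS_def[abs_def] pull_add pull_sum pull_cmult
    by (simp add: split fun_eq_iff pull_pulls assms cong: sum.cong_simp)
qed

text \<open>With the closed form inserted, the only unknown left is \<open>V m\<close>, and the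
  equation is an instance of \<open>volterra_dual\<close>.\<close>

lemma cauchy_scalar:
  assumes f: "\<And>i. f i \<in> zdual" and V: "\<And>k i. k \<le> m \<Longrightarrow> V k i \<in> zdual"
    and step: "\<And>k i. k < m \<Longrightarrow> V k i = (\<lambda>\<phi>. pull PP (V (Suc k) i) \<phi> + x k i * heav \<phi>)"
  shows "(\<forall>i. \<forall>\<phi>\<in>RR I. V m i \<phi> - (\<Sum>k<m. \<Sum>p\<in>UNIV. pull (\<lambda>\<phi> s. A k i p s * \<phi> s) (V k p) \<phi>) = f i \<phi>)
     \<longleftrightarrow> (\<forall>k\<le>m. \<forall>i. V k i = VS f x k i)"
proof -
  let ?M = "\<lambda>k i p. pull (\<lambda>\<phi> s. A k i p s * \<phi> s)"
  have closed: "V k i = (\<lambda>\<phi>. pulls (m - k) (V m i) \<phi> + (\<Sum>j\<in>{k..<m}. x j i * pulls (j - k) heav \<phi>))" if "k \<le> m" for k i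
    by (rule chain_closed_form[of "\<lambda>k. V k i" "\<lambda>k. x k i", OF step that])
  have "V m i \<phi> - (\<Sum>k<m. \<Sum>p\<in>UNIV. ?M k i p (V k p) \<phi>) = f i \<phi> \<longleftrightarrow>
      V m i \<phi> - (\<Sum>k<m. \<Sum>p\<in>UNIV. V m p ((PP ^^ (m - k)) (\<lambda>s. A k i p s * \<phi> s))) = rhs f x i \<phi>" if \<phi>: "\<phi> \<in> RR I" for i \<phi>
  proof -
    have "?M k i p (V k p) \<phi> = V m p ((PP ^^ (m - k)) (\<lambda>s. A k i p s * \<phi> s)) + (\<Sum>j\<in>{k..<m}. x j p * ?M k i p (pulls (j - k) heav) \<phi>)"
      if k: "k < m" for k p
    proof -
      have "?M k i p (V k p) \<phi> = ?M k i p (pulls (m - k) (V m p)) \<phi> + (\<Sum>j\<in>{k..<m}. x j p * ?M k i p (pulls (j - k) heav) \<phi>)"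
        using closed[of k p] k by (simp add: pull_add pull_sum pull_cmult)
      moreover have "?M k i p (pulls (m - k) (V m p)) \<phi> = V m p ((PP ^^ (m - k)) (\<lambda>s. A k i p s * \<phi> s))"
        using \<phi> RR_mult[OF A_GGinf[OF k] \<phi>] by (simp add: pull_def[of "\<lambda>\<phi> s. A k i p s * \<phi> s"] pulls_apply)
      ultimately show ?thesis by simp
    qed
    then show ?thesis by (auto simp: rhs_def sum.distrib algebra_simps)
  qed
  then have "(\<forall>i. \<forall>\<phi>\<in>RR I. V m i \<phi> - (\<Sum>k<m. \<Sum>p\<in>UNIV. ?M k i p (V k p) \<phi>) = f i \<phi>) \<longleftrightarrow>
      (\<forall>i. \<forall>\<phi>\<in>RR I. V m i \<phi> - (\<Sum>k<m. \<Sum>p\<in>UNIV. V m p ((PP ^^ (m - k)) (\<lambda>s. A k i p s * \<phi> s))) = rhs f x i \<phi>)" by simp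
  also have "\<dots> \<longleftrightarrow> (\<forall>i. \<forall>\<psi>\<in>RR I. V m i \<psi> = (\<Sum>p\<in>UNIV. rhs f x p (res (single i \<psi>) p)))"
    using rhs_zdual[OF f] V zdual_dual by (intro volterra_dual) auto
  also have "\<dots> \<longleftrightarrow> (\<forall>i. V m i = top_deriv f x i)"
  proof -
    have "top_deriv f x i \<psi> = (\<Sum>p\<in>UNIV. rhs f x p (res (single i \<psi>) p))" if "\<psi> \<in> RR I" for i \<psi>
      using that by (simp add: top_deriv_def pull_def)
    moreover have "V m i \<psi> = top_deriv f x i \<psi>" if "\<psi> \<notin> RR I" for i \<psi>
      using that V[of m i] top_deriv_zdual[OF f] by (simp add: zdual_outside)
    ultimately show ?thesis unfolding fun_eq_iff by metis
  qed
  also have "\<dots> \<longleftrightarrow> (\<forall>k\<le>m. \<forall>i. V k i = VS f x k i)"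
  proof
    assume *: "\<forall>i. V m i = top_deriv f x i"
    show "\<forall>k\<le>m. \<forall>i. V k i = VS f x k i"
    proof (intro allI impI)
      fix k i assume "k \<le> m"
      from closed[OF this, of i] show "V k i = VS f x k i" using * by (simp add: VS_def[abs_def])
    qed
  qed (auto simp: VS_m)
  finally show ?thesis .
qed

end

context cauchy_problem
begin

lemma zero_before_zb: "zero_before I t0 Z \<longleftrightarrow> (\<forall>i j. zb t0 (Z $ i $ j))"
  unfolding zero_before_def zb_def by blast

definition VY :: "(nat \<Rightarrow> 'a mat_dist) \<Rightarrow> (nat \<Rightarrow> complex ^ 'a ^ 'a) \<Rightarrow> complex \<Rightarrow> nat \<Rightarrow> 'a \<Rightarrow> 'a \<Rightarrow>
    (real \<Rightarrow> complex) \<Rightarrow> complex" where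
  "VY Y X \<alpha> k i q \<phi> = (Y k $ i $ q) \<phi> - (\<Sum>j<k. X j $ i $ q * delta I t0 (k - j - 1) \<alpha> \<phi>)"

lemma VY_entry: "(Y k - (\<Sum>j<k. const_mult (X j) (delta I t0 (k - j - 1) \<alpha>))) $ i $ q = VY Y X \<alpha> k i q"
  by (simp add: fun_eq_iff VY_def fun_sum_apply const_mult_def)

text \<open>The coefficients multiply from the left, so the columns \<open>q\<close> decouple and
  each satisfies a vector equation.\<close>

lemma equation_iff:
  assumes M: "\<And>k i p. M k $ i $ p = A k i p"
  shows "Y m - (\<Sum>j<m. const_mult (X j) (delta I t0 (m - j - 1) \<alpha>))
      - (\<Sum>k<m. fun_mult I (M k) (Y k - (\<Sum>j<k. const_mult (X j) (delta I t0 (k - j - 1) \<alpha>)))) = F \<longleftrightarrow>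
    (\<forall>i q \<phi>. VY Y X \<alpha> m i q \<phi> - (\<Sum>k<m. \<Sum>p\<in>UNIV. pull (\<lambda>\<phi> s. A k i p s * \<phi> s) (VY Y X \<alpha> k p q) \<phi>) = (F $ i $ q) \<phi>)"
proof -
  have 1: "fun_mult I (M k) (Y k - (\<Sum>j<k. const_mult (X j) (delta I t0 (k - j - 1) \<alpha>))) $ i $ q =
      (\<Sum>p\<in>UNIV. pull (\<lambda>\<phi> s. A k i p s * \<phi> s) (VY Y X \<alpha> k p q))" for k i q
    unfolding fun_mult_def vec_lambda_beta VY_entry M mult_dist_def pull_def ..
  show ?thesis
    unfolding vec_eq_iff vector_minus_component[of "_ - _"] vector_minus_component[of "(_ - _) $ _"] sum_component 1
    by (simp only: VY_entry fun_eq_iff minus_apply fun_sum_apply)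
qed

text \<open>Existence, uniqueness and independence of \<open>\<alpha>\<close> together: on the right
  stands one explicit matrix in which \<open>\<alpha>\<close> does not occur.\<close>

lemma cauchy_solution_iff:
  assumes M: "\<And>k i p. M k $ i $ p = A k i p" and F: "F \<in> mat_dual I" "zero_before I t0 F"
  shows "cauchy_solution I m M t0 \<alpha> F X Z \<longleftrightarrow>
    Z = (\<chi> i q. VS (\<lambda>i. F $ i $ q) (\<lambda>j i. X j $ i $ q) 0 i)" (is "?L \<longleftrightarrow> Z = ?S")
proof -
  have Fz: "F $ i $ q \<in> zdual" for i q using F unfolding mat_dual_def zero_before_zb zdual_def by blast
  let ?D = "\<lambda>k i q \<phi>. \<Sum>j<k. X j $ i $ q * delta I t0 (k - j - 1) \<alpha> \<phi>"
  have Dz: "?D k i q \<in> zdual" for k i q by (intro zdual_sum zdual_cmult delta_zdual)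
  have Dp: "pull PP (?D (Suc k) i q) = (\<lambda>\<phi>. ?D k i q \<phi> + X k $ i $ q * heav \<phi>)" for k i q
    by (rule delta_sum_pull)
  show ?thesis
  proof
    assume ?L
    then obtain Y where Y: "Y 0 = Z" "deriv_chain I m Y" "\<forall>k<m. zero_before I t0 (Y k)"
      and eq: "\<And>i q \<phi>. VY Y X \<alpha> m i q \<phi> - (\<Sum>k<m. \<Sum>p\<in>UNIV. pull (\<lambda>\<phi> s. A k i p s * \<phi> s) (VY Y X \<alpha> k p q) \<phi>) = (F $ i $ q) \<phi>"
      unfolding cauchy_solution_def equation_iff[OF M] by blast
    have zk: "zb t0 (Y k $ i $ q)" if "k < m" for k i q using Y(3) that unfolding zero_before_zb by blast
    have VYz: "VY Y X \<alpha> k i q \<phi> = 0" if "k < m" "\<phi> \<in> RR I" "van u v \<phi>" "v < t0" for k i q \<phi> u v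
      using zb_van[OF zk[OF that(1)] that(2-4)] zb_van[OF zdual_zb[OF Dz] that(2-4)] by (simp add: VY_def)
    \<comment> \<open>The initial conditions cover the orders below \<open>m\<close> only; vanishing
      of the highest derivative is read off from the equation, all other terms of which vanish
      before \<open>t0\<close>.\<close>
    have zm: "zb t0 (Y m $ i $ q)" for i q
    proof (rule zb_I)
      fix \<phi> u v assume \<phi>: "\<phi> \<in> RR I" "van u v \<phi>" "v < t0"
      have "pull (\<lambda>\<phi> s. A k i p s * \<phi> s) (VY Y X \<alpha> k p q) \<phi> = 0" if "k < m" for k p
        using VYz[OF that RR_mult[OF A_GGinf[OF that] \<phi>(1)] van_mult[OF \<phi>(2)] \<phi>(3)] \<phi>(1) by (simp add: pull_def)
      then have "VY Y X \<alpha> m i q \<phi> = 0" using eq[of i q \<phi>] zb_van[OF zdual_zb[OF Fz] \<phi>] by simp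
      then show "(Y m $ i $ q) \<phi> = 0" using zb_van[OF zdual_zb[OF Dz] \<phi>] by (simp add: VY_def)
    qed
    have z: "zb t0 (Y k $ i $ q)" if "k \<le> m" for k i q using zk zm that by (cases "k = m") auto
    have Y0: "Y 0 $ i $ q \<in> RR_dual I" and ch: "k < m \<Longrightarrow> Y (Suc k) $ i $ q \<in> derivs I (Y k $ i $ q)" for i q k
      using Y(2) unfolding deriv_chain_def mat_dual_def by blast+
    have c1: "Y k $ i $ q \<in> zdual" if "k \<le> m" for k i q
      by (rule chain_pull(1)[of "\<lambda>k. Y k $ i $ q", OF Y0 ch z that])
    have c2: "Y k $ i $ q = pull PP (Y (Suc k) $ i $ q)" if "k < m" for k i q
      by (rule chain_pull(2)[of "\<lambda>k. Y k $ i $ q", OF Y0 ch z that])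
    have VYe: "VY Y X \<alpha> k i q = (\<lambda>\<phi>. (Y k $ i $ q) \<phi> - ?D k i q \<phi>)" for k i q by (simp add: fun_eq_iff VY_def)
    have V0: "VY Y X \<alpha> 0 i q = VS (\<lambda>i. F $ i $ q) (\<lambda>j i. X j $ i $ q) 0 i" for i q
    proof -
      have "\<forall>k\<le>m. \<forall>i. VY Y X \<alpha> k i q = VS (\<lambda>i. F $ i $ q) (\<lambda>j i. X j $ i $ q) k i"
      proof (rule cauchy_scalar[THEN iffD1])
        show "VY Y X \<alpha> k i q \<in> zdual" if "k \<le> m" for k i
          unfolding VYe by (intro zdual_diff c1[OF that] Dz)
        show "VY Y X \<alpha> k i q = (\<lambda>\<phi>. pull PP (VY Y X \<alpha> (Suc k) i q) \<phi> + X k $ i $ q * heav \<phi>)" if k: "k < m" for k i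
        proof -
          have "Y k $ i $ q = pull PP (Y (Suc k) $ i $ q)" by (rule c2[OF k])
          then show ?thesis unfolding VYe pull_diff Dp by (simp add: fun_eq_iff)
        qed
      qed (use Fz eq in auto)
      then show ?thesis by blast
    qed
    show "Z = ?S"
      unfolding vec_eq_iff using V0 Y(1) by (simp add: VY_def[abs_def])
  next
    assume Z: "Z = ?S"
    define V where "V = (\<lambda>k i q. VS (\<lambda>i. F $ i $ q) (\<lambda>j i. X j $ i $ q) k i)"
    \<comment> \<open>The delta part is added back for the given \<open>\<alpha>\<close>; at order 0
      this sum is empty, so the solution itself is unaffected.\<close>
    define Y where "Y = (\<lambda>k. \<chi> i q. (\<lambda>\<phi>. V k i q \<phi> + ?D k i q \<phi>))"
    have Vz: "V k i q \<in> zdual" for k i q unfolding V_def by (rule VS_zdual[OF Fz])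
    have Ye: "Y k $ i $ q = (\<lambda>\<phi>. V k i q \<phi> + ?D k i q \<phi>)" for k i q by (simp add: Y_def)
    have Yz: "Y k $ i $ q \<in> zdual" for k i q unfolding Ye by (rule zdual_add[OF Vz Dz])
    have VYV: "VY Y X \<alpha> k i q = V k i q" for k i q by (simp add: fun_eq_iff VY_def Ye)
    have Ys: "Y k $ i $ q = pull PP (Y (Suc k) $ i $ q)" if "k < m" for k i q
    proof -
      have "V k i q = (\<lambda>\<phi>. pull PP (V (Suc k) i q) \<phi> + X k $ i $ q * heav \<phi>)" unfolding V_def by (rule VS_step[OF that])
      then show ?thesis unfolding Ye pull_add Dp by (simp add: fun_eq_iff)
    qed
    have "Y 0 = Z" by (simp add: Z Y_def V_def vec_eq_iff)
    moreover have "deriv_chain I m Y"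
      unfolding deriv_chain_def mat_dual_def
      using Yz derivs_pull_PP[OF zdual_dual[OF Yz] zdual_zb[OF Yz] t0(2)] Ys by (auto intro: zdual_dual)
    moreover have "\<forall>k<m. zero_before I t0 (Y k)" unfolding zero_before_zb using Yz zdual_zb by blast
    moreover have "VY Y X \<alpha> m i q \<phi> - (\<Sum>k<m. \<Sum>p\<in>UNIV. pull (\<lambda>\<phi> s. A k i p s * \<phi> s) (VY Y X \<alpha> k p q) \<phi>) = (F $ i $ q) \<phi>" for i q \<phi>
    proof (cases "\<phi> \<in> RR I")
      case True
      have "\<forall>i. \<forall>\<phi>\<in>RR I. V m i q \<phi> - (\<Sum>k<m. \<Sum>p\<in>UNIV. pull (\<lambda>\<phi> s. A k i p s * \<phi> s) (V k p q) \<phi>) = (F $ i $ q) \<phi>"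
        by (rule cauchy_scalar[where V = "\<lambda>k i. V k i q" and f = "\<lambda>i. F $ i $ q" and x = "\<lambda>j i. X j $ i $ q", THEN iffD2])
          (use Fz Vz VS_step in \<open>auto simp: V_def\<close>)
      then show ?thesis using True unfolding VYV by blast
    next
      case False
      then show ?thesis unfolding VYV using zdual_outside[OF Vz] zdual_outside[OF Fz] by (simp add: pull_def)
    qed
    ultimately show ?L unfolding cauchy_solution_def equation_iff[OF M] by blast
  qed
qed

section \<open>Weak* continuity of the solution map\<close>

lemma continuous_map_cmult: "continuous_map T euclidean g \<Longrightarrow> continuous_map T euclidean (\<lambda>x. g x * (l :: complex))"
  using continuous_map_compose[of T euclidean g euclidean "\<lambda>z. z * l"]
  by (simp add: comp_def continuous_intros)

lemma continuous_map_entry: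
  assumes "\<phi> \<in> RR I" shows "continuous_map (mat_weak_star I) euclidean (\<lambda>F :: 'a mat_dist. (F $ i $ q) \<phi>)"
proof -
  have "continuous_map (product_topology (\<lambda>_. weak_star I) (UNIV :: ('a \<times> 'a) set)) (weak_star I) (\<lambda>h. h (i, q))"
    by (rule continuous_map_product_projection) simp
  from continuous_map_pullback[OF this, of "mat_dual I" "\<lambda>Z. \<lambda>(i, j). Z $ i $ j"]
  have 1: "continuous_map (mat_weak_star I) (weak_star I) (\<lambda>F :: 'a mat_dist. F $ i $ q)"
    by (simp add: mat_weak_star_def comp_def)
  have "continuous_map (product_topology (\<lambda>_. euclidean) (RR I)) euclidean (\<lambda>h :: (real \<Rightarrow> complex) \<Rightarrow> complex. h \<phi>)"
    by (rule continuous_map_product_projection[OF assms])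
  from continuous_map_pullback[OF this, of "RR_dual I" "\<lambda>f. restrict f (RR I)"]
  have "continuous_map (weak_star I) euclidean (\<lambda>f. f \<phi>)" using assms by (simp add: weak_star_def comp_def)
  from continuous_map_compose[OF 1 this] show ?thesis by (simp add: comp_def)
qed

text \<open>Both topologies are pulled back from products, so continuity into them is continuity of
  each entry evaluated at each test function.\<close>

lemma continuous_map_mat_weak_star:
  assumes ent: "\<And>i q \<phi>. \<phi> \<in> RR I \<Longrightarrow> continuous_map T euclidean (\<lambda>x. (S x $ i $ q) \<phi>)"
    and dual: "\<And>x. x \<in> topspace T \<Longrightarrow> S x \<in> mat_dual I"
  shows "continuous_map T (mat_weak_star I) (S :: _ \<Rightarrow> 'a mat_dist)"
  unfolding mat_weak_star_def
proof (rule continuous_map_pullback')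
  show "topspace T \<subseteq> S -` mat_dual I" using dual by blast
  have "continuous_map T (weak_star I) (\<lambda>x. S x $ i $ q)" for i q
    unfolding weak_star_def
  proof (rule continuous_map_pullback')
    show "topspace T \<subseteq> (\<lambda>x. S x $ i $ q) -` RR_dual I" using dual unfolding mat_dual_def by blast
    show "continuous_map T (product_topology (\<lambda>_. euclidean) (RR I)) ((\<lambda>f. restrict f (RR I)) \<circ> (\<lambda>x. S x $ i $ q))"
      unfolding continuous_map_componentwise comp_def using ent by (auto simp: restrict_def extensional_def)
  qed
  then show "continuous_map T (product_topology (\<lambda>_. weak_star I) UNIV) ((\<lambda>Z (i, j). Z $ i $ j) \<circ> S)"
    unfolding continuous_map_componentwise_UNIV by (auto simp: comp_def)
qed

lemma solution_continuous:
  "continuous_map (prod_topology (subtopology (mat_weak_star I) {F. zero_before I t0 F}) (product_topology (\<lambda>_. euclidean) {..<m}))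
     (mat_weak_star I) (\<lambda>(F, X). (\<chi> i q. VS (\<lambda>i. F $ i $ q) (\<lambda>j i. X j $ i $ q) 0 i) :: 'a mat_dist)"
  (is "continuous_map ?T _ _")
proof (rule continuous_map_mat_weak_star)
  fix x assume "x \<in> topspace ?T"
  then obtain F X where x: "x = (F, X)" "F \<in> mat_dual I" "zero_before I t0 F"
    by (auto simp: mat_weak_star_def topspace_pullback_topology)
  then have "F $ i $ q \<in> zdual" for i q unfolding mat_dual_def zero_before_zb zdual_def by blast
  then show "(case x of (F, X) \<Rightarrow> \<chi> i q. VS (\<lambda>i. F $ i $ q) (\<lambda>j i. X j $ i $ q) 0 i) \<in> mat_dual I"
    using x(1) VS_zdual zdual_dual by (simp add: mat_dual_def)
next
  fix i q \<phi> assume \<phi>: "\<phi> \<in> RR I"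
  have cF: "continuous_map ?T euclidean (\<lambda>x. (fst x $ p $ r) \<psi>)" if "\<psi> \<in> RR I" for p r \<psi>
    using continuous_map_compose[OF continuous_map_fst continuous_map_from_subtopology[OF continuous_map_entry[OF that]]]
    by (simp add: comp_def)
  have cX: "continuous_map ?T euclidean (\<lambda>x. snd x j $ p $ r)" if "j < m" for j p r
  proof -
    have "continuous_map (product_topology (\<lambda>_. euclidean) {..<m}) euclidean (\<lambda>X. X j)"
      by (rule continuous_map_product_projection) (use that in simp)
    from continuous_map_compose[OF continuous_map_compose[OF continuous_map_snd this], of euclidean "\<lambda>z. z $ p $ r"]
    show ?thesis by (simp add: comp_def continuous_intros)
  qed
  let ?\<psi> = "(PP ^^ m) \<phi>"
  have \<psi>: "?\<psi> \<in> RR I" by (rule PPn_RR[OF \<phi>])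
  have r: "res (single i ?\<psi>) p \<in> RR I" for p by (rule res(1)[OF single_RR[OF \<psi>]])
  \<comment> \<open>The test functions at which \<open>f\<close> is evaluated depend on
    \<open>\<phi>\<close> alone, so \<open>f\<close> and \<open>x\<close> enter through finitely
    many continuous evaluations.\<close>
  have eq: "VS f x 0 i \<phi> = (\<Sum>p\<in>UNIV. rhs f x p (res (single i ?\<psi>) p)) + (\<Sum>j\<in>{0..<m}. x j i * pulls j heav \<phi>)" for f x
    using \<phi> \<psi> by (simp add: VS_def pulls_apply[OF \<phi>, of _ "top_deriv f x i"] top_deriv_def pull_def[of "\<lambda>\<psi>. res (single i \<psi>) _"])
  have "continuous_map ?T euclidean (\<lambda>x. VS (\<lambda>i. fst x $ i $ q) (\<lambda>j i. snd x j $ i $ q) 0 i \<phi>)"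
    unfolding eq rhs_def
    by (intro continuous_map_add continuous_map_sum continuous_map_cmult cF cX r) auto
  then show "continuous_map ?T euclidean (\<lambda>x. ((case x of (F, X) \<Rightarrow> \<chi> i q. VS (\<lambda>i. F $ i $ q) (\<lambda>j i. X j $ i $ q) 0 i) $ i $ q) \<phi>)"
    by (simp add: case_prod_unfold)
qed

end

theorem theorem3p5:
  fixes a b :: ereal and I :: "real set" and t0 :: real and m :: nat
    and A :: "nat \<Rightarrow> (real \<Rightarrow> complex) ^ 'n ^ 'n"
  assumes I: "I = einterval a b"
    and m: "1 \<le> m"
    and A: "\<And>k i j. k < m \<Longrightarrow> A k $ i $ j \<in> GGinf I"
    and t0: "t0 \<in> I"
  shows "\<exists>S :: 'n mat_dist \<times> (nat \<Rightarrow> complex ^ 'n ^ 'n) \<Rightarrow> 'n mat_dist.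
    (\<forall>F\<in>mat_dual I. zero_before I t0 F \<longrightarrow>
       (\<forall>X\<in>{..<m} \<rightarrow>\<^sub>E UNIV. \<forall>\<alpha> Z. cauchy_solution I m A t0 \<alpha> F X Z \<longleftrightarrow> Z = S (F, X))) \<and>
    continuous_map
      (prod_topology (subtopology (mat_weak_star I) {F. zero_before I t0 F})
                     (product_topology (\<lambda>_. euclidean) {..<m}))
      (mat_weak_star I) S"
proof -
  have oI: "open I" unfolding I by (rule open_einterval)
  have iI: "is_interval I"
    unfolding I is_interval_1
  proof (intro ballI allI impI)
    fix x y z assume "x \<in> einterval a b" "y \<in> einterval a b" "x \<le> z \<and> z \<le> y"
    then have "a < ereal x" "ereal x \<le> ereal z" "ereal z \<le> ereal y" "ereal y < b" by (auto simp: einterval_def)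
    then have "a < ereal z" "ereal z < b" using less_le_trans le_less_trans by blast+
    then show "z \<in> einterval a b" by (simp add: einterval_def)
  qed
  obtain r where r: "r > 0" "ball t0 r \<subseteq> I" using oI t0 open_contains_ball by blast
  \<comment> \<open>As \<open>I\<close> is open it contains a point strictly to the left of
    \<open>t0\<close>, at which primitives can be truncated.\<close>
  define c where "c = t0 - r / 2"
  have c: "c \<in> I" "c < t0" using r by (auto simp: c_def subset_iff dist_real_def)
  interpret cauchy_problem I c m "\<lambda>k i p. A k $ i $ p" t0
    by unfold_locales (use oI iI t0 c A in auto)
  show ?thesis
    by (rule exI[of _ "\<lambda>(F, X). \<chi> i q. VS (\<lambda>i. F $ i $ q) (\<lambda>j i. X j $ i $ q) 0 i"])
      (use cauchy_solution_iff[of A] solution_continuous in auto)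
qed

end
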